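(* Let $d \ge 1$ be an integer, $\alpha > -1$ and $\gamma \in (-1,\infty)^d$. The bound $$\left\| u - S^{\alpha,\gamma}_N (u) \right\|_{\alpha,\gamma;1} \leq C \, N^{1/2} \, \|u\|_{\alpha,\gamma;1} \qquad (\forall\, u \in \mathrm{H}^1_{\alpha,\gamma},\ \forall\, N \in \mathbb{N}),$$ where $C = C(\alpha,\gamma)>0$, is sharp in the sense that the power $1/2$ on $N$ cannot be lowered; that is, for no real $s < 1/2$ does there exist a constant $C > 0$ such that $\| u - S^{\alpha,\gamma}_N (u) \|_{\alpha,\gamma;1} \leq C \, N^{s} \, \|u\|_{\alpha,\gamma;1}$ for all $u \in \mathrm{H}^1_{\alpha,\gamma}$ and all $N \in \mathbb{N}$.
   Context: $\mathbb{N}$ is the set of strictly positive integers. $B^d$ is the open unit ball of $\mathbb{R}^d$ and $\|\cdot\|$ (without subscript, on points) the Euclidean norm. The weight is $W_{\alpha,\gamma}(x) = (1-\|x\|^2)^\alpha \prod_{i=1}^d |x_i|^{\gamma_i}$ on $B^d$. $\mathrm{L}^2_{\alpha,\gamma} = \mathrm{L}^2(B^d, W_{\alpha,\gamma})$ with inner product $\langle u,v\rangle_{\alpha,\gamma} = \int_{B^d} u\,v\,W_{\alpha,\gamma}\,dx$ and norm $\|\cdot\|_{\alpha,\gamma}$. $S^{\alpha,\gamma}_N$ is the orthogonal projector of $\mathrm{L}^2_{\alpha,\gamma}$ onto the space $\Pi^d_N$ of real $d$-variate polynomials of total degree at most $N$. $\mathrm{C}^1(\overline{B^d})$ is the space of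 real functions which, with their first partial derivatives, are continuous up to the boundary. With $\sigma_j x := x - 2x_j e_j$, the Dunkl operators are $\mathcal{D}^{(\gamma)}_j u(x) := \partial_j u(x) + \frac{\gamma_j}{2}\frac{u(x) - u(\sigma_j x)}{x_j}$, $j \in \{1,\dots,d\}$, where for $x_j=0$ the ratio is interpreted as its limit $2\,\partial_j u(x)$. The norm $\|\cdot\|_{\alpha,\gamma;1}$ is given on $\mathrm{C}^1(\overline{B^d})$ by $\|u\|_{\alpha,\gamma;1}^2 = \|u\|_{\alpha,\gamma}^2 + \sum_{j=1}^d \|\mathcal{D}^{(\gamma)}_j u\|_{\alpha,\gamma}^2$, and $\mathrm{H}^1_{\alpha,\gamma}$ is the completion of $(\mathrm{C}^1(\overline{B^d}), \|\cdot\|_{\alpha,\gamma;1})$, with the extended norm denoted the same way. Elements of $\mathrm{H}^1_{\alpha,\gamma}$ are regarded as elements of $\mathrm{L}^2_{\alpha,\gamma}$ through the natural continuous map extending the identity on $\mathrm{C}^1(\overline{B^d})$. *)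

theory Defs
  imports "HOL-Analysis.Analysis"
begin

text \<open>
  The dimension is \<open>d = CARD('n)\<close>.  Functions on the ball are total functions on \<open>real^'n\<close>; only
  their values on the ball matter.  Elements of the weighted \<open>L\<^sup>2\<close> space are represented by functions
  rather than by classes modulo equality almost everywhere.
\<close>

text \<open>Since \<open>0 powr a = 0\<close> for every \<open>a\<close>, this vanishes on the coordinate hyperplanes, a null set.\<close>

definition ball_weight :: "real \<Rightarrow> real^'n \<Rightarrow> real^'n \<Rightarrow> real" where
  "ball_weight \<alpha> \<gamma> x = (1 - (norm x)\<^sup>2) powr \<alpha> * (\<Prod>i\<in>UNIV. \<bar>x $ i\<bar> powr (\<gamma> $ i))"

definition L2_ball :: "real \<Rightarrow> real^'n \<Rightarrow> (real^'n \<Rightarrow> real) set" where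
  "L2_ball \<alpha> \<gamma> = {u. set_borel_measurable lborel (ball 0 1) u \<and>
     set_integrable lborel (ball 0 1) (\<lambda>x. (u x)\<^sup>2 * ball_weight \<alpha> \<gamma> x)}"

definition L2_inner :: "real \<Rightarrow> real^'n \<Rightarrow> (real^'n \<Rightarrow> real) \<Rightarrow> (real^'n \<Rightarrow> real) \<Rightarrow> real" where
  "L2_inner \<alpha> \<gamma> u v = (LINT x:ball 0 1|lborel. u x * v x * ball_weight \<alpha> \<gamma> x)"

definition L2_norm :: "real \<Rightarrow> real^'n \<Rightarrow> (real^'n \<Rightarrow> real) \<Rightarrow> real" where
  "L2_norm \<alpha> \<gamma> u = sqrt (L2_inner \<alpha> \<gamma> u u)"

definition poly_le :: "nat \<Rightarrow> (real^'n \<Rightarrow> real) set" where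
  "poly_le N = {p. \<exists>c :: ('n \<Rightarrow> nat) \<Rightarrow> real.
     \<forall>x. p x = (\<Sum>k | sum k UNIV \<le> N. c k * (\<Prod>i\<in>UNIV. (x $ i) ^ k i))}"

definition poly_proj :: "real \<Rightarrow> real^'n \<Rightarrow> nat \<Rightarrow> (real^'n \<Rightarrow> real) \<Rightarrow> real^'n \<Rightarrow> real" where
  "poly_proj \<alpha> \<gamma> N u =
     (THE p. p \<in> poly_le N \<and> (\<forall>q\<in>poly_le N. L2_inner \<alpha> \<gamma> (\<lambda>x. u x - p x) q = 0))"

definition C1_ball :: "(real^'n \<Rightarrow> real) set" where
  "C1_ball = {u. continuous_on (cball 0 1) u \<and>
     (\<forall>j. \<exists>g. continuous_on (cball 0 1) g \<and>
        (\<forall>x\<in>ball 0 1. ((\<lambda>t. u (x + t *\<^sub>R axis j 1)) has_real_derivative g x) (at 0)))}"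

definition partial_deriv :: "'n \<Rightarrow> (real^'n \<Rightarrow> real) \<Rightarrow> real^'n \<Rightarrow> real" where
  "partial_deriv j u x = deriv (\<lambda>t. u (x + t *\<^sub>R axis j 1)) 0"

definition coord_refl :: "'n \<Rightarrow> real^'n \<Rightarrow> real^'n" where
  "coord_refl j x = x - (2 * x $ j) *\<^sub>R axis j 1"

definition dunkl :: "real^'n \<Rightarrow> 'n \<Rightarrow> (real^'n \<Rightarrow> real) \<Rightarrow> real^'n \<Rightarrow> real" where
  "dunkl \<gamma> j u x = partial_deriv j u x + (\<gamma> $ j) / 2 *
     (if x $ j = 0 then 2 * partial_deriv j u x else (u x - u (coord_refl j x)) / x $ j)"

definition C1_norm :: "real \<Rightarrow> real^'n \<Rightarrow> (real^'n \<Rightarrow> real) \<Rightarrow> real" where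
  "C1_norm \<alpha> \<gamma> u =
     sqrt ((L2_norm \<alpha> \<gamma> u)\<^sup>2 + (\<Sum>j\<in>UNIV. (L2_norm \<alpha> \<gamma> (dunkl \<gamma> j u))\<^sup>2))"

text \<open>
  The space \<open>H1_ball\<close> is the completion of \<open>C1_ball\<close>, constructed as the set of equivalence classes of
  Cauchy sequences.  Members of \<open>C1_ball\<close> that agree on the ball but differ elsewhere are
  at distance zero, hence are identified by \<open>H1_rel\<close>.
\<close>

definition C1_Cauchy :: "real \<Rightarrow> real^'n \<Rightarrow> (nat \<Rightarrow> real^'n \<Rightarrow> real) set" where
  "C1_Cauchy \<alpha> \<gamma> = {U. (\<forall>k. U k \<in> C1_ball) \<and>
     (\<forall>e>0. \<exists>M. \<forall>m\<ge>M. \<forall>n\<ge>M. C1_norm \<alpha> \<gamma> (\<lambda>x. U m x - U n x) < e)}"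

definition H1_rel ::
  "real \<Rightarrow> real^'n \<Rightarrow> ((nat \<Rightarrow> real^'n \<Rightarrow> real) \<times> (nat \<Rightarrow> real^'n \<Rightarrow> real)) set" where
  "H1_rel \<alpha> \<gamma> = {(U, V). U \<in> C1_Cauchy \<alpha> \<gamma> \<and> V \<in> C1_Cauchy \<alpha> \<gamma> \<and>
     (\<lambda>k. C1_norm \<alpha> \<gamma> (\<lambda>x. U k x - V k x)) \<longlonglongrightarrow> 0}"

definition H1_ball :: "real \<Rightarrow> real^'n \<Rightarrow> (nat \<Rightarrow> real^'n \<Rightarrow> real) set set" where
  "H1_ball \<alpha> \<gamma> = C1_Cauchy \<alpha> \<gamma> // H1_rel \<alpha> \<gamma>"

definition H1_norm :: "real \<Rightarrow> real^'n \<Rightarrow> (nat \<Rightarrow> real^'n \<Rightarrow> real) set \<Rightarrow> real" where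
  "H1_norm \<alpha> \<gamma> X = (THE l. \<forall>U\<in>X. (\<lambda>k. C1_norm \<alpha> \<gamma> (U k)) \<longlonglongrightarrow> l)"

definition H1_of_C1 ::
  "real \<Rightarrow> real^'n \<Rightarrow> (real^'n \<Rightarrow> real) \<Rightarrow> (nat \<Rightarrow> real^'n \<Rightarrow> real) set" where
  "H1_of_C1 \<alpha> \<gamma> u = H1_rel \<alpha> \<gamma> `` {\<lambda>k. u}"

definition H1_diff :: "real \<Rightarrow> real^'n \<Rightarrow> (nat \<Rightarrow> real^'n \<Rightarrow> real) set \<Rightarrow>
    (nat \<Rightarrow> real^'n \<Rightarrow> real) set \<Rightarrow> (nat \<Rightarrow> real^'n \<Rightarrow> real) set" where
  "H1_diff \<alpha> \<gamma> X Y = (\<Union>U\<in>X. \<Union>V\<in>Y. H1_rel \<alpha> \<gamma> `` {\<lambda>k x. U k x - V k x})"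

text \<open>
  The natural continuous map into the weighted \<open>L\<^sup>2\<close> space: a representative of the common \<open>L\<^sup>2\<close> limit,
  determined up to equality almost everywhere.
\<close>

definition H1_to_L2 :: "real \<Rightarrow> real^'n \<Rightarrow> (nat \<Rightarrow> real^'n \<Rightarrow> real) set \<Rightarrow> real^'n \<Rightarrow> real" where
  "H1_to_L2 \<alpha> \<gamma> X =
     (SOME v. v \<in> L2_ball \<alpha> \<gamma> \<and> (\<forall>U\<in>X. (\<lambda>k. L2_norm \<alpha> \<gamma> (\<lambda>x. U k x - v x)) \<longlonglongrightarrow> 0))"

definition H1_proj :: "real \<Rightarrow> real^'n \<Rightarrow> nat \<Rightarrow> (nat \<Rightarrow> real^'n \<Rightarrow> real) set \<Rightarrow>
    (nat \<Rightarrow> real^'n \<Rightarrow> real) set" where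
  "H1_proj \<alpha> \<gamma> N X = H1_of_C1 \<alpha> \<gamma> (poly_proj \<alpha> \<gamma> N (H1_to_L2 \<alpha> \<gamma> X))"

end

theory Submission
  imports Defs
begin

text \<open>
  Let \<open>P\<^sub>N\<close> be the polynomials of degree at most \<open>N\<close>, write \<open>\<parallel>u\<parallel>\<^sub>\<alpha>\<close> for the norm of the weighted
  \<open>L\<^sup>2\<close> space, \<open>S\<^sub>N\<close> for the projection onto \<open>P\<^sub>N\<close> in that space, and \<open>D\<^sub>j\<close> for the Dunkl operators.
  The parameter \<open>\<gamma>\<close> is fixed, but \<open>\<alpha>\<close> and \<open>\<alpha> + 1\<close> both occur.  Let \<open>\<kappa> = (d + \<Sum>\<^sub>i \<gamma>\<^sub>i) / 2\<close>.

  \<^bold>\<open>Upper bound.\<close>  By integration by parts (\<open>dunkl_by_parts\<close>), the adjoint of \<open>D\<^sub>j\<close>, as an operator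
  from the space with parameter \<open>\<alpha>\<close> to the one with parameter \<open>\<alpha> + 1\<close>, maps \<open>P\<^sub>N\<^sub>-\<^sub>1\<close> to \<open>P\<^sub>N\<close>.
  Therefore \<open>D\<^sub>j S\<^sub>N u\<close> is the projection of \<open>v = D\<^sub>j u\<close> onto \<open>P\<^sub>N\<^sub>-\<^sub>1\<close> for the parameter \<open>\<alpha> + 1\<close>
  (\<open>dunkl_poly_proj\<close>), and it has to be bounded in the stronger norm with parameter \<open>\<alpha>\<close>
  (\<open>next_weight_projection_bound\<close>).  Compare it with the projection of \<open>v\<close> onto the same space for the
  parameter \<open>\<alpha>\<close>, which is harmless.  As the two weights differ by the factor \<open>1 - \<bar>x\<bar>\<^sup>2\<close> of degree 2,
  the difference \<open>r\<close> of the two projections is orthogonal, for \<open>\<alpha> + 1\<close>, to all polynomials except those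
  of the two highest degrees.  If \<open>r\<close> of degree at most \<open>m\<close> is orthogonal, for \<open>\<alpha> + 1\<close>, to all lower
  degrees, Euler's identity for homogeneous functions gives the exact relation
  \<open>(\<alpha> + 1) \<parallel>r\<parallel>\<^sub>\<alpha>\<^sup>2 = (m + \<kappa> + \<alpha> + 1) \<parallel>r\<parallel>\<^sub>\<alpha>\<^sub>+\<^sub>1\<^sup>2\<close> (\<open>orthogonal_poly_norms\<close>).  The change of norm thus
  costs a factor of order \<open>N\<^sup>1\<^sup>/\<^sup>2\<close>.  The bound on \<open>C\<^sup>1\<close> functions passes to the completion
  because all norms on \<open>P\<^sub>N\<close> are equivalent.

  \<^bold>\<open>Sharpness.\<close>  Radial functions \<open>u(x) = f(\<bar>x\<bar>\<^sup>2)\<close> with polynomial \<open>f\<close> suffice.  Their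
  projections are radial (\<open>radial_orthogonal\<close>), and \<open>\<Sum>\<^sub>j \<parallel>D\<^sub>j u\<parallel>\<^sub>\<alpha>\<^sup>2 = 4 \<Lambda>(f'\<^sup>2)\<close>, where, up to a
  constant, \<open>\<Lambda>(p)\<close> is the integral of \<open>p(t) t\<^sup>\<kappa> (1 - t)\<^sup>\<alpha>\<close> over the unit interval.  Let \<open>\<phi>\<^sub>m\<close> have the least
  value \<open>\<eta>\<^sub>m\<close> of \<open>\<Lambda>(p\<^sup>2)\<close> among the polynomials of degree at most \<open>m\<close> with \<open>p(1) = 1\<close>.  These polynomials
  are orthogonal for the weight \<open>t\<^sup>\<kappa> (1 - t)\<^sup>\<alpha>\<^sup>+\<^sup>1\<close>.  Choose \<open>f\<close> with \<open>f' = \<phi>\<^sub>m - \<phi>\<^sub>m\<^sub>+\<^sub>1\<close>; then the error of the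
  projection onto degree \<open>N = 2 (m + 1)\<close> has derivative \<open>- \<phi>\<^sub>m\<^sub>+\<^sub>1\<close>, with energy \<open>4 \<eta>\<^sub>m\<^sub>+\<^sub>1\<close>, whereas \<open>u\<close> itself has
  only the energy \<open>4 (\<eta>\<^sub>m - \<eta>\<^sub>m\<^sub>+\<^sub>1)\<close>.  The exact value of \<open>\<eta>\<^sub>m\<^sub>+\<^sub>1 / \<eta>\<^sub>m\<close> (\<open>eta_ratio\<close>) shows that the second
  is smaller by a factor of order \<open>m\<close>; the \<open>L\<^sup>2\<close> norm of \<open>u\<close> is smaller still
  (\<open>projection_energy_blowup\<close>).
\<close>

section \<open>Integrability of the weight\<close>

text \<open>
  Scaling \<open>t\<close> by \<open>sqrt r\<close> takes out the power of \<open>r\<close>, and the remaining integral is a Beta integral.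
\<close>

lemma nn_integral_slice_weight:
  fixes \<alpha> g :: real
  assumes "\<alpha> > -1" "g > -1"
  obtains C :: ennreal where "C < \<infinity>"
    "\<And>r. r > 0 \<Longrightarrow> (\<integral>\<^sup>+t. ennreal (if t\<^sup>2 < r then (r - t\<^sup>2) powr \<alpha> * \<bar>t\<bar> powr g else 0) \<partial>lborel)
        = C * ennreal (r powr (\<alpha> + (g + 1) / 2))"
proof -
  let ?f = "\<lambda>r t. if t\<^sup>2 < r then (r - t\<^sup>2) powr \<alpha> * \<bar>t\<bar> powr g else (0::real)"
  define C where "C = (\<integral>\<^sup>+t. ennreal (?f 1 t) \<partial>lborel)"
  have scale: "(\<integral>\<^sup>+t. ennreal (?f r t) \<partial>lborel) = C * ennreal (r powr (\<alpha> + (g + 1) / 2))" if r: "r > 0" for r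
  proof -
    have eq: "?f r (sqrt r * t) = r powr (\<alpha> + g / 2) * ?f 1 t" for t
    proof -
      have "(sqrt r * t)\<^sup>2 = r * t\<^sup>2" using r by (simp add: power_mult_distrib)
      moreover have "r - r * t\<^sup>2 = r * (1 - t\<^sup>2)" by (simp add: algebra_simps)
      moreover have "\<bar>sqrt r * t\<bar> powr g = r powr (g / 2) * \<bar>t\<bar> powr g"
        using r by (simp add: abs_mult powr_mult powr_half_sqrt[symmetric] powr_powr)
      moreover have "r * t\<^sup>2 < r \<longleftrightarrow> t\<^sup>2 < 1" using r by simp
      ultimately show ?thesis using r by (auto simp: powr_mult powr_add)
    qed
    have "(\<integral>\<^sup>+t. ennreal (?f r t) \<partial>lborel) = ennreal \<bar>sqrt r\<bar> * (\<integral>\<^sup>+t. ennreal (?f r (0 + sqrt r * t)) \<partial>lborel)"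
      using r by (intro nn_integral_real_affine) auto
    also have "\<dots> = ennreal (sqrt r) * (\<integral>\<^sup>+t. ennreal (r powr (\<alpha> + g / 2)) * ennreal (?f 1 t) \<partial>lborel)"
      using r by (simp only: eq add_0_left) (simp add: ennreal_mult[symmetric])
    also have "\<dots> = ennreal (sqrt r) * (ennreal (r powr (\<alpha> + g / 2)) * C)"
      unfolding C_def by (subst nn_integral_cmult) auto
    also have "\<dots> = C * (ennreal (sqrt r) * ennreal (r powr (\<alpha> + g / 2)))" by (simp add: mult_ac)
    also have "ennreal (sqrt r) * ennreal (r powr (\<alpha> + g / 2)) = ennreal (r powr (\<alpha> + (g + 1) / 2))"
      using r by (simp add: ennreal_mult[symmetric] powr_half_sqrt[symmetric] powr_add[symmetric] field_simps)
    finally show ?thesis .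
  qed
  have "C < \<infinity>"
  proof -
    let ?h = "\<lambda>t::real. indicator {0..1} t * (t powr ((g + 1) - 1) * (1 - t) powr ((\<alpha> + 1) - 1))"
    have int: "integrable lborel ?h"
      using integrable_Beta[of "g + 1" "\<alpha> + 1"] assms by (simp add: set_integrable_def)
    have int': "integrable lborel (\<lambda>t. ?h (0 + (-1) * t))"
      using int by (subst lborel_integrable_real_affine_iff) auto
    have bnd: "?f 1 t \<le> 2 powr \<bar>\<alpha>\<bar> * (?h t + ?h (0 + (-1) * t))" for t
    proof (cases "t\<^sup>2 < 1")
      case True
      then have t1: "\<bar>t\<bar> < 1" by (simp add: abs_square_less_1)
      have "1 - t\<^sup>2 = (1 - \<bar>t\<bar>) * (1 + \<bar>t\<bar>)" by (simp add: algebra_simps power2_eq_square)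
      then have "(1 - t\<^sup>2) powr \<alpha> = (1 - \<bar>t\<bar>) powr \<alpha> * (1 + \<bar>t\<bar>) powr \<alpha>"
        using t1 by (simp add: powr_mult)
      also have "\<dots> \<le> (1 - \<bar>t\<bar>) powr \<alpha> * 2 powr \<bar>\<alpha>\<bar>"
      proof (rule mult_left_mono)
        have "(1 + \<bar>t\<bar>) powr \<alpha> \<le> (1 + \<bar>t\<bar>) powr \<bar>\<alpha>\<bar>" by (rule powr_mono) auto
        also have "\<dots> \<le> 2 powr \<bar>\<alpha>\<bar>" using t1 by (intro powr_mono2) auto
        finally show "(1 + \<bar>t\<bar>) powr \<alpha> \<le> 2 powr \<bar>\<alpha>\<bar>" .
      qed auto
      finally have "?f 1 t \<le> 2 powr \<bar>\<alpha>\<bar> * (\<bar>t\<bar> powr g * (1 - \<bar>t\<bar>) powr \<alpha>)"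
        using True by (simp add: mult_ac mult_left_mono)
      also have "\<dots> \<le> 2 powr \<bar>\<alpha>\<bar> * (?h t + ?h (0 + (-1) * t))"
        using t1 by (intro mult_left_mono) (auto simp: indicator_def)
      finally show ?thesis .
    qed auto
    have "integrable lborel (?f 1)"
    proof (rule Bochner_Integration.integrable_bound)
      show "integrable lborel (\<lambda>t. 2 powr \<bar>\<alpha>\<bar> * (?h t + ?h (0 + (-1) * t)))"
        using int int' by (intro integrable_mult_right Bochner_Integration.integrable_add)
      show "AE t in lborel. norm (?f 1 t) \<le> norm (2 powr \<bar>\<alpha>\<bar> * (?h t + ?h (0 + (-1) * t)))"
        using bnd by (intro AE_I2) (smt (verit) mult_nonneg_nonneg powr_ge_zero real_norm_def)
    qed auto
    then show ?thesis
      unfolding C_def by (subst nn_integral_eq_integral) auto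
  qed
  then show thesis using scale that by blast
qed

text \<open>
  Integrating out the coordinate \<open>i\<close> leaves a weight of the same kind in the other coordinates, with
  \<open>\<alpha>\<close> replaced by \<open>\<alpha> + (g i + 1) / 2\<close>, which is again larger than \<open>-1\<close>.  For this reason \<open>\<alpha>\<close> is
  arbitrary in the induction.
\<close>

lemma nn_integral_product_weight_finite:
  fixes g :: "'b \<Rightarrow> real" and \<alpha> :: real
  assumes "finite I" "\<alpha> > -1" "\<And>i. g i > -1"
  shows "(\<integral>\<^sup>+f. ennreal (if (\<Sum>i\<in>I. (f i)\<^sup>2) < 1
            then (1 - (\<Sum>i\<in>I. (f i)\<^sup>2)) powr \<alpha> * (\<Prod>i\<in>I. \<bar>f i\<bar> powr g i) else 0)
          \<partial>(Pi\<^sub>M I (\<lambda>_. lborel))) < \<infinity>"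
  using assms(1,2)
proof (induction I arbitrary: \<alpha> rule: finite_induct)
  case empty
  show ?case by (simp add: PiM_empty nn_integral_count_space_finite)
next
  case (insert i I)
  interpret product_sigma_finite "\<lambda>_::'b. lborel :: real measure" by standard
  let ?w = "\<lambda>I \<alpha> f. if (\<Sum>i\<in>I. (f i)\<^sup>2) < 1
            then (1 - (\<Sum>i\<in>I. (f i)\<^sup>2)) powr \<alpha> * (\<Prod>i\<in>I. \<bar>f i\<bar> powr g i) else (0::real)"
  obtain C where C: "C < \<infinity>" "\<And>r. r > 0 \<Longrightarrow>
      (\<integral>\<^sup>+t. ennreal (if t\<^sup>2 < r then (r - t\<^sup>2) powr \<alpha> * \<bar>t\<bar> powr g i else 0) \<partial>lborel)
        = C * ennreal (r powr (\<alpha> + (g i + 1) / 2))"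
    using nn_integral_slice_weight[OF insert.prems assms(3)[of i]] by blast
  have inner: "(\<integral>\<^sup>+t. ennreal (?w (insert i I) \<alpha> (f(i := t))) \<partial>lborel) = C * ennreal (?w I (\<alpha> + (g i + 1) / 2) f)" for f
  proof -
    let ?r = "1 - (\<Sum>i\<in>I. (f i)\<^sup>2)" and ?p = "\<Prod>i\<in>I. \<bar>f i\<bar> powr g i"
    have s: "(\<Sum>j\<in>I. ((f(i := t)) j)\<^sup>2) = (\<Sum>i\<in>I. (f i)\<^sup>2)" for t
      using insert.hyps by (intro sum.cong) auto
    have p: "(\<Prod>j\<in>I. \<bar>(f(i := t)) j\<bar> powr g j) = ?p" for t
      using insert.hyps by (intro prod.cong) auto
    have eq: "?w (insert i I) \<alpha> (f(i := t)) = ?p * (if t\<^sup>2 < ?r then (?r - t\<^sup>2) powr \<alpha> * \<bar>t\<bar> powr g i else 0)" for t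
      using insert.hyps s[of t] p[of t] by (auto simp: algebra_simps)
    have pn: "?p \<ge> 0" by (intro prod_nonneg) auto
    have "(\<integral>\<^sup>+t. ennreal (?w (insert i I) \<alpha> (f(i := t))) \<partial>lborel)
        = ennreal ?p * (\<integral>\<^sup>+t. ennreal (if t\<^sup>2 < ?r then (?r - t\<^sup>2) powr \<alpha> * \<bar>t\<bar> powr g i else 0) \<partial>lborel)"
      unfolding eq by (subst nn_integral_cmult[symmetric]) (auto simp: ennreal_mult pn)
    also have "\<dots> = C * ennreal (?w I (\<alpha> + (g i + 1) / 2) f)"
    proof (cases "?r > 0")
      case True
      then show ?thesis using pn by (simp add: C(2) ennreal_mult mult_ac)
    next
      case False
      then have "\<not> t\<^sup>2 < ?r" for t :: real by (metis linorder_not_less order_le_less_trans zero_le_power2)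
      then show ?thesis using False by (simp cong: if_cong)
    qed
    finally show ?thesis .
  qed
  have meas: "(\<lambda>f. ennreal (?w (insert i I) \<alpha> f)) \<in> borel_measurable (Pi\<^sub>M (insert i I) (\<lambda>_. lborel))"
    by measurable
  have "(g i + 1) / 2 > 0" using assms(3)[of i] by simp
  with insert.prems have "\<alpha> + (g i + 1) / 2 > -1" by linarith
  note IH = insert.IH[OF this]
  have "(\<integral>\<^sup>+f. ennreal (?w (insert i I) \<alpha> f) \<partial>(Pi\<^sub>M (insert i I) (\<lambda>_. lborel)))
      = (\<integral>\<^sup>+f. C * ennreal (?w I (\<alpha> + (g i + 1) / 2) f) \<partial>(Pi\<^sub>M I (\<lambda>_. lborel)))"
    by (simp only: product_nn_integral_insert[OF insert.hyps meas] inner)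
  also have "\<dots> = C * (\<integral>\<^sup>+f. ennreal (?w I (\<alpha> + (g i + 1) / 2) f) \<partial>(Pi\<^sub>M I (\<lambda>_. lborel)))"
    by (rule nn_integral_cmult) measurable
  also have "\<dots> < \<infinity>"
    using C(1) IH unfolding infinity_ennreal_def by (simp only: ennreal_mult_less_top) simp
  finally show ?case .
qed

section \<open>Integration by parts in one coordinate\<close>

text \<open>
  The integrand is the derivative of \<open>f t * (\<rho>\<^sup>2 - t\<^sup>2) powr (\<alpha> + 1) * t powr g\<close>.  This function tends to 0
  at \<open>\<rho>\<close> because \<open>\<alpha> + 1 > 0\<close>, and at 0 because \<open>f\<close> vanishes there to first order and \<open>g + 1 > 0\<close>.
\<close>

lemma integral_slice_eq_zero_1d:
  fixes f f' :: "real \<Rightarrow> real" and \<alpha> g \<rho> B :: real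
  assumes \<alpha>: "\<alpha> > -1" and g: "g > -1" and \<rho>: "\<rho> > 0"
    and der: "\<And>t. 0 < t \<Longrightarrow> t < \<rho> \<Longrightarrow> (f has_real_derivative f' t) (at t)"
    and cont: "\<And>t. 0 < t \<Longrightarrow> t < \<rho> \<Longrightarrow> isCont f' t"
    and bnd: "\<And>t. 0 < t \<Longrightarrow> t < \<rho> \<Longrightarrow> \<bar>f t\<bar> \<le> B * t"
    and int: "set_integrable lborel {0<..<\<rho>} (\<lambda>t. (f' t * (\<rho>\<^sup>2 - t\<^sup>2) + g * (f t / t) * (\<rho>\<^sup>2 - t\<^sup>2)
        - 2 * (\<alpha> + 1) * t * f t) * ((\<rho>\<^sup>2 - t\<^sup>2) powr \<alpha> * t powr g))"
  shows "(LINT t:{0<..<\<rho>}|lborel. (f' t * (\<rho>\<^sup>2 - t\<^sup>2) + g * (f t / t) * (\<rho>\<^sup>2 - t\<^sup>2)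
        - 2 * (\<alpha> + 1) * t * f t) * ((\<rho>\<^sup>2 - t\<^sup>2) powr \<alpha> * t powr g)) = 0"
proof -
  let ?E = "\<lambda>t. (f' t * (\<rho>\<^sup>2 - t\<^sup>2) + g * (f t / t) * (\<rho>\<^sup>2 - t\<^sup>2)
        - 2 * (\<alpha> + 1) * t * f t) * ((\<rho>\<^sup>2 - t\<^sup>2) powr \<alpha> * t powr g)"
  define h where "h = (\<lambda>t. f t * (\<rho>\<^sup>2 - t\<^sup>2) powr (\<alpha> + 1) * t powr g)"
  have pos: "\<rho>\<^sup>2 - t\<^sup>2 > 0" if "0 < t" "t < \<rho>" for t
    using power_strict_mono[of t \<rho> 2] that by simp
  have dh: "(h has_real_derivative ?E t) (at t)" if t: "0 < t" "t < \<rho>" for t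
  proof -
    have d1: "((\<lambda>t. (\<rho>\<^sup>2 - t\<^sup>2) powr (\<alpha> + 1)) has_real_derivative
        ((\<alpha> + 1) * (\<rho>\<^sup>2 - t\<^sup>2) powr (\<alpha> + 1 - 1) * (- (2 * t)))) (at t)"
      by (rule DERIV_chain2[OF has_real_derivative_powr]) (use pos[OF t] in \<open>auto intro!: derivative_eq_intros\<close>)
    have d2: "((\<lambda>t. t powr g) has_real_derivative (g * t powr (g - 1))) (at t)"
      by (rule has_real_derivative_powr) (use t in auto)
    have e1: "(\<rho>\<^sup>2 - t\<^sup>2) powr (\<alpha> + 1) = (\<rho>\<^sup>2 - t\<^sup>2) powr \<alpha> * (\<rho>\<^sup>2 - t\<^sup>2)"
      using pos[OF t] by (simp add: powr_add)
    have e2: "t powr (g - 1) = t powr g / t"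
      using t by (simp add: powr_diff)
    show ?thesis
      unfolding h_def
      by (rule DERIV_cong[OF DERIV_mult[OF DERIV_mult[OF der[OF t] d1] d2]])
        (simp only: e1 e2 add_diff_cancel, use t in \<open>simp add: field_simps\<close>)
  qed
  have isc: "isCont ?E t" if t: "0 < t" "t < \<rho>" for t
    using pos[OF t] t cont[OF t] DERIV_isCont[OF der[OF t]]
    by (intro continuous_intros) auto
  have h0: "(h \<longlongrightarrow> 0) (at_right 0)"
  proof (rule Lim_null_comparison)
    have *: "\<bar>h t\<bar> \<le> B * \<rho>\<^sup>2 powr (\<alpha> + 1) * t powr (g + 1)" if t: "0 < t" "t < \<rho>" for t
    proof -
      have "\<bar>h t\<bar> = \<bar>f t\<bar> * (\<rho>\<^sup>2 - t\<^sup>2) powr (\<alpha> + 1) * t powr g"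
        by (simp add: h_def abs_mult)
      also have "\<dots> \<le> (B * t) * \<rho>\<^sup>2 powr (\<alpha> + 1) * t powr g"
        using bnd[OF t] pos[OF t] \<alpha> by (intro mult_right_mono mult_mono powr_mono2) auto
      finally show ?thesis using t by (simp add: powr_add mult_ac)
    qed
    show "eventually (\<lambda>t. norm (h t) \<le> B * \<rho>\<^sup>2 powr (\<alpha> + 1) * t powr (g + 1)) (at_right 0)"
      using eventually_at_right_less[of 0] eventually_at_right_real[OF \<rho>] 
      by eventually_elim (use * in auto)
    have "((\<lambda>t::real. t powr (g + 1)) \<longlongrightarrow> 0 powr (g + 1)) (at_right 0)"
      using g by (intro tendsto_powr') (auto intro!: tendsto_eq_intros eventually_at_right_less simp: eventually_at_filter)
    then show "((\<lambda>t. B * \<rho>\<^sup>2 powr (\<alpha> + 1) * t powr (g + 1)) \<longlongrightarrow> 0) (at_right 0)"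
      by (intro tendsto_mult_right_zero) simp
  qed
  have h1: "(h \<longlongrightarrow> 0) (at_left \<rho>)"
  proof (rule Lim_null_comparison)
    have *: "\<bar>h t\<bar> \<le> B * (t powr (g + 1) * (\<rho>\<^sup>2 - t\<^sup>2) powr (\<alpha> + 1))" if t: "0 < t" "t < \<rho>" for t
    proof -
      have "\<bar>h t\<bar> = \<bar>f t\<bar> * (\<rho>\<^sup>2 - t\<^sup>2) powr (\<alpha> + 1) * t powr g"
        by (simp add: h_def abs_mult)
      also have "\<dots> \<le> (B * t) * (\<rho>\<^sup>2 - t\<^sup>2) powr (\<alpha> + 1) * t powr g"
        using bnd[OF t] by (intro mult_right_mono) auto
      finally show ?thesis using t by (simp add: powr_add mult_ac)
    qed
    show "eventually (\<lambda>t. norm (h t) \<le> B * (t powr (g + 1) * (\<rho>\<^sup>2 - t\<^sup>2) powr (\<alpha> + 1))) (at_left \<rho>)"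
      using eventually_at_left_real[OF \<rho>] by eventually_elim (use * in auto)
    have "((\<lambda>t. (\<rho>\<^sup>2 - t\<^sup>2) powr (\<alpha> + 1)) \<longlongrightarrow> 0 powr (\<alpha> + 1)) (at_left \<rho>)"
    proof (rule tendsto_powr')
      show "((\<lambda>t. \<rho>\<^sup>2 - t\<^sup>2) \<longlongrightarrow> 0) (at_left \<rho>)" by (auto intro!: tendsto_eq_intros)
      show "0 \<noteq> 0 \<or> \<alpha> + 1 > 0 \<and> (\<forall>\<^sub>F t in at_left \<rho>. 0 \<le> \<rho>\<^sup>2 - t\<^sup>2)"
        using \<alpha> eventually_at_left_real[OF \<rho>] by (auto elim!: eventually_mono intro: less_imp_le pos[simplified])
    qed auto
    moreover have "((\<lambda>t. t powr (g + 1)) \<longlongrightarrow> \<rho> powr (g + 1)) (at_left \<rho>)"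
      using \<rho> by (intro tendsto_powr) (auto intro!: tendsto_eq_intros)
    ultimately have "((\<lambda>t. B * (t powr (g + 1) * (\<rho>\<^sup>2 - t\<^sup>2) powr (\<alpha> + 1))) \<longlongrightarrow> B * (\<rho> powr (g + 1) * 0 powr (\<alpha> + 1))) (at_left \<rho>)"
      by (intro tendsto_mult tendsto_const)
    then show "((\<lambda>t. B * (t powr (g + 1) * (\<rho>\<^sup>2 - t\<^sup>2) powr (\<alpha> + 1))) \<longlongrightarrow> 0) (at_left \<rho>)"
      by simp
  qed
  have "(LBINT t=ereal 0..ereal \<rho>. ?E t) = 0 - 0"
  proof (rule interval_integral_FTC_integrable)
    show "set_integrable lborel (einterval (ereal 0) (ereal \<rho>)) ?E"
      using int by (simp add: einterval_eq)
    show "((h \<circ> real_of_ereal) \<longlongrightarrow> 0) (at_right (ereal 0))"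
      using h0 unfolding ereal_tendsto_simps .
    show "((h \<circ> real_of_ereal) \<longlongrightarrow> 0) (at_left (ereal \<rho>))"
      using h1 unfolding ereal_tendsto_simps .
    show "(h has_vector_derivative ?E t) (at t)" if "ereal 0 < ereal t" "ereal t < ereal \<rho>" for t
      using dh[of t] that by (simp add: has_real_derivative_iff_has_vector_derivative)
    show "isCont ?E t" if "ereal 0 < ereal t" "ereal t < ereal \<rho>" for t
      using isc[of t] that by simp
  qed (use \<rho> in auto)
  then show ?thesis
    using \<rho> by (simp add: interval_lebesgue_integral_def einterval_eq)
qed

section \<open>The weighted measure on the ball\<close>

text \<open>
  Restricting to the ball first makes measurability a condition on the values in the ball only, which is
  the condition in \<open>L2_ball\<close>.
\<close>

definition ball_measure :: "real \<Rightarrow> real^'n \<Rightarrow> (real^'n) measure" where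
  "ball_measure \<alpha> \<gamma> = density (restrict_space lborel (ball 0 1)) (\<lambda>x. ennreal (ball_weight \<alpha> \<gamma> x))"

lemma ball_weight_nonneg [simp]: "ball_weight \<alpha> \<gamma> x \<ge> 0"
  by (auto simp: ball_weight_def intro!: mult_nonneg_nonneg prod_nonneg)

lemma borel_measurable_vec_component [measurable]: "(\<lambda>x::real^'n. x $ i) \<in> borel_measurable borel"
  by (intro borel_measurable_continuous_onI continuous_intros)

lemma ball_weight_measurable [measurable]: "ball_weight \<alpha> \<gamma> \<in> borel_measurable borel"
  unfolding ball_weight_def[abs_def] by measurable

lemma space_ball_measure [simp]: "space (ball_measure \<alpha> \<gamma>) = ball 0 1"
  by (simp add: ball_measure_def space_restrict_space)

lemma sets_ball_measure [measurable_cong]: "sets (ball_measure \<alpha> \<gamma>) = sets (restrict_space borel (ball 0 1))"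
  by (simp add: ball_measure_def cong: sets_restrict_space_cong)

lemma ball_weight_plus_one:
  assumes "x \<in> ball 0 1"
  shows "ball_weight (\<alpha> + 1) \<gamma> x = (1 - (norm x)\<^sup>2) * ball_weight \<alpha> \<gamma> x"
proof -
  have "(norm x)\<^sup>2 < 1" using assms by (simp add: abs_square_less_1)
  then show ?thesis by (simp add: ball_weight_def powr_add)
qed

lemma borel_measurable_ball_measure_iff:
  fixes u :: "real^'n \<Rightarrow> real"
  shows "u \<in> borel_measurable (ball_measure \<alpha> \<gamma>) \<longleftrightarrow> set_borel_measurable lborel (ball 0 1) u"
  unfolding set_borel_measurable_def ball_measure_def
  by (subst borel_measurable_restrict_space_iff[symmetric]) auto

lemma integrable_ball_measure_iff:
  fixes u :: "real^'n \<Rightarrow> real"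
  assumes "u \<in> borel_measurable (ball_measure \<alpha> \<gamma>)"
  shows "integrable (ball_measure \<alpha> \<gamma>) u \<longleftrightarrow> set_integrable lborel (ball 0 1) (\<lambda>x. u x * ball_weight \<alpha> \<gamma> x)"
  using assms unfolding ball_measure_def set_integrable_def
  by (subst integrable_density)
     (auto simp: integrable_restrict_space mult_ac intro!: measurable_restrict_space1)

lemma integral_ball_measure:
  fixes u :: "real^'n \<Rightarrow> real"
  assumes "u \<in> borel_measurable (ball_measure \<alpha> \<gamma>)"
  shows "(LINT x:ball 0 1|lborel. u x * ball_weight \<alpha> \<gamma> x) = integral\<^sup>L (ball_measure \<alpha> \<gamma>) u"
  using assms unfolding ball_measure_def set_lebesgue_integral_def
  by (subst integral_density)
     (auto simp: integral_restrict_space mult_ac intro!: measurable_restrict_space1)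

lemma Basis_vec_real: "(Basis :: (real^'n) set) = range (\<lambda>i. axis i 1)"
  by (auto simp: Basis_vec_def)

lemma inj_axis: "inj (\<lambda>i::'n::finite. axis i (1::real))"
  by (auto simp: inj_on_def axis_eq_axis)

lemma prod_Basis_vec: "(\<Prod>b\<in>(Basis :: (real^'n) set). h b) = (\<Prod>i\<in>UNIV. h (axis i 1))"
  unfolding Basis_vec_real by (subst prod.reindex[OF inj_axis]) simp

text \<open>
  In the coordinates of the standard basis, Lebesgue measure is a product measure and the weight has the
  form treated above.
\<close>

lemma nn_integral_ball_weight_finite:
  fixes \<gamma> :: "real^'n"
  assumes "\<alpha> > -1" "\<And>i. \<gamma> $ i > -1"
  shows "(\<integral>\<^sup>+x. ennreal (indicator (ball 0 1) x * ball_weight \<alpha> \<gamma> x) \<partial>lborel) < \<infinity>"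
proof -
  let ?v = "\<lambda>f. \<Sum>b\<in>(Basis::(real^'n) set). f b *\<^sub>R b"
  have comp: "?v f \<bullet> b = f b" if "b \<in> Basis" for f and b :: "real^'n"
    using that by simp
  have nrm: "(norm (?v f))\<^sup>2 = (\<Sum>b\<in>Basis. (f b)\<^sup>2)" for f :: "real^'n \<Rightarrow> real"
    unfolding power2_norm_eq_inner by (subst euclidean_inner) (auto simp: power2_eq_square intro!: sum.cong)
  have cart: "?v f $ i = f (axis i 1)" for f i
    using comp[of "axis i 1" f] by (simp add: cart_eq_inner_axis)
  have ball: "?v f \<in> ball 0 1 \<longleftrightarrow> (\<Sum>b\<in>Basis. (f b)\<^sup>2) < 1" for f
    using nrm[of f] abs_square_less_1[of "norm (?v f)"] by simp
  have eq: "indicator (ball 0 1) (?v f) * ball_weight \<alpha> \<gamma> (?v f) = 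
      (if (\<Sum>b\<in>Basis. (f b)\<^sup>2) < 1 then (1 - (\<Sum>b\<in>Basis. (f b)\<^sup>2)) powr \<alpha> * (\<Prod>b\<in>Basis. \<bar>f b\<bar> powr (\<gamma> \<bullet> b)) else 0)" for f
    using ball[of f] nrm[of f] unfolding ball_weight_def prod_Basis_vec cart
    by (simp add: indicator_def cart_eq_inner_axis)
  have "\<gamma> \<bullet> b > -1" if "b \<in> Basis" for b
    using that assms(2) by (auto simp: Basis_vec_real cart_eq_inner_axis)
  have "(\<integral>\<^sup>+f. ennreal (if (\<Sum>b\<in>Basis. (f b)\<^sup>2) < 1
            then (1 - (\<Sum>b\<in>Basis. (f b)\<^sup>2)) powr \<alpha> * (\<Prod>b\<in>Basis. \<bar>f b\<bar> powr (if b \<in> Basis then \<gamma> \<bullet> b else 0)) else 0)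
          \<partial>(Pi\<^sub>M (Basis :: (real^'n) set) (\<lambda>_. lborel))) < \<infinity>"
    using assms(2) by (intro nn_integral_product_weight_finite assms(1)) (auto simp: Basis_vec_real cart_eq_inner_axis)
  then have fin: "(\<integral>\<^sup>+f. ennreal (indicator (ball 0 1) (?v f) * ball_weight \<alpha> \<gamma> (?v f))
      \<partial>(Pi\<^sub>M (Basis :: (real^'n) set) (\<lambda>_. lborel))) < \<infinity>"
    by (simp add: eq cong: prod.cong if_cong)
  have "(\<integral>\<^sup>+x. ennreal (indicator (ball 0 1) x * ball_weight \<alpha> \<gamma> x)
        \<partial>distr (Pi\<^sub>M (Basis :: (real^'n) set) (\<lambda>_. lborel)) borel ?v) =
      (\<integral>\<^sup>+f. ennreal (indicator (ball 0 1) (?v f) * ball_weight \<alpha> \<gamma> (?v f))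
      \<partial>(Pi\<^sub>M (Basis :: (real^'n) set) (\<lambda>_. lborel)))"
  proof (rule nn_integral_distr)
    show "(\<lambda>x. ennreal (indicator (ball 0 1) x * ball_weight \<alpha> \<gamma> x)) \<in> borel_measurable
        (distr (Pi\<^sub>M (Basis :: (real^'n) set) (\<lambda>_. lborel)) borel ?v)"
      unfolding measurable_distr_eq1
      by (intro measurable_compose[OF _ measurable_ennreal] borel_measurable_times borel_measurable_indicator) auto
  qed measurable
  with fin show ?thesis by (subst lborel_eq) simp
qed

lemma finite_measure_ball_measure:
  fixes \<gamma> :: "real^'n"
  assumes "\<alpha> > -1" "\<And>i. \<gamma> $ i > -1"
  shows "finite_measure (ball_measure \<alpha> \<gamma>)"
proof (rule finite_measureI)
  have "emeasure (ball_measure \<alpha> \<gamma>) (space (ball_measure \<alpha> \<gamma>)) =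
      (\<integral>\<^sup>+x. ennreal (ball_weight \<alpha> \<gamma> x) * indicator (ball 0 1) x \<partial>restrict_space lborel (ball 0 1))"
    unfolding ball_measure_def
    by (subst emeasure_density) (auto simp: space_restrict_space sets_restrict_space intro!: measurable_restrict_space1)
  also have "\<dots> = (\<integral>\<^sup>+x. ennreal (indicator (ball 0 1) x * ball_weight \<alpha> \<gamma> x) \<partial>lborel)"
    by (subst nn_integral_restrict_space) (auto intro!: nn_integral_cong split: split_indicator)
  finally show "emeasure (ball_measure \<alpha> \<gamma>) (space (ball_measure \<alpha> \<gamma>)) \<noteq> \<infinity>"
    using nn_integral_ball_weight_finite[OF assms] by simp
qed

lemma borel_measurable_ball_continuous:
  fixes u :: "real^'n \<Rightarrow> real"
  assumes "continuous_on (ball 0 1) u"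
  shows "u \<in> borel_measurable (ball_measure \<alpha> \<gamma>)"
  using borel_measurable_continuous_on_restrict[OF assms]
  by (simp add: measurable_cong_sets[OF sets_ball_measure refl])

lemma integrable_ball_bounded:
  fixes u :: "real^'n \<Rightarrow> real" and \<gamma> :: "real^'n"
  assumes "\<alpha> > -1" "\<And>i. \<gamma> $ i > -1"
    and "u \<in> borel_measurable (ball_measure \<alpha> \<gamma>)" "\<And>x. x \<in> ball 0 1 \<Longrightarrow> \<bar>u x\<bar> \<le> B"
  shows "integrable (ball_measure \<alpha> \<gamma>) u"
proof -
  interpret finite_measure "ball_measure \<alpha> \<gamma>" by (rule finite_measure_ball_measure[OF assms(1,2)])
  show ?thesis by (rule integrable_const_bound[of _ B]) (use assms(3,4) in auto)
qed

lemma integral_ball_measure_plus_one: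
  fixes u :: "real^'n \<Rightarrow> real"
  assumes "u \<in> borel_measurable (ball_measure \<alpha> \<gamma>)"
  shows "integral\<^sup>L (ball_measure (\<alpha> + 1) \<gamma>) u = (\<integral>x. u x * (1 - (norm x)\<^sup>2) \<partial>ball_measure \<alpha> \<gamma>)"
proof -
  have m1: "u \<in> borel_measurable (ball_measure (\<alpha> + 1) \<gamma>)"
    using assms by (simp add: borel_measurable_ball_measure_iff)
  have m2: "(\<lambda>x. u x * (1 - (norm x)\<^sup>2)) \<in> borel_measurable (ball_measure \<alpha> \<gamma>)"
    by (intro borel_measurable_times assms borel_measurable_ball_continuous continuous_intros)
  show ?thesis
    unfolding integral_ball_measure[OF m1, symmetric] integral_ball_measure[OF m2, symmetric]
    by (rule set_lebesgue_integral_cong) (auto simp: ball_weight_plus_one simp del: mem_ball)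
qed

lemma integrable_ball_measure_plus_one:
  fixes u :: "real^'n \<Rightarrow> real"
  assumes "u \<in> borel_measurable (ball_measure \<alpha> \<gamma>)"
  shows "integrable (ball_measure (\<alpha> + 1) \<gamma>) u \<longleftrightarrow> integrable (ball_measure \<alpha> \<gamma>) (\<lambda>x. u x * (1 - (norm x)\<^sup>2))"
proof -
  have m1: "u \<in> borel_measurable (ball_measure (\<alpha> + 1) \<gamma>)"
    using assms by (simp add: borel_measurable_ball_measure_iff)
  have m2: "(\<lambda>x. u x * (1 - (norm x)\<^sup>2)) \<in> borel_measurable (ball_measure \<alpha> \<gamma>)"
    by (intro borel_measurable_times assms borel_measurable_ball_continuous continuous_intros)
  show ?thesis
    unfolding integrable_ball_measure_iff[OF m1] integrable_ball_measure_iff[OF m2]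
    unfolding set_integrable_def
    by (intro Bochner_Integration.integrable_cong) (auto simp: indicator_def ball_weight_plus_one simp del: mem_ball)
qed

text \<open>
  The mean value inequality on the segment between the two points, which lies in the ball by convexity.
\<close>

lemma axis_increment_bound:
  fixes u g :: "real^'n \<Rightarrow> real"
  assumes der: "\<And>x. x \<in> ball 0 1 \<Longrightarrow> ((\<lambda>t. u (x + t *\<^sub>R axis j 1)) has_real_derivative g x) (at 0)"
    and bnd: "\<And>x. x \<in> ball 0 1 \<Longrightarrow> \<bar>g x\<bar> \<le> B"
    and x: "x \<in> ball 0 1" and xh: "x + h *\<^sub>R axis j 1 \<in> ball 0 1"
  shows "\<bar>u (x + h *\<^sub>R axis j 1) - u x\<bar> \<le> B * \<bar>h\<bar>"
proof -
  let ?e = "axis j 1 :: real^'n"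
  define S where "S = {s. x + s *\<^sub>R ?e \<in> ball 0 1}"
  have "convex S"
  proof (rule convexI)
    fix s s' a b :: real assume *: "s \<in> S" "s' \<in> S" "0 \<le> a" "0 \<le> b" "a + b = 1"
    have "x + (a *\<^sub>R s + b *\<^sub>R s') *\<^sub>R ?e = (a + b) *\<^sub>R x + (a * s + b * s') *\<^sub>R ?e" using * by simp
    also have "\<dots> = a *\<^sub>R (x + s *\<^sub>R ?e) + b *\<^sub>R (x + s' *\<^sub>R ?e)" by (simp add: algebra_simps)
    also have "\<dots> \<in> ball 0 1" using * by (intro convexD[OF convex_ball]) (auto simp: S_def)
    finally show "a *\<^sub>R s + b *\<^sub>R s' \<in> S" by (simp add: S_def)
  qed
  moreover have "((\<lambda>s. u (x + s *\<^sub>R ?e)) has_field_derivative g (x + s *\<^sub>R ?e)) (at s within S)" if "s \<in> S" for s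
  proof -
    let ?f = "\<lambda>t. u (x + s *\<^sub>R ?e + t *\<^sub>R ?e)"
    have "(?f has_real_derivative g (x + s *\<^sub>R ?e)) (at (s - s))"
      using der[of "x + s *\<^sub>R ?e"] that by (simp add: S_def)
    moreover have "((\<lambda>t. t - s) has_real_derivative 1) (at s)"
      by (auto intro!: derivative_eq_intros)
    ultimately have "((\<lambda>t. ?f (t - s)) has_real_derivative g (x + s *\<^sub>R ?e) * 1) (at s)"
      by (rule DERIV_chain2)
    then have "((\<lambda>t. u (x + t *\<^sub>R ?e)) has_real_derivative g (x + s *\<^sub>R ?e)) (at s)"
      by (simp add: algebra_simps)
    then show ?thesis by (rule has_field_derivative_at_within)
  qed
  ultimately have "norm (u (x + h *\<^sub>R ?e) - u (x + 0 *\<^sub>R ?e)) \<le> B * norm (h - 0)"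
    by (rule field_differentiable_bound) (use bnd x xh in \<open>auto simp: S_def\<close>)
  then show ?thesis by simp
qed

text \<open>
  The slice through \<open>y\<close> is cut at \<open>t = 0\<close>, where the weight may be singular, and each half is an instance
  of \<open>integral_slice_eq_zero_1d\<close>; \<open>\<sigma>\<close> is the sign of the coordinate on that half.  A slice that is not
  integrable has integral 0 by convention, so that the conclusion holds for every \<open>y\<close> and not only
  for almost every one.
\<close>

lemma slice_integral_zero:
  fixes \<gamma> y :: "real^'n" and F F' :: "real^'n \<Rightarrow> real"
  defines "\<Phi> \<equiv> \<lambda>\<alpha> j x. indicator (ball 0 1) x * ((F' x * (1 - (norm x)\<^sup>2) + \<gamma> $ j * (F x / x $ j) * (1 - (norm x)\<^sup>2)
        - 2 * (\<alpha> + 1) * x $ j * F x) * ball_weight \<alpha> \<gamma> x)"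
  assumes \<alpha>: "\<alpha> > -1" and \<gamma>: "\<gamma> $ j > -1"
    and cont: "continuous_on (ball 0 1) F'"
    and bnd: "\<And>x. x \<in> ball 0 1 \<Longrightarrow> \<bar>F' x\<bar> \<le> B"
    and der: "\<And>x. x \<in> ball 0 1 \<Longrightarrow> ((\<lambda>t. F (x + t *\<^sub>R axis j 1)) has_real_derivative F' x) (at 0)"
    and zero: "\<And>x. x $ j = 0 \<Longrightarrow> F x = 0"
    and y: "y $ j = 0"
  shows "(\<integral>t. \<Phi> \<alpha> j (y + t *\<^sub>R axis j 1) \<partial>lborel) = 0"
proof -
  let ?e = "axis j 1 :: real^'n"
  define \<phi> where "\<phi> = (\<lambda>t. \<Phi> \<alpha> j (y + t *\<^sub>R ?e))"
  have nrm: "(norm (y + t *\<^sub>R ?e))\<^sup>2 = (norm y)\<^sup>2 + t\<^sup>2" for t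
    unfolding power2_norm_eq_inner using y by (simp add: inner_add_left inner_add_right inner_axis inner_axis' power2_eq_square)
  have ball: "y + t *\<^sub>R ?e \<in> ball 0 1 \<longleftrightarrow> (norm y)\<^sup>2 + t\<^sup>2 < 1" for t
    using nrm[of t] abs_square_less_1[of "norm (y + t *\<^sub>R ?e)"] by simp
  show ?thesis
  proof (cases "integrable lborel \<phi> \<and> (norm y)\<^sup>2 < 1")
    case False
    then consider "\<not> integrable lborel \<phi>" | "\<not> (norm y)\<^sup>2 < 1" by blast
    then show ?thesis
    proof cases
      case 1
      then show ?thesis by (simp add: \<phi>_def not_integrable_integral_eq)
    next
      case 2
      then have "y + t *\<^sub>R ?e \<notin> ball 0 1" for t
        unfolding ball using zero_le_power2[of t] by linarith
      then show ?thesis by (simp add: \<Phi>_def)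
    qed
  next
    case True
    then have int: "integrable lborel \<phi>" and y1: "(norm y)\<^sup>2 < 1" by auto
    define \<rho> where "\<rho> = sqrt (1 - (norm y)\<^sup>2)"
    have \<rho>: "\<rho> > 0" "\<rho>\<^sup>2 = 1 - (norm y)\<^sup>2" using y1 by (auto simp: \<rho>_def)
    define c where "c = (\<Prod>i\<in>UNIV - {j}. \<bar>y $ i\<bar> powr (\<gamma> $ i))"
    have inball: "y + (\<sigma> * t) *\<^sub>R ?e \<in> ball 0 1" if "\<bar>\<sigma>\<bar> = 1" "\<bar>t\<bar> < \<rho>" for \<sigma> t
    proof -
      have "(\<sigma> * t)\<^sup>2 = t\<^sup>2" using that(1) by (metis abs_mult mult_1 power2_abs)
      also have "t\<^sup>2 < \<rho>\<^sup>2" using power_strict_mono[of "\<bar>t\<bar>" \<rho> 2] that(2) by simp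
      finally have "(\<sigma> * t)\<^sup>2 < \<rho>\<^sup>2" .
      then show ?thesis unfolding ball \<rho>(2) by linarith
    qed
    have weight: "ball_weight \<alpha> \<gamma> (y + t *\<^sub>R ?e) = (\<rho>\<^sup>2 - t\<^sup>2) powr \<alpha> * (c * \<bar>t\<bar> powr (\<gamma> $ j))" for t
    proof -
      have "(\<Prod>i\<in>UNIV. \<bar>(y + t *\<^sub>R ?e) $ i\<bar> powr (\<gamma> $ i)) = \<bar>t\<bar> powr (\<gamma> $ j) * c"
        unfolding c_def by (subst prod.remove[of _ j]) (auto simp: y axis_def intro!: prod.cong)
      then show ?thesis by (simp add: ball_weight_def nrm \<rho>(2) algebra_simps)
    qed
    have half: "(LINT t:{0<..<\<rho>}|lborel. \<phi> (\<sigma> * t)) = 0"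
      if \<sigma>: "\<sigma> = 1 \<or> \<sigma> = -1" and int\<sigma>: "integrable lborel (\<lambda>t. \<phi> (\<sigma> * t))" for \<sigma>
    proof -
      define f where "f = (\<lambda>t. F (y + (\<sigma> * t) *\<^sub>R ?e))"
      define f' where "f' = (\<lambda>t. \<sigma> * F' (y + (\<sigma> * t) *\<^sub>R ?e))"
      have abs\<sigma>: "\<bar>\<sigma>\<bar> = 1" "\<sigma> * \<sigma> = 1" using \<sigma> by auto
      have df: "(f has_real_derivative f' t) (at t)" if "\<bar>t\<bar> < \<rho>" for t
      proof -
        let ?x = "y + (\<sigma> * t) *\<^sub>R ?e"
        have f: "f = (\<lambda>s. (\<lambda>u. F (?x + u *\<^sub>R ?e)) (\<sigma> * (s - t)))"
          unfolding f_def by (auto simp: algebra_simps)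
        have "((\<lambda>u. F (?x + u *\<^sub>R ?e)) has_real_derivative F' ?x) (at (\<sigma> * (t - t)))"
          using der[OF inball[OF abs\<sigma>(1) that]] by simp
        moreover have "((\<lambda>s. \<sigma> * (s - t)) has_real_derivative \<sigma>) (at t)"
          by (auto intro!: derivative_eq_intros)
        ultimately have "(f has_real_derivative F' ?x * \<sigma>) (at t)"
          unfolding f by (rule DERIV_chain2)
        then show ?thesis by (simp add: f'_def mult.commute)
      qed
      have cf': "isCont f' t" if "\<bar>t\<bar> < \<rho>" for t
      proof -
        have "isCont F' (y + (\<sigma> * t) *\<^sub>R ?e)"
          using cont inball[OF abs\<sigma>(1) that] by (simp add: continuous_on_eq_continuous_at)
        moreover have "isCont (\<lambda>s. y + (\<sigma> * s) *\<^sub>R ?e) t" by (intro continuous_intros)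
        ultimately have "isCont (\<lambda>s. F' (y + (\<sigma> * s) *\<^sub>R ?e)) t" by (rule isCont_o2[rotated])
        then show ?thesis unfolding f'_def by (rule continuous_mult[OF continuous_const])
      qed
      have bf: "\<bar>f t\<bar> \<le> B * t" if t: "0 < t" "t < \<rho>" for t
      proof -
        have "\<exists>z>0. z < t \<and> f t - f 0 = (t - 0) * f' z"
          by (rule MVT2) (use t in \<open>auto intro: df\<close>)
        then obtain z where z: "0 < z" "z < t" "f t - f 0 = t * f' z" by auto
        have "f 0 = 0" using zero y by (simp add: f_def)
        moreover have "\<bar>f' z\<bar> \<le> B"
          using bnd[OF inball[OF abs\<sigma>(1), of z]] z t abs\<sigma> by (simp add: f'_def abs_mult)
        ultimately show ?thesis using z t by (simp add: abs_mult mult.commute mult_right_mono)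
      qed
      let ?g = "\<gamma> $ j"
      define E where "E = (\<lambda>t. (f' t * (\<rho>\<^sup>2 - t\<^sup>2) + ?g * (f t / t) * (\<rho>\<^sup>2 - t\<^sup>2)
        - 2 * (\<alpha> + 1) * t * f t) * ((\<rho>\<^sup>2 - t\<^sup>2) powr \<alpha> * t powr ?g))"
      have eq: "\<phi> (\<sigma> * t) = \<sigma> * c * E t" if t: "t \<in> {0<..<\<rho>}" for t
      proof -
        let ?x = "y + (\<sigma> * t) *\<^sub>R ?e"
        have s2: "(\<sigma> * t)\<^sup>2 = t\<^sup>2" and sa: "\<bar>\<sigma> * t\<bar> = t" using \<sigma> t by (auto simp: power_mult_distrib)
        have F': "F' ?x = \<sigma> * f' t" using abs\<sigma> by (simp add: f'_def flip: mult.assoc)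
        have xj: "?x $ j = \<sigma> * t" using y by simp
        have Fx: "F ?x = f t" by (simp add: f_def)
        have quot: "f t / (\<sigma> * t) = \<sigma> * (f t / t)" using \<sigma> by auto
        have ind: "indicator (ball 0 1) ?x = (1::real)"
          using inball[OF abs\<sigma>(1), of t] t by (simp add: indicator_def del: mem_ball)
        have nx: "1 - (norm ?x)\<^sup>2 = \<rho>\<^sup>2 - t\<^sup>2" using nrm[of "\<sigma> * t"] \<rho>(2) s2 by simp
        show ?thesis
          unfolding \<phi>_def \<Phi>_def weight F' xj s2 sa E_def ind nx Fx quot by (simp add: algebra_simps)
      qed
      show ?thesis
      proof (cases "c = 0")
        case True
        then show ?thesis
          by (subst set_lebesgue_integral_cong[where g = "\<lambda>_. 0"]) (auto simp: eq)
      next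
        case False
        have "set_integrable lborel {0<..<\<rho>} (\<lambda>t. \<phi> (\<sigma> * t))"
          unfolding set_integrable_def using int\<sigma> by (intro integrable_mult_indicator) auto
        then have "set_integrable lborel {0<..<\<rho>} (\<lambda>t. \<sigma> * c * E t)"
          by (subst set_integrable_cong[OF refl refl, where f' = "\<lambda>t. \<phi> (\<sigma> * t)"]) (auto simp: eq)
        then have "set_integrable lborel {0<..<\<rho>} E"
          using False \<sigma> set_integrable_mult_right_iff[of "\<sigma> * c" lborel "{0<..<\<rho>}" E] by auto
        then have "(LINT t:{0<..<\<rho>}|lborel. E t) = 0"
          unfolding E_def by (intro integral_slice_eq_zero_1d[where B = B] \<alpha> \<gamma> \<rho> df cf' bf) auto
        then show ?thesis
          by (subst set_lebesgue_integral_cong[where g = "\<lambda>t. \<sigma> * c * E t"]) (auto simp: eq)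
      qed
    qed
    have int': "integrable lborel (\<lambda>t. \<phi> (0 + (-1) * t))"
      using int by (subst lborel_integrable_real_affine_iff) auto
    have split: "AE t in lborel. \<phi> t = indicator {0<..<\<rho>} t * \<phi> t + indicator {0<..<\<rho>} (-t) * \<phi> t"
    proof (rule AE_mp[OF AE_lborel_singleton[of 0]], rule AE_I2, rule impI)
      fix t :: real assume "t \<noteq> 0"
      have z: "\<phi> t = 0" if "\<not> \<bar>t\<bar> < \<rho>"
      proof -
        have "\<rho>\<^sup>2 \<le> t\<^sup>2" using that \<rho>(1) by (metis abs_of_pos abs_le_square_iff not_less)
        then have "y + t *\<^sub>R ?e \<notin> ball 0 1" unfolding ball \<rho>(2) by linarith
        then show ?thesis by (simp add: \<phi>_def \<Phi>_def)
      qed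
      show "\<phi> t = indicator {0<..<\<rho>} t * \<phi> t + indicator {0<..<\<rho>} (-t) * \<phi> t"
        using \<open>t \<noteq> 0\<close> z by (cases "\<bar>t\<bar> < \<rho>"; cases "t > 0") (auto simp: indicator_def)
    qed
    have i1: "integrable lborel (\<lambda>t. indicator {0<..<\<rho>} t * \<phi> t)"
      using integrable_mult_indicator[of "{0<..<\<rho>}", OF _ int] by simp
    have i2: "integrable lborel (\<lambda>t. indicator {0<..<\<rho>} (-t) * \<phi> t)"
      using integrable_mult_indicator[of "{-\<rho><..<0}", OF _ int]
      by (rule Bochner_Integration.integrable_cong[THEN iffD1, rotated 2]) (auto simp: indicator_def)
    have "(\<integral>t. \<phi> t \<partial>lborel) = (\<integral>t. indicator {0<..<\<rho>} t * \<phi> t + indicator {0<..<\<rho>} (-t) * \<phi> t \<partial>lborel)"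
      using split by (rule integral_cong_AE[rotated 2]) (use i1 i2 int in \<open>auto dest!: borel_measurable_integrable\<close>)
    also have "\<dots> = (\<integral>t. indicator {0<..<\<rho>} t * \<phi> t \<partial>lborel) + (\<integral>t. indicator {0<..<\<rho>} (-t) * \<phi> t \<partial>lborel)"
      by (rule Bochner_Integration.integral_add[OF i1 i2])
    also have "(\<integral>t. indicator {0<..<\<rho>} t * \<phi> t \<partial>lborel) = 0"
      using half[of 1] int by (simp add: set_lebesgue_integral_def)
    also have "(\<integral>t. indicator {0<..<\<rho>} (-t) * \<phi> t \<partial>lborel) = 0"
      using half[of "-1"] int' lborel_integral_real_affine[of "-1" "\<lambda>t. indicator {0<..<\<rho>} (-t) * \<phi> t" 0]
      by (simp add: set_lebesgue_integral_def)
    finally show ?thesis by (simp add: \<phi>_def)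
  qed
qed

text \<open>
  Fubini's theorem reduces the claim to the slices in direction \<open>j\<close>.  As \<open>F\<close> vanishes on the hyperplane
  \<open>x\<^sub>j = 0\<close>, the quotient \<open>F x / x\<^sub>j\<close> is bounded and the integrand is integrable, even where \<open>\<gamma>\<^sub>j\<close> is negative.
\<close>

lemma weighted_integration_by_parts:
  fixes \<gamma> :: "real^'n" and F F' :: "real^'n \<Rightarrow> real"
  assumes \<alpha>: "\<alpha> > -1" and \<gamma>: "\<And>i. \<gamma> $ i > -1"
    and contF: "continuous_on (ball 0 1) F" and cont: "continuous_on (ball 0 1) F'"
    and bnd: "\<And>x. x \<in> ball 0 1 \<Longrightarrow> \<bar>F' x\<bar> \<le> B"
    and der: "\<And>x. x \<in> ball 0 1 \<Longrightarrow> ((\<lambda>t. F (x + t *\<^sub>R axis j 1)) has_real_derivative F' x) (at 0)"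
    and zero: "\<And>x. x $ j = 0 \<Longrightarrow> F x = 0"
  shows "integrable (ball_measure \<alpha> \<gamma>) (\<lambda>x. F' x * (1 - (norm x)\<^sup>2) + \<gamma> $ j * (F x / x $ j) * (1 - (norm x)\<^sup>2)
        - 2 * (\<alpha> + 1) * x $ j * F x)" (is "integrable _ ?H")
    and "(\<integral>x. F' x * (1 - (norm x)\<^sup>2) + \<gamma> $ j * (F x / x $ j) * (1 - (norm x)\<^sup>2)
        - 2 * (\<alpha> + 1) * x $ j * F x \<partial>ball_measure \<alpha> \<gamma>) = 0"
proof -
  let ?e = "axis j 1 :: real^'n"
  have B0: "B \<ge> 0" using bnd[of 0] by simp
  have Fbnd: "\<bar>F x\<bar> \<le> B * \<bar>x $ j\<bar>" if x: "x \<in> ball 0 1" for x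
  proof -
    let ?x0 = "x - (x $ j) *\<^sub>R ?e"
    have "norm ?x0 \<le> norm x"
      by (rule norm_le_componentwise_cart) (simp add: axis_def)
    then have x0: "?x0 \<in> ball 0 1" using x by simp
    have "\<bar>F (?x0 + (x $ j) *\<^sub>R ?e) - F ?x0\<bar> \<le> B * \<bar>x $ j\<bar>"
      by (rule axis_increment_bound[OF der bnd x0]) (use x in auto)
    then show ?thesis using zero[of ?x0] by simp
  qed
  have meas: "?H \<in> borel_measurable (ball_measure \<alpha> \<gamma>)"
  proof -
    have [measurable]: "F \<in> borel_measurable (ball_measure \<alpha> \<gamma>)" "F' \<in> borel_measurable (ball_measure \<alpha> \<gamma>)"
      "(\<lambda>x. x $ j) \<in> borel_measurable (ball_measure \<alpha> \<gamma>)" "(\<lambda>x. norm x) \<in> borel_measurable (ball_measure \<alpha> \<gamma>)"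
      by (intro borel_measurable_ball_continuous contF cont continuous_intros)+
    show ?thesis by measurable
  qed
  have Hbnd: "\<bar>?H x\<bar> \<le> B + \<bar>\<gamma> $ j\<bar> * B + 2 * (\<alpha> + 1) * B" if x: "x \<in> ball 0 1" for x
  proof -
    have n: "\<bar>1 - (norm x)\<^sup>2\<bar> \<le> 1" using x abs_square_less_1[of "norm x"] by simp
    have xj: "\<bar>x $ j\<bar> \<le> 1" using component_le_norm_cart[of x j] x by simp
    have q: "\<bar>F x / x $ j\<bar> \<le> B" 
      using Fbnd[OF x] B0 by (cases "x $ j = 0") (auto simp: abs_divide divide_le_eq)
    have "\<bar>F x\<bar> \<le> B" using Fbnd[OF x] mult_left_mono[OF xj B0] by simp
    have "\<bar>F' x * (1 - (norm x)\<^sup>2)\<bar> \<le> B * 1"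
      unfolding abs_mult using bnd[OF x] n B0 by (intro mult_mono) auto
    moreover have "\<bar>\<gamma> $ j * (F x / x $ j) * (1 - (norm x)\<^sup>2)\<bar> \<le> \<bar>\<gamma> $ j\<bar> * B * 1"
      unfolding abs_mult using q n B0 by (intro mult_mono) (auto simp: abs_divide)
    moreover have "\<bar>2 * (\<alpha> + 1) * x $ j * F x\<bar> \<le> 2 * (\<alpha> + 1) * 1 * B"
      unfolding abs_mult using xj \<open>\<bar>F x\<bar> \<le> B\<close> B0 \<alpha> by (intro mult_mono) auto
    ultimately show ?thesis by linarith
  qed
  show int: "integrable (ball_measure \<alpha> \<gamma>) ?H"
    using integrable_ball_bounded[OF \<alpha> \<gamma> meas] Hbnd by blast
  let ?\<Phi> = "\<lambda>x. indicator (ball 0 1) x * (?H x * ball_weight \<alpha> \<gamma> x)"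
  let ?v = "\<lambda>f. \<Sum>b\<in>(Basis::(real^'n) set). f b *\<^sub>R b"
  have int\<Phi>: "integrable lborel ?\<Phi>"
    using int unfolding integrable_ball_measure_iff[OF meas] set_integrable_def by simp
  then have \<Phi>meas: "?\<Phi> \<in> borel_measurable borel" by (simp add: borel_measurable_integrable)
  interpret product_sigma_finite "\<lambda>_::real^'n. lborel :: real measure" by standard
  have e: "?e \<in> Basis" by (simp add: Basis_vec_real)
  have ins: "insert ?e (Basis - {?e}) = (Basis :: (real^'n) set)" using e by blast
  have vmeas: "?v \<in> measurable (Pi\<^sub>M (Basis :: (real^'n) set) (\<lambda>_. lborel)) borel" by measurable
  have intP: "integrable (Pi\<^sub>M (insert ?e (Basis - {?e})) (\<lambda>_. lborel)) (\<lambda>f. ?\<Phi> (?v f))"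
    using int\<Phi> unfolding ins by (subst (asm) lborel_eq) (simp only: integrable_distr_eq[OF vmeas \<Phi>meas])
  have upd: "?v (f(?e := t)) = (\<Sum>b\<in>Basis - {?e}. f b *\<^sub>R b) + t *\<^sub>R ?e" for f :: "real^'n \<Rightarrow> real" and t
    using sum.remove[OF finite_Basis e, of "\<lambda>b. (f(?e := t)) b *\<^sub>R b"]
    by (simp add: add.commute cong: sum.cong_simp)
  have "(\<Sum>b\<in>Basis - {?e}. f b *\<^sub>R b) $ j = 0" for f :: "real^'n \<Rightarrow> real"
  proof -
    have "b $ j = 0" if "b \<in> Basis - {?e}" for b :: "real^'n"
      using that by (auto simp: Basis_vec_real) (auto simp: axis_def)
    then show ?thesis by (simp add: sum_component)
  qed
  then have inner: "(\<integral>t. ?\<Phi> (?v (f(?e := t))) \<partial>lborel) = 0" for f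
    unfolding upd using slice_integral_zero[where F = F and F' = F', OF \<alpha> \<gamma> cont bnd der zero] by simp
  have "(LINT x:ball 0 1|lborel. ?H x * ball_weight \<alpha> \<gamma> x) = integral\<^sup>L lborel ?\<Phi>"
    by (simp add: set_lebesgue_integral_def)
  also have "\<dots> = (\<integral>f. ?\<Phi> (?v f) \<partial>Pi\<^sub>M Basis (\<lambda>_. lborel))"
    by (subst lborel_eq, subst integral_distr[OF vmeas \<Phi>meas]) simp
  also have "\<dots> = 0"
    using product_integral_insert[OF _ _ intP] by (simp only: ins inner) simp
  finally show "integral\<^sup>L (ball_measure \<alpha> \<gamma>) ?H = 0"
    unfolding integral_ball_measure[OF meas] .
qed

section \<open>Monomials and polynomials\<close>

definition monomial :: "('n \<Rightarrow> nat) \<Rightarrow> real^'n \<Rightarrow> real" where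
  "monomial k x = (\<Prod>i\<in>UNIV. (x $ i) ^ k i)"

abbreviation total_degree :: "('n::finite \<Rightarrow> nat) \<Rightarrow> nat" where
  "total_degree k \<equiv> sum k UNIV"

lemma finite_total_degree_le: "finite {k :: 'n::finite \<Rightarrow> nat. total_degree k \<le> N}"
proof (rule finite_subset)
  show "{k :: 'n \<Rightarrow> nat. total_degree k \<le> N} \<subseteq> Pi\<^sub>E UNIV (\<lambda>_. {..N})"
  proof
    fix k :: "'n \<Rightarrow> nat" assume "k \<in> {k. total_degree k \<le> N}"
    moreover have "k i \<le> total_degree k" for i by (rule member_le_sum) auto
    ultimately show "k \<in> Pi\<^sub>E UNIV (\<lambda>_. {..N})" by (auto intro: order_trans)
  qed
qed (auto intro: finite_PiE)

lemma poly_le_iff_monomial_sum: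
  "p \<in> poly_le N \<longleftrightarrow> (\<exists>c. p = (\<lambda>x. \<Sum>k | total_degree k \<le> N. c k * monomial k x))"
  by (auto simp: poly_le_def monomial_def fun_eq_iff)

lemma poly_le_add: "p \<in> poly_le N \<Longrightarrow> q \<in> poly_le N \<Longrightarrow> (\<lambda>x. p x + q x) \<in> poly_le N"
  unfolding poly_le_iff_monomial_sum
  by (elim exE, rule_tac x = "\<lambda>k. c k + ca k" in exI) (simp add: sum.distrib algebra_simps)

lemma poly_le_scale: "p \<in> poly_le N \<Longrightarrow> (\<lambda>x. c * p x) \<in> poly_le N"
  unfolding poly_le_iff_monomial_sum
  by (elim exE, rule_tac x = "\<lambda>k. c * ca k" in exI) (simp add: sum_distrib_left algebra_simps)

lemma poly_le_diff: "p \<in> poly_le N \<Longrightarrow> q \<in> poly_le N \<Longrightarrow> (\<lambda>x. p x - q x) \<in> poly_le N"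
  using poly_le_add[OF _ poly_le_scale[of q N "-1"], of p] by simp

lemma poly_le_zero: "(\<lambda>x. 0) \<in> poly_le N"
  unfolding poly_le_iff_monomial_sum by (rule exI[of _ "\<lambda>_. 0"]) simp

lemma poly_le_sum: "(\<And>i. i \<in> I \<Longrightarrow> f i \<in> poly_le N) \<Longrightarrow> (\<lambda>x. \<Sum>i\<in>I. f i x) \<in> poly_le N"
proof (induction I rule: infinite_finite_induct)
  case (insert i I)
  then show ?case using poly_le_add[of "f i" N "\<lambda>x. \<Sum>i\<in>I. f i x"] by simp
qed (simp_all add: poly_le_zero)

lemma monomial_in_poly_le: 
  assumes "total_degree k \<le> N"
  shows "monomial k \<in> poly_le N"
proof -
  let ?c = "\<lambda>l. if l = k then 1 else 0 :: real"
  have "(\<Sum>l | total_degree l \<le> N. ?c l * monomial l x) = (\<Sum>l\<in>{k}. ?c l * monomial l x)" for x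
    using assms finite_total_degree_le by (intro sum.mono_neutral_right) auto
  then show ?thesis unfolding poly_le_iff_monomial_sum by (intro exI[of _ ?c]) simp
qed

lemma poly_le_induct [consumes 1, case_names monomial zero add scale]:
  assumes p: "p \<in> poly_le N"
    and mono: "\<And>k. total_degree k \<le> N \<Longrightarrow> P (monomial k)"
    and zero: "P (\<lambda>x. 0)"
    and add: "\<And>p q. p \<in> poly_le N \<Longrightarrow> q \<in> poly_le N \<Longrightarrow> P p \<Longrightarrow> P q \<Longrightarrow> P (\<lambda>x. p x + q x)"
    and scale: "\<And>c p. p \<in> poly_le N \<Longrightarrow> P p \<Longrightarrow> P (\<lambda>x. c * p x)"
  shows "P p"
proof -
  obtain c where c: "p = (\<lambda>x. \<Sum>k | total_degree k \<le> N. c k * monomial k x)"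
    using p poly_le_iff_monomial_sum by blast
  have "P (\<lambda>x. \<Sum>k\<in>K. c k * monomial k x)" if "K \<subseteq> {k. total_degree k \<le> N}" for K
    using finite_subset[OF that finite_total_degree_le] that
  proof (induction K rule: finite_induct)
    case empty
    then show ?case by (simp add: zero)
  next
    case (insert k K)
    then have "P (\<lambda>x. c k * monomial k x + (\<Sum>k\<in>K. c k * monomial k x))"
      by (intro add scale mono monomial_in_poly_le poly_le_scale poly_le_sum) auto
    then show ?case using insert by simp
  qed
  then show ?thesis unfolding c by blast
qed

lemma poly_le_mono: 
  assumes "N \<le> M" "p \<in> poly_le N"
  shows "p \<in> poly_le M"
  using assms(2)
proof (induction rule: poly_le_induct)
  case (monomial k)
  then show ?case using assms(1) by (intro monomial_in_poly_le) simp
qed (simp_all add: poly_le_zero poly_le_add poly_le_scale)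

lemma monomial_mult: "monomial k x * monomial l x = monomial (\<lambda>i. k i + l i) x"
  by (simp add: monomial_def power_add prod.distrib)

lemma monomial_split: "monomial k x = (x $ j) ^ k j * (\<Prod>i\<in>UNIV - {j}. (x $ i) ^ k i)"
  unfolding monomial_def by (rule prod.remove) auto

lemma monomial_coordinate: "x $ j * monomial k x = monomial (k(j := Suc (k j))) x"
proof -
  have "(\<Prod>i\<in>UNIV - {j}. (x $ i) ^ (k(j := Suc (k j))) i) = (\<Prod>i\<in>UNIV - {j}. (x $ i) ^ k i)"
    by (rule prod.cong) auto
  then show ?thesis by (simp add: monomial_split[of _ x j])
qed

lemma total_degree_fun_upd: "total_degree (k(j := m)) + k j = total_degree (k :: 'n::finite \<Rightarrow> nat) + m"
proof -
  have split: "total_degree k = k j + sum k (UNIV - {j})" for k :: "'n::finite \<Rightarrow> nat"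
    by (rule sum.remove) auto
  have "sum (k(j := m)) (UNIV - {j}) = sum k (UNIV - {j})"
    by (rule sum.cong) auto
  then show ?thesis unfolding split[of k] split[of "k(j := m)"] by simp
qed

lemma poly_le_coordinate: "p \<in> poly_le N \<Longrightarrow> (\<lambda>x. x $ j * p x) \<in> poly_le (Suc N)"
proof (induction rule: poly_le_induct)
  case (monomial k)
  have "total_degree (k(j := Suc (k j))) \<le> Suc N" using total_degree_fun_upd[of k j "Suc (k j)"] monomial by simp
  moreover have "(\<lambda>x. x $ j * monomial k x) = monomial (k(j := Suc (k j)))"
    by (rule ext) (rule monomial_coordinate)
  ultimately show ?case by (simp only: monomial_in_poly_le)
next
  case (add p q)
  then show ?case using poly_le_add[of "\<lambda>x. x $ j * p x" _ "\<lambda>x. x $ j * q x"] by (simp only: distrib_left)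
next
  case (scale c p)
  then show ?case using poly_le_scale[of "\<lambda>x. x $ j * p x" _ c] by (simp only: mult.left_commute)
next
  case zero
  show ?case by (simp only: mult_zero_right poly_le_zero)
qed

lemma norm_square_sum: "(norm (x::real^'n))\<^sup>2 = (\<Sum>j\<in>UNIV. (x $ j)\<^sup>2)"
  unfolding power2_norm_eq_inner by (simp only: inner_vec_def power2_eq_square inner_real_def)

lemma poly_le_norm_square: "p \<in> poly_le N \<Longrightarrow> (\<lambda>x. (norm x)\<^sup>2 * p x) \<in> poly_le (N + 2)"
proof -
  assume p: "p \<in> poly_le N"
  have "(\<lambda>x. \<Sum>j\<in>UNIV. x $ j * (x $ j * p x)) \<in> poly_le (Suc (Suc N))"
    by (intro poly_le_sum poly_le_coordinate p)
  then show ?thesis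
    unfolding norm_square_sum sum_distrib_right by (simp only: power2_eq_square mult.assoc add_2_eq_Suc')
qed

lemma poly_le_one_minus_norm_square: "p \<in> poly_le N \<Longrightarrow> (\<lambda>x. (1 - (norm x)\<^sup>2) * p x) \<in> poly_le (N + 2)"
  using poly_le_diff[OF poly_le_mono[of N "N + 2" p] poly_le_norm_square[of p N]] by (simp add: algebra_simps)

lemma continuous_on_monomial [continuous_intros]:
  "continuous_on S f \<Longrightarrow> continuous_on S (\<lambda>x. monomial k (f x))"
  unfolding monomial_def by (intro continuous_intros)

lemma continuous_on_poly_le: "p \<in> poly_le N \<Longrightarrow> continuous_on S p"
proof (induction rule: poly_le_induct)
  case (monomial k)
  show ?case by (rule continuous_on_monomial[OF continuous_on_id])
qed (simp_all add: continuous_on_add continuous_on_mult_left)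

section \<open>Moments of monomials\<close>

lemma integrable_continuous:
  fixes u :: "real^'n \<Rightarrow> real" and \<gamma> :: "real^'n"
  assumes "\<alpha> > -1" "\<And>i. \<gamma> $ i > -1" and u: "continuous_on (cball 0 1) u"
  shows "integrable (ball_measure \<alpha> \<gamma>) u"
proof -
  have "bounded (u ` cball 0 1)" using u by (intro compact_imp_bounded compact_continuous_image) auto
  then obtain B where "\<And>x. x \<in> cball 0 1 \<Longrightarrow> norm (u x) \<le> B" unfolding bounded_iff by blast
  then show ?thesis
    by (intro integrable_ball_bounded[where B = B] assms borel_measurable_ball_continuous continuous_on_subset[OF u]) auto
qed

text \<open>
  Since \<open>0 powr a = 0\<close>, the weight is 0 on the hyperplane.
\<close>

lemma AE_ball_measure_coordinate: "AE x in ball_measure \<alpha> \<gamma>. x $ j \<noteq> 0"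
proof -
  have "ball_weight \<alpha> \<gamma> x = 0" if "x $ j = 0" for x
    unfolding ball_weight_def using that by (subst prod.remove[of UNIV j]) auto
  then show ?thesis
    unfolding ball_measure_def
    by (subst AE_density) (auto intro!: AE_I2 measurable_restrict_space1)
qed

text \<open>
  The measure with density \<open>\<Prod>\<^sub>i \<bar>x\<^sub>i\<bar> powr \<gamma>\<^sub>i\<close> is homogeneous, of twice this degree.
\<close>

definition half_homogeneity :: "real^'n \<Rightarrow> real" where
  "half_homogeneity \<gamma> = (real CARD('n) + (\<Sum>j\<in>UNIV. \<gamma> $ j)) / 2"

lemma half_homogeneity_pos:
  fixes \<gamma> :: "real^'n"
  assumes "\<And>i. \<gamma> $ i > -1"
  shows "half_homogeneity \<gamma> > 0"
proof -
  have "0 < 1 + \<gamma> $ j" for j using assms[of j] by simp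
  then have "0 < (\<Sum>j\<in>(UNIV::'n set). 1 + \<gamma> $ j)" by (intro sum_pos) auto
  then show ?thesis by (simp add: half_homogeneity_def sum.distrib)
qed

lemma has_derivative_coordinate_power:
  "((\<lambda>t. ((x + t *\<^sub>R axis j 1) $ j) ^ m) has_real_derivative real m * (x $ j) ^ (m - 1)) (at 0)"
  by (auto intro!: derivative_eq_intros)

lemma monomial_partial:
  "((\<lambda>t. monomial k (x + t *\<^sub>R axis j 1)) has_real_derivative real (k j) * monomial (k(j := k j - 1)) x) (at 0)"
proof -
  have eq: "monomial k (x + t *\<^sub>R axis j 1) = ((x + t *\<^sub>R axis j 1) $ j) ^ k j * (\<Prod>i\<in>UNIV - {j}. (x $ i) ^ k i)" for t
    unfolding monomial_split[of _ _ j] by (auto simp: axis_def intro!: prod.cong)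
  have eq': "monomial (k(j := k j - 1)) x = (x $ j) ^ (k j - 1) * (\<Prod>i\<in>UNIV - {j}. (x $ i) ^ k i)"
    unfolding monomial_split[of _ _ j] by (auto intro!: prod.cong)
  show ?thesis
    unfolding eq eq' using DERIV_cmult_right[OF has_derivative_coordinate_power, where c = "\<Prod>i\<in>UNIV - {j}. (x $ i) ^ k i"]
    by (simp add: mult_ac)
qed

lemma continuous_bounded_cball:
  fixes g :: "real^'n \<Rightarrow> real"
  assumes "continuous_on (cball 0 1) g"
  obtains B where "\<And>x. x \<in> cball 0 1 \<Longrightarrow> \<bar>g x\<bar> \<le> B"
proof -
  have "bounded (g ` cball 0 1)" using assms by (intro compact_imp_bounded compact_continuous_image) auto
  then obtain B where "\<And>x. x \<in> cball 0 1 \<Longrightarrow> norm (g x) \<le> B" unfolding bounded_iff by blast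
  then show thesis using that[of B] by simp
qed

text \<open>
  Integration by parts for \<open>F x = x\<^sub>j x\<^sup>k\<close>, summed over \<open>j\<close>: this is Euler's identity for homogeneous
  functions, tested against the weight.
\<close>

lemma monomial_moment:
  fixes \<gamma> :: "real^'n"
  assumes \<alpha>: "\<alpha> > -1" and \<gamma>: "\<And>i. \<gamma> $ i > -1"
  shows "(real (total_degree k) + 2 * half_homogeneity \<gamma>) * (\<integral>x. monomial k x * (1 - (norm x)\<^sup>2) \<partial>ball_measure \<alpha> \<gamma>)
    = 2 * (\<alpha> + 1) * (\<integral>x. monomial k x * (norm x)\<^sup>2 \<partial>ball_measure \<alpha> \<gamma>)"
proof -
  let ?\<mu> = "ball_measure \<alpha> \<gamma>"
  have int: "integrable ?\<mu> u" if "continuous_on (cball 0 1) u" for u :: "real^'n \<Rightarrow> real"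
    by (rule integrable_continuous[OF \<alpha> \<gamma> that])
  have i1: "integrable ?\<mu> (\<lambda>x. monomial k x * (1 - (norm x)\<^sup>2))"
    and i2: "integrable ?\<mu> (\<lambda>x. (x $ j)\<^sup>2 * monomial k x)" for j
    by (intro int continuous_intros)+
  have each: "(real (k j) + 1 + \<gamma> $ j) * (\<integral>x. monomial k x * (1 - (norm x)\<^sup>2) \<partial>?\<mu>)
      = 2 * (\<alpha> + 1) * (\<integral>x. (x $ j)\<^sup>2 * monomial k x \<partial>?\<mu>)" for j
  proof -
    let ?F = "\<lambda>x. x $ j * monomial k x" and ?F' = "\<lambda>x. (real (k j) + 1) * monomial k x"
    have cF': "continuous_on S ?F'" and cF: "continuous_on S ?F" for S by (intro continuous_intros)+
    obtain B where B: "\<And>x. x \<in> cball 0 1 \<Longrightarrow> \<bar>?F' x\<bar> \<le> B"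
      using continuous_bounded_cball[OF cF'] by metis
    have der: "((\<lambda>t. ?F (x + t *\<^sub>R axis j 1)) has_real_derivative ?F' x) (at 0)" for x
      unfolding monomial_coordinate using monomial_partial[of "k(j := Suc (k j))" x j]
      by (simp add: fun_upd_upd) (simp add: add.commute)
    have "(\<integral>x. ?F' x * (1 - (norm x)\<^sup>2) + \<gamma> $ j * (?F x / x $ j) * (1 - (norm x)\<^sup>2)
        - 2 * (\<alpha> + 1) * x $ j * ?F x \<partial>?\<mu>) = 0" (is "integral\<^sup>L _ ?H = 0")
    proof (rule weighted_integration_by_parts(2)[OF \<alpha> \<gamma>])
      show "\<bar>?F' x\<bar> \<le> B" if "x \<in> ball 0 1" for x using that by (intro B) auto
    qed (use der in \<open>auto intro: cF cF'\<close>)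
    moreover have "integral\<^sup>L ?\<mu> ?H = (\<integral>x. (real (k j) + 1 + \<gamma> $ j) * (monomial k x * (1 - (norm x)\<^sup>2))
        - 2 * (\<alpha> + 1) * ((x $ j)\<^sup>2 * monomial k x) \<partial>?\<mu>)"
    proof (rule integral_cong_AE)
      show "?H \<in> borel_measurable ?\<mu>"
      proof (rule borel_measurable_integrable, rule weighted_integration_by_parts(1)[OF \<alpha> \<gamma>])
        show "\<bar>?F' x\<bar> \<le> B" if "x \<in> ball 0 1" for x using that by (intro B) auto
      qed (use der in \<open>auto intro: cF cF'\<close>)
      show "AE x in ?\<mu>. ?H x = (real (k j) + 1 + \<gamma> $ j) * (monomial k x * (1 - (norm x)\<^sup>2))
        - 2 * (\<alpha> + 1) * ((x $ j)\<^sup>2 * monomial k x)"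
        using AE_ball_measure_coordinate[of j \<alpha> \<gamma>] by eventually_elim (simp add: algebra_simps power2_eq_square)
    qed (intro borel_measurable_ball_continuous continuous_intros)
    ultimately show ?thesis by (simp add: i1 i2)
  qed
  have "(\<Sum>j\<in>UNIV. (real (k j) + 1 + \<gamma> $ j) * (\<integral>x. monomial k x * (1 - (norm x)\<^sup>2) \<partial>?\<mu>))
      = (\<Sum>j\<in>UNIV. 2 * (\<alpha> + 1) * (\<integral>x. (x $ j)\<^sup>2 * monomial k x \<partial>?\<mu>))"
    by (simp only: each)
  also have "\<dots> = 2 * (\<alpha> + 1) * (\<integral>x. (\<Sum>j\<in>UNIV. (x $ j)\<^sup>2 * monomial k x) \<partial>?\<mu>)"
    by (simp add: i2 sum_distrib_left)
  finally have "(\<Sum>j\<in>UNIV. real (k j) + 1 + \<gamma> $ j) * (\<integral>x. monomial k x * (1 - (norm x)\<^sup>2) \<partial>?\<mu>)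
      = 2 * (\<alpha> + 1) * (\<integral>x. (\<Sum>j\<in>UNIV. (x $ j)\<^sup>2 * monomial k x) \<partial>?\<mu>)"
    by (simp add: sum_distrib_right)
  moreover have "2 * half_homogeneity \<gamma> = real CARD('n) + (\<Sum>j\<in>UNIV. \<gamma> $ j)" by (simp add: half_homogeneity_def)
  ultimately show ?thesis
    by (simp add: norm_square_sum sum_distrib_right[symmetric] sum.distrib mult.commute[of "monomial k _"] add.assoc)
qed

section \<open>Reflections in the coordinate hyperplanes\<close>

lemma coord_refl_nth: "coord_refl j x $ i = (if i = j then - (x $ j) else x $ i)"
  by (simp add: coord_refl_def axis_def)

lemma coord_refl_refl [simp]: "coord_refl j (coord_refl j x) = x"
  by (simp add: vec_eq_iff coord_refl_nth)

lemma norm_coord_refl [simp]: "norm (coord_refl j x) = norm x"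
proof -
  have "(norm (coord_refl j x))\<^sup>2 = (norm x)\<^sup>2"
    unfolding norm_square_sum by (intro sum.cong) (auto simp: coord_refl_nth)
  then show ?thesis by simp
qed

lemma ball_weight_coord_refl [simp]: "ball_weight \<alpha> \<gamma> (coord_refl j x) = ball_weight \<alpha> \<gamma> x"
proof -
  have "(\<Prod>i\<in>UNIV. \<bar>coord_refl j x $ i\<bar> powr (\<gamma> $ i)) = (\<Prod>i\<in>UNIV. \<bar>x $ i\<bar> powr (\<gamma> $ i))"
    by (intro prod.cong) (auto simp: coord_refl_nth)
  then show ?thesis by (simp add: ball_weight_def)
qed

lemma continuous_on_coord_refl: "continuous_on S (coord_refl j)"
  unfolding coord_refl_def[abs_def] by (intro continuous_intros)

lemma lborel_coord_refl: "distr lborel borel (coord_refl j) = (lborel :: (real^'n) measure)"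
proof -
  let ?e = "axis j 1 :: real^'n"
  let ?c = "\<lambda>b. if b = ?e then -1 else 1 :: real"
  have e: "?e \<in> Basis" by (simp add: Basis_vec_real)
  have T: "0 + (\<Sum>b\<in>Basis. (?c b * (x \<bullet> b)) *\<^sub>R b) = coord_refl j x" for x
  proof -
    have "(\<Sum>b\<in>Basis. (?c b * (x \<bullet> b)) *\<^sub>R b) = (\<Sum>b\<in>Basis. (x \<bullet> b) *\<^sub>R b - (if b = ?e then (2 * (x \<bullet> ?e)) *\<^sub>R ?e else 0))"
      by (intro sum.cong refl) (simp add: scaleR_left_diff_distrib[symmetric])
    then show ?thesis
      using e by (simp add: sum_subtractf euclidean_representation coord_refl_def inner_axis sum.delta)
  qed
  have "lborel = density (distr lborel borel (\<lambda>x. 0 + (\<Sum>b\<in>Basis. (?c b * (x \<bullet> b)) *\<^sub>R b))) (\<lambda>_. (\<Prod>b\<in>(Basis :: (real^'n) set). \<bar>?c b\<bar>))"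
    by (rule lborel_affine_euclidean) auto
  moreover have "(\<Prod>b\<in>(Basis :: (real^'n) set). \<bar>?c b\<bar>) = 1" by (intro prod.neutral) auto
  ultimately show ?thesis unfolding T by (simp add: density_1)
qed

lemma integral_coord_refl:
  fixes u :: "real^'n \<Rightarrow> real"
  assumes u: "u \<in> borel_measurable (ball_measure \<alpha> \<gamma>)"
  shows "(\<lambda>x. u (coord_refl j x)) \<in> borel_measurable (ball_measure \<alpha> \<gamma>)"
    and "(\<integral>x. u (coord_refl j x) \<partial>ball_measure \<alpha> \<gamma>) = integral\<^sup>L (ball_measure \<alpha> \<gamma>) u"
    and "integrable (ball_measure \<alpha> \<gamma>) u \<Longrightarrow> integrable (ball_measure \<alpha> \<gamma>) (\<lambda>x. u (coord_refl j x))"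
proof -
  have \<sigma>: "coord_refl j \<in> borel_measurable borel"
    by (intro borel_measurable_continuous_onI continuous_on_coord_refl)
  let ?f = "\<lambda>x. indicator (ball 0 1) x * (u x * ball_weight \<alpha> \<gamma> x)"
  have "(\<lambda>x. indicator (ball 0 1) x * u x) \<in> borel_measurable borel"
    using u unfolding borel_measurable_ball_measure_iff set_borel_measurable_def by simp
  note um = this
  have "(\<lambda>x. (indicator (ball 0 1) x * u x) * ball_weight \<alpha> \<gamma> x) \<in> borel_measurable borel"
    by (intro borel_measurable_times um ball_weight_measurable)
  then have f: "?f \<in> borel_measurable borel" by (simp add: mult.assoc)
  have ind: "indicator (ball 0 1) (coord_refl j x) = (indicator (ball 0 1) x :: real)" for x
    by (simp add: indicator_def)
  have "(\<lambda>x. indicator (ball 0 1) (coord_refl j x) * u (coord_refl j x)) \<in> borel_measurable borel"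
    using measurable_compose[OF \<sigma> um] by simp
  then show m: "(\<lambda>x. u (coord_refl j x)) \<in> borel_measurable (ball_measure \<alpha> \<gamma>)"
    unfolding borel_measurable_ball_measure_iff set_borel_measurable_def by (simp add: ind)
  have fs: "?f (coord_refl j x) = indicator (ball 0 1) x * (u (coord_refl j x) * ball_weight \<alpha> \<gamma> x)" for x
    by (simp only: ind ball_weight_coord_refl)
  have "integral\<^sup>L lborel ?f = integral\<^sup>L (distr lborel borel (coord_refl j)) ?f"
    by (simp only: lborel_coord_refl)
  also have "\<dots> = (\<integral>x. ?f (coord_refl j x) \<partial>lborel)"
    by (rule integral_distr) (use \<sigma> f in auto)
  finally show "(\<integral>x. u (coord_refl j x) \<partial>ball_measure \<alpha> \<gamma>) = integral\<^sup>L (ball_measure \<alpha> \<gamma>) u"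
    unfolding integral_ball_measure[OF m, symmetric] integral_ball_measure[OF u, symmetric]
      set_lebesgue_integral_def fs by simp
  show "integrable (ball_measure \<alpha> \<gamma>) (\<lambda>x. u (coord_refl j x))" if "integrable (ball_measure \<alpha> \<gamma>) u"
  proof -
    have "integrable (distr lborel borel (coord_refl j)) ?f"
      using that unfolding integrable_ball_measure_iff[OF u] set_integrable_def lborel_coord_refl by simp
    then have "integrable lborel (\<lambda>x. ?f (coord_refl j x))"
      by (subst (asm) integrable_distr_eq) (use \<sigma> f in auto)
    then show ?thesis
      unfolding integrable_ball_measure_iff[OF m] set_integrable_def fs by simp
  qed
qed

section \<open>Dunkl operators\<close>

lemma C1_ballE:
  fixes u :: "real^'n \<Rightarrow> real"
  assumes "u \<in> C1_ball"
  obtains g B where "continuous_on (cball 0 1) u" "continuous_on (cball 0 1) g"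
    "\<And>x. x \<in> cball 0 1 \<Longrightarrow> \<bar>u x\<bar> \<le> B" "\<And>x. x \<in> cball 0 1 \<Longrightarrow> \<bar>g x\<bar> \<le> B"
    "\<And>x. x \<in> ball 0 1 \<Longrightarrow> ((\<lambda>t. u (x + t *\<^sub>R axis j 1)) has_real_derivative g x) (at 0)"
proof -
  from assms have cu: "continuous_on (cball 0 1) u" by (simp add: C1_ball_def)
  from assms obtain g where g: "continuous_on (cball 0 1) g"
      "\<And>x. x \<in> ball 0 1 \<Longrightarrow> ((\<lambda>t. u (x + t *\<^sub>R axis j 1)) has_real_derivative g x) (at 0)"
    unfolding C1_ball_def by blast
  obtain B1 where B1: "\<And>x. x \<in> cball 0 1 \<Longrightarrow> \<bar>u x\<bar> \<le> B1" using continuous_bounded_cball[OF cu] by metis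
  obtain B2 where B2: "\<And>x. x \<in> cball 0 1 \<Longrightarrow> \<bar>g x\<bar> \<le> B2" using continuous_bounded_cball[OF g(1)] by metis
  show thesis
  proof (rule that[of g "max B1 B2"])
    show "\<bar>u x\<bar> \<le> max B1 B2" if "x \<in> cball 0 1" for x using B1[OF that] by simp
    show "\<bar>g x\<bar> \<le> max B1 B2" if "x \<in> cball 0 1" for x using B2[OF that] by simp
  qed (use cu g in auto)
qed

lemma C1_ball_lincomb:
  fixes u v :: "real^'n \<Rightarrow> real"
  assumes u: "u \<in> C1_ball" and v: "v \<in> C1_ball"
  shows "(\<lambda>x. a * u x + b * v x) \<in> C1_ball"
  unfolding C1_ball_def
proof (intro CollectI conjI allI)
  show "continuous_on (cball 0 1) (\<lambda>x. a * u x + b * v x)"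
    using u v unfolding C1_ball_def by (auto intro!: continuous_on_add continuous_on_mult_left)
  fix j
  obtain g B where g: "continuous_on (cball 0 1) g"
    "\<And>x. x \<in> ball 0 1 \<Longrightarrow> ((\<lambda>t. u (x + t *\<^sub>R axis j 1)) has_real_derivative g x) (at 0)"
    using C1_ballE[OF u] by metis
  obtain h B where h: "continuous_on (cball 0 1) h"
    "\<And>x. x \<in> ball 0 1 \<Longrightarrow> ((\<lambda>t. v (x + t *\<^sub>R axis j 1)) has_real_derivative h x) (at 0)"
    using C1_ballE[OF v] by metis
  show "\<exists>g. continuous_on (cball 0 1) g \<and>
        (\<forall>x\<in>ball 0 1. ((\<lambda>t. a * u (x + t *\<^sub>R axis j 1) + b * v (x + t *\<^sub>R axis j 1)) has_real_derivative g x) (at 0))"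
  proof (intro exI[of _ "\<lambda>x. a * g x + b * h x"] conjI ballI)
    show "continuous_on (cball 0 1) (\<lambda>x. a * g x + b * h x)"
      using g h by (intro continuous_on_add continuous_on_mult_left)
    show "((\<lambda>t. a * u (x + t *\<^sub>R axis j 1) + b * v (x + t *\<^sub>R axis j 1)) has_real_derivative a * g x + b * h x) (at 0)"
      if "x \<in> ball 0 1" for x
      using g(2)[OF that] h(2)[OF that] by (intro DERIV_add DERIV_cmult)
  qed
qed

lemma C1_ball_diff:
  fixes u v :: "real^'n \<Rightarrow> real"
  assumes "u \<in> C1_ball" "v \<in> C1_ball"
  shows "(\<lambda>x. u x - v x) \<in> C1_ball"
  using C1_ball_lincomb[OF assms, of 1 "-1"] by simp

lemma monomial_C1_ball: "monomial k \<in> C1_ball"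
  unfolding C1_ball_def
proof (intro CollectI conjI allI)
  show "continuous_on (cball 0 1) (monomial k)" by (rule continuous_on_monomial[OF continuous_on_id])
  fix j
  show "\<exists>g. continuous_on (cball 0 1) g \<and>
        (\<forall>x\<in>ball 0 1. ((\<lambda>t. monomial k (x + t *\<^sub>R axis j 1)) has_real_derivative g x) (at 0))"
    by (intro exI[of _ "\<lambda>x. real (k j) * monomial (k(j := k j - 1)) x"] conjI ballI monomial_partial
        continuous_on_mult_left continuous_on_monomial continuous_on_id)
qed

lemma poly_le_C1_ball: "p \<in> poly_le N \<Longrightarrow> p \<in> C1_ball"
proof (induction rule: poly_le_induct)
  case (monomial k)
  show ?case by (rule monomial_C1_ball)
next
  case zero
  show ?case using C1_ball_lincomb[OF monomial_C1_ball monomial_C1_ball, of 0 _ 0] by simp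
next
  case (add p q)
  then show ?case using C1_ball_lincomb[of p q 1 1] by simp
next
  case (scale c p)
  then show ?case using C1_ball_lincomb[of p p c 0] by simp
qed

lemma poly_le_partial:
  assumes "p \<in> poly_le N"
  obtains g where "\<And>x. ((\<lambda>t. p (x + t *\<^sub>R axis j 1)) has_real_derivative g x) (at 0)"
proof -
  have "\<exists>g. \<forall>x. ((\<lambda>t. p (x + t *\<^sub>R axis j 1)) has_real_derivative g x) (at 0)"
    using assms
  proof (induction rule: poly_le_induct)
    case (monomial k)
    show ?case by (intro exI allI) (rule monomial_partial)
  next
    case zero
    show ?case by (intro exI[of _ "\<lambda>_. 0"]) simp
  next
    case (add p q)
    then obtain g h where "\<forall>x. ((\<lambda>t. p (x + t *\<^sub>R axis j 1)) has_real_derivative g x) (at 0)"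
      "\<forall>x. ((\<lambda>t. q (x + t *\<^sub>R axis j 1)) has_real_derivative h x) (at 0)" by blast
    then show ?case by (intro exI[of _ "\<lambda>x. g x + h x"]) (simp add: DERIV_add)
  next
    case (scale c p)
    then obtain g where "\<forall>x. ((\<lambda>t. p (x + t *\<^sub>R axis j 1)) has_real_derivative g x) (at 0)" by blast
    then show ?case by (intro exI[of _ "\<lambda>x. c * g x"]) (simp add: DERIV_cmult)
  qed
  then show thesis using that by blast
qed

lemma partial_deriv_eq:
  "((\<lambda>t. u (x + t *\<^sub>R axis j 1)) has_real_derivative d) (at 0) \<Longrightarrow> partial_deriv j u x = d"
  unfolding partial_deriv_def by (rule DERIV_imp_deriv)

lemma dunkl_lincomb:
  assumes "((\<lambda>t. u (x + t *\<^sub>R axis j 1)) has_real_derivative d) (at 0)"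
    and "((\<lambda>t. v (x + t *\<^sub>R axis j 1)) has_real_derivative e) (at 0)"
  shows "dunkl \<gamma> j (\<lambda>x. a * u x + b * v x) x = a * dunkl \<gamma> j u x + b * dunkl \<gamma> j v x"
proof -
  have "partial_deriv j (\<lambda>x. a * u x + b * v x) x = a * d + b * e"
    by (rule partial_deriv_eq) (intro DERIV_add DERIV_cmult assms)
  then show ?thesis
    by (simp add: dunkl_def partial_deriv_eq[OF assms(1)] partial_deriv_eq[OF assms(2)] algebra_simps diff_divide_distrib add_divide_distrib)
qed

lemma dunkl_C1_lincomb:
  fixes u v :: "real^'n \<Rightarrow> real"
  assumes u: "u \<in> C1_ball" and v: "v \<in> C1_ball" and x: "x \<in> ball 0 1"
  shows "dunkl \<gamma> j (\<lambda>x. a * u x + b * v x) x = a * dunkl \<gamma> j u x + b * dunkl \<gamma> j v x"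
proof -
  obtain g where g: "((\<lambda>t. u (x + t *\<^sub>R axis j 1)) has_real_derivative g x) (at 0)"
    using C1_ballE[OF u] x by metis
  obtain h where h: "((\<lambda>t. v (x + t *\<^sub>R axis j 1)) has_real_derivative h x) (at 0)"
    using C1_ballE[OF v] x by metis
  show ?thesis by (rule dunkl_lincomb[where u = u and v = v, OF g h])
qed

lemma dunkl_C1_diff:
  fixes u v :: "real^'n \<Rightarrow> real"
  assumes "u \<in> C1_ball" "v \<in> C1_ball" "x \<in> ball 0 1"
  shows "dunkl \<gamma> j (\<lambda>x. u x - v x) x = dunkl \<gamma> j u x - dunkl \<gamma> j v x"
  using dunkl_C1_lincomb[OF assms, of \<gamma> j 1 "-1"] by simp

text \<open>
  The quotient in the Dunkl operator kills even powers of \<open>x\<^sub>j\<close> and doubles odd ones.  Its value on the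
  hyperplane agrees with this formula, because there only \<open>k j = 1\<close> gives a nonzero value.
\<close>

lemma dunkl_monomial:
  "dunkl \<gamma> j (monomial k) x = (real (k j) + (if odd (k j) then \<gamma> $ j else 0)) * monomial (k(j := k j - 1)) x"
proof -
  let ?R = "\<Prod>i\<in>UNIV - {j}. (x $ i) ^ k i"
  have pd: "partial_deriv j (monomial k) x = real (k j) * monomial (k(j := k j - 1)) x"
    by (rule partial_deriv_eq) (rule monomial_partial)
  have R1: "monomial k x = (x $ j) ^ k j * ?R" by (rule monomial_split)
  have R2: "monomial (k(j := k j - 1)) x = (x $ j) ^ (k j - 1) * ?R"
    unfolding monomial_split[of _ x j] by (auto intro!: prod.cong)
  have R3: "monomial k (coord_refl j x) = (- (x $ j)) ^ k j * ?R"
    unfolding monomial_split[of _ _ j] by (auto simp: coord_refl_nth intro!: prod.cong)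
  show ?thesis
  proof (cases "x $ j = 0")
    case True
    then have "dunkl \<gamma> j (monomial k) x = (1 + \<gamma> $ j) * real (k j) * monomial (k(j := k j - 1)) x"
      unfolding dunkl_def pd by (simp add: algebra_simps)
    moreover have "k j = 0 \<or> k j = 1 \<or> monomial (k(j := k j - 1)) x = 0"
      unfolding R2 using True by (cases "k j = 0"; cases "k j = 1") auto
    ultimately show ?thesis by auto
  next
    case False
    then have "dunkl \<gamma> j (monomial k) x = real (k j) * monomial (k(j := k j - 1)) x
        + (\<gamma> $ j) / 2 * ((monomial k x - monomial k (coord_refl j x)) / x $ j)"
      unfolding dunkl_def pd by simp
    moreover have "(monomial k x - monomial k (coord_refl j x)) / x $ j = (if odd (k j) then 2 * monomial (k(j := k j - 1)) x else 0)"
    proof (cases "odd (k j)")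
      case True
      then have "(x $ j) ^ k j = x $ j * (x $ j) ^ (k j - 1)" by (metis odd_pos power_minus_mult mult.commute)
      then show ?thesis using True False unfolding R1 R2 R3 by (simp add: power_minus_odd)
    next
      case False
      then show ?thesis unfolding R1 R3 by simp
    qed
    ultimately show ?thesis by (simp add: algebra_simps)
  qed
qed

lemma dunkl_poly_le: "p \<in> poly_le N \<Longrightarrow> dunkl \<gamma> j p \<in> poly_le (N - 1)"
proof (induction rule: poly_le_induct)
  case (monomial k)
  have eq: "dunkl \<gamma> j (monomial k) = (\<lambda>x. (real (k j) + (if odd (k j) then \<gamma> $ j else 0)) * monomial (k(j := k j - 1)) x)"
    by (rule ext) (rule dunkl_monomial)
  show ?case
  proof (cases "k j = 0")
    case True
    then show ?thesis unfolding eq by (simp add: poly_le_zero)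
  next
    case False
    then have "total_degree (k(j := k j - 1)) \<le> N - 1" using total_degree_fun_upd[of k j "k j - 1"] monomial by simp
    then show ?thesis unfolding eq by (intro poly_le_scale monomial_in_poly_le)
  qed
next
  case zero
  have "dunkl \<gamma> j (\<lambda>x. 0) = (\<lambda>x. 0)"
    by (rule ext) (simp add: dunkl_def partial_deriv_def)
  then show ?case by (simp add: poly_le_zero)
next
  case (add p q)
  have "dunkl \<gamma> j (\<lambda>x. p x + q x) x = dunkl \<gamma> j p x + dunkl \<gamma> j q x" for x
  proof -
    obtain g h where "((\<lambda>t. p (x + t *\<^sub>R axis j 1)) has_real_derivative g) (at 0)"
      "((\<lambda>t. q (x + t *\<^sub>R axis j 1)) has_real_derivative h) (at 0)"
      using poly_le_partial[OF add(1)] poly_le_partial[OF add(2)] by metis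
    from dunkl_lincomb[OF this, of \<gamma> 1 1] show ?thesis by simp
  qed
  then have "dunkl \<gamma> j (\<lambda>x. p x + q x) = (\<lambda>x. dunkl \<gamma> j p x + dunkl \<gamma> j q x)" by (rule ext)
  then show ?case using add by (simp add: poly_le_add)
next
  case (scale c p)
  have "dunkl \<gamma> j (\<lambda>x. c * p x) x = c * dunkl \<gamma> j p x" for x
  proof -
    obtain g where g: "((\<lambda>t. p (x + t *\<^sub>R axis j 1)) has_real_derivative g) (at 0)"
      using poly_le_partial[OF scale(1)] by metis
    from dunkl_lincomb[OF g g, of \<gamma> c 0] show ?thesis by simp
  qed
  then have "dunkl \<gamma> j (\<lambda>x. c * p x) = (\<lambda>x. c * dunkl \<gamma> j p x)" by (rule ext)
  then show ?case using scale by (simp add: poly_le_scale)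
qed

lemma dunkl_C1_bounded_measurable:
  fixes u :: "real^'n \<Rightarrow> real" and \<gamma> :: "real^'n"
  assumes u: "u \<in> C1_ball"
  obtains B where "\<And>x. x \<in> ball 0 1 \<Longrightarrow> \<bar>dunkl \<gamma> j u x\<bar> \<le> B"
    "\<And>\<alpha> \<gamma>'. dunkl \<gamma> j u \<in> borel_measurable (ball_measure \<alpha> \<gamma>')"
proof -
  obtain g B where g: "continuous_on (cball 0 1) u" "continuous_on (cball 0 1) g"
    "\<And>x. x \<in> cball 0 1 \<Longrightarrow> \<bar>u x\<bar> \<le> B" "\<And>x. x \<in> cball 0 1 \<Longrightarrow> \<bar>g x\<bar> \<le> B"
    "\<And>x. x \<in> ball 0 1 \<Longrightarrow> ((\<lambda>t. u (x + t *\<^sub>R axis j 1)) has_real_derivative g x) (at 0)"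
    using C1_ballE[OF u] by metis
  have B0: "B \<ge> 0" using g(3)[of 0] by simp
  let ?D = "\<lambda>x. g x + (\<gamma> $ j) / 2 * (if x $ j = 0 then 2 * g x else (u x - u (coord_refl j x)) / x $ j)"
  have D: "dunkl \<gamma> j u x = ?D x" if "x \<in> ball 0 1" for x
    unfolding dunkl_def partial_deriv_eq[OF g(5)[OF that]] ..
  have q: "\<bar>if x $ j = 0 then 2 * g x else (u x - u (coord_refl j x)) / x $ j\<bar> \<le> 2 * B" if x: "x \<in> ball 0 1" for x
  proof (cases "x $ j = 0")
    case True
    then show ?thesis using g(4)[of x] x by simp
  next
    case False
    have s: "coord_refl j x = x + (- (2 * x $ j)) *\<^sub>R axis j 1" by (simp add: coord_refl_def)
    have "coord_refl j x \<in> ball 0 1" using x by simp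
    then have "\<bar>u (coord_refl j x) - u x\<bar> \<le> B * \<bar>- (2 * x $ j)\<bar>"
      unfolding s by (intro axis_increment_bound[OF g(5) g(4)] x) auto
    then show ?thesis using False by (simp add: abs_divide divide_le_eq abs_minus_commute abs_mult)
  qed
  show thesis
  proof
    fix x :: "real^'n" assume x: "x \<in> ball 0 1"
    have "\<bar>(\<gamma> $ j) / 2 * (if x $ j = 0 then 2 * g x else (u x - u (coord_refl j x)) / x $ j)\<bar> \<le> \<bar>(\<gamma> $ j) / 2\<bar> * (2 * B)"
      unfolding abs_mult by (intro mult_left_mono q[OF x]) simp
    moreover have "\<bar>g x\<bar> \<le> B" using g(4)[of x] x by simp
    ultimately show "\<bar>dunkl \<gamma> j u x\<bar> \<le> B + \<bar>(\<gamma> $ j) / 2\<bar> * (2 * B)" unfolding D[OF x] by linarith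
  next
    fix \<alpha> and \<gamma>' :: "real^'n"
    have [measurable]: "u \<in> borel_measurable (ball_measure \<alpha> \<gamma>')" "g \<in> borel_measurable (ball_measure \<alpha> \<gamma>')"
      "(\<lambda>x. x $ j) \<in> borel_measurable (ball_measure \<alpha> \<gamma>')"
      by (intro borel_measurable_ball_continuous continuous_on_subset[OF g(1)] continuous_on_subset[OF g(2)] continuous_intros; force)+
    have [measurable]: "(\<lambda>x. u (coord_refl j x)) \<in> borel_measurable (ball_measure \<alpha> \<gamma>')"
      by (intro integral_coord_refl) measurable
    have "?D \<in> borel_measurable (ball_measure \<alpha> \<gamma>')" by measurable
    then show "dunkl \<gamma> j u \<in> borel_measurable (ball_measure \<alpha> \<gamma>')"
      by (subst measurable_cong[where g = ?D]) (use D in auto)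
  qed
qed

text \<open>
  Up to the factor 2, averaging the integrand over the reflection \<open>\<sigma>\<close> gives the integrand of
  \<open>weighted_integration_by_parts\<close> for \<open>F = (u q - (u q) \<circ> \<sigma>) / 2\<close>, which vanishes on the hyperplane.
  The weight is invariant under \<open>\<sigma>\<close>, so averaging does not change the integral.
\<close>

theorem dunkl_by_parts:
  fixes u q :: "real^'n \<Rightarrow> real" and \<gamma> :: "real^'n"
  assumes \<alpha>: "\<alpha> > -1" and \<gamma>: "\<And>i. \<gamma> $ i > -1" and u: "u \<in> C1_ball" and q: "q \<in> C1_ball"
  shows "(\<integral>x. dunkl \<gamma> j u x * q x * (1 - (norm x)\<^sup>2)
      + u x * (dunkl \<gamma> j q x * (1 - (norm x)\<^sup>2) - 2 * (\<alpha> + 1) * x $ j * q x) \<partial>ball_measure \<alpha> \<gamma>) = 0"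
    (is "integral\<^sup>L ?\<mu> ?H = 0")
proof -
  obtain u' B where u': "continuous_on (cball 0 1) u" "continuous_on (cball 0 1) u'"
    "\<And>x. x \<in> cball 0 1 \<Longrightarrow> \<bar>u x\<bar> \<le> B" "\<And>x. x \<in> cball 0 1 \<Longrightarrow> \<bar>u' x\<bar> \<le> B"
    "\<And>x. x \<in> ball 0 1 \<Longrightarrow> ((\<lambda>t. u (x + t *\<^sub>R axis j 1)) has_real_derivative u' x) (at 0)"
    using C1_ballE[OF u] by metis
  obtain q' C where q': "continuous_on (cball 0 1) q" "continuous_on (cball 0 1) q'"
    "\<And>x. x \<in> cball 0 1 \<Longrightarrow> \<bar>q x\<bar> \<le> C" "\<And>x. x \<in> cball 0 1 \<Longrightarrow> \<bar>q' x\<bar> \<le> C"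
    "\<And>x. x \<in> ball 0 1 \<Longrightarrow> ((\<lambda>t. q (x + t *\<^sub>R axis j 1)) has_real_derivative q' x) (at 0)"
    using C1_ballE[OF q] by metis
  let ?\<sigma> = "coord_refl j :: real^'n \<Rightarrow> real^'n"
  have \<sigma>ball: "?\<sigma> ` ball 0 1 \<subseteq> ball 0 1" and \<sigma>cball: "?\<sigma> ` cball 0 1 \<subseteq> cball 0 1" by auto
  define w w' where "w = (\<lambda>x. u x * q x)" and "w' = (\<lambda>x. u' x * q x + u x * q' x)"
  define F F' where "F = (\<lambda>x. (w x - w (?\<sigma> x)) / 2)" and "F' = (\<lambda>x. (w' x + w' (?\<sigma> x)) / 2)"
  have dw: "((\<lambda>t. w (x + t *\<^sub>R axis j 1)) has_real_derivative w' x) (at 0)" if x: "x \<in> ball 0 1" for x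
    using DERIV_mult[OF u'(5)[OF x] q'(5)[OF x]] by (simp add: w_def w'_def algebra_simps)
  have dws: "((\<lambda>t. w (?\<sigma> (x + t *\<^sub>R axis j 1))) has_real_derivative - w' (?\<sigma> x)) (at 0)" if x: "x \<in> ball 0 1" for x
  proof -
    have eq: "?\<sigma> (x + t *\<^sub>R axis j 1) = ?\<sigma> x + (- t) *\<^sub>R axis j 1" for t
      by (simp add: vec_eq_iff coord_refl_nth axis_def)
    have "?\<sigma> x \<in> ball 0 1" using x by simp
    from dw[OF this] have "((\<lambda>t. w (?\<sigma> x + t *\<^sub>R axis j 1)) has_real_derivative w' (?\<sigma> x)) (at (- 0))" by simp
    moreover have "((\<lambda>t::real. - t) has_real_derivative - 1) (at 0)" by (auto intro!: derivative_eq_intros)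
    ultimately have "((\<lambda>t. w (?\<sigma> x + (- t) *\<^sub>R axis j 1)) has_real_derivative w' (?\<sigma> x) * - 1) (at 0)"
      by (rule DERIV_chain2)
    then show ?thesis unfolding eq by simp
  qed
  have cw: "continuous_on (cball 0 1) w" "continuous_on (cball 0 1) w'"
    unfolding w_def w'_def by (intro continuous_on_add continuous_on_mult u' q')+
  have cws: "continuous_on (cball 0 1) (\<lambda>x. w (?\<sigma> x))" "continuous_on (cball 0 1) (\<lambda>x. w' (?\<sigma> x))"
    by (rule continuous_on_compose2[OF cw(1) continuous_on_coord_refl \<sigma>cball],
        rule continuous_on_compose2[OF cw(2) continuous_on_coord_refl \<sigma>cball])
  have cF: "continuous_on (cball 0 1) F" and cF': "continuous_on (cball 0 1) F'"
    unfolding F_def F'_def by (intro continuous_on_divide continuous_on_add continuous_on_diff cw cws continuous_on_const; simp)+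
  obtain M where M: "\<And>x. x \<in> cball 0 1 \<Longrightarrow> \<bar>F' x\<bar> \<le> M" using continuous_bounded_cball[OF cF'] by metis
  have dF: "((\<lambda>t. F (x + t *\<^sub>R axis j 1)) has_real_derivative F' x) (at 0)" if x: "x \<in> ball 0 1" for x
    unfolding F_def F'_def using DERIV_cdivide[OF DERIV_diff[OF dw[OF x] dws[OF x]], of 2] by simp
  have zero: "F x = 0" if "x $ j = 0" for x
  proof -
    have "?\<sigma> x = x" using that by (simp add: coord_refl_def)
    then show ?thesis by (simp add: F_def)
  qed
  let ?I = "\<lambda>x. F' x * (1 - (norm x)\<^sup>2) + \<gamma> $ j * (F x / x $ j) * (1 - (norm x)\<^sup>2) - 2 * (\<alpha> + 1) * x $ j * F x"
  have M': "\<bar>F' x\<bar> \<le> M" if "x \<in> ball 0 1" for x using M[of x] that by simp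
  have cF1: "continuous_on (ball 0 1) F" "continuous_on (ball 0 1) F'"
    by (rule continuous_on_subset[OF cF], force) (rule continuous_on_subset[OF cF'], force)
  note ibp = weighted_integration_by_parts[where F = F and F' = F' and j = j, OF \<alpha> \<gamma> cF1 M' dF zero]
  obtain Du where Du: "\<And>x. x \<in> ball 0 1 \<Longrightarrow> \<bar>dunkl \<gamma> j u x\<bar> \<le> Du" "dunkl \<gamma> j u \<in> borel_measurable ?\<mu>"
    using dunkl_C1_bounded_measurable[OF u] by metis
  obtain Dq where Dq: "\<And>x. x \<in> ball 0 1 \<Longrightarrow> \<bar>dunkl \<gamma> j q x\<bar> \<le> Dq" "dunkl \<gamma> j q \<in> borel_measurable ?\<mu>"
    using dunkl_C1_bounded_measurable[OF q] by metis
  have Hm: "?H \<in> borel_measurable ?\<mu>"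
  proof -
    have [measurable]: "u \<in> borel_measurable ?\<mu>" "q \<in> borel_measurable ?\<mu>"
      "(\<lambda>x. x $ j) \<in> borel_measurable ?\<mu>" "(\<lambda>x. norm x) \<in> borel_measurable ?\<mu>"
      by (intro borel_measurable_ball_continuous continuous_on_subset[OF u'(1)] continuous_on_subset[OF q'(1)] continuous_intros; force)+
    note Du(2)[measurable] Dq(2)[measurable]
    show ?thesis by measurable
  qed
  have Hint: "integrable ?\<mu> ?H"
  proof (rule integrable_ball_bounded[OF \<alpha> \<gamma> Hm])
    fix x :: "real^'n" assume x: "x \<in> ball 0 1"
    have n: "\<bar>1 - (norm x)\<^sup>2\<bar> \<le> 1" using x abs_square_less_1[of "norm x"] by simp
    have xj: "\<bar>x $ j\<bar> \<le> 1" using component_le_norm_cart[of x j] x by simp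
    have ub: "\<bar>u x\<bar> \<le> B" and qb: "\<bar>q x\<bar> \<le> C" using u'(3)[of x] q'(3)[of x] x by auto
    have nn: "B \<ge> 0" "C \<ge> 0" "Du \<ge> 0" "Dq \<ge> 0" using ub qb Du(1)[OF x] Dq(1)[OF x] by linarith+
    have "\<bar>dunkl \<gamma> j u x * q x * (1 - (norm x)\<^sup>2)\<bar> \<le> Du * C * 1"
      unfolding abs_mult using Du(1)[OF x] qb n nn by (intro mult_mono mult_nonneg_nonneg) auto
    moreover have "\<bar>dunkl \<gamma> j q x * (1 - (norm x)\<^sup>2) - 2 * (\<alpha> + 1) * x $ j * q x\<bar> \<le> Dq * 1 + 2 * (\<alpha> + 1) * 1 * C"
    proof -
      have "\<bar>dunkl \<gamma> j q x * (1 - (norm x)\<^sup>2)\<bar> \<le> Dq * 1"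
        unfolding abs_mult using Dq(1)[OF x] n nn by (intro mult_mono) auto
      moreover have "\<bar>2 * (\<alpha> + 1) * x $ j * q x\<bar> \<le> 2 * (\<alpha> + 1) * 1 * C"
        unfolding abs_mult using xj qb nn \<alpha> by (intro mult_mono) auto
      ultimately show ?thesis by linarith
    qed
    then have "\<bar>u x * (dunkl \<gamma> j q x * (1 - (norm x)\<^sup>2) - 2 * (\<alpha> + 1) * x $ j * q x)\<bar> \<le> B * (Dq * 1 + 2 * (\<alpha> + 1) * 1 * C)"
      unfolding abs_mult using ub nn by (intro mult_mono) auto
    ultimately show "\<bar>?H x\<bar> \<le> Du * C * 1 + B * (Dq * 1 + 2 * (\<alpha> + 1) * 1 * C)" by linarith
  qed
  have sym: "?H x + ?H (?\<sigma> x) = 2 * ?I x" if x: "x \<in> ball 0 1" and xj: "x $ j \<noteq> 0" for x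
  proof -
    have sx: "?\<sigma> x \<in> ball 0 1" using x by simp
    have sj: "?\<sigma> x $ j = - (x $ j)" by (simp add: coord_refl_nth)
    define y where "y = x $ j"
    have y: "y \<noteq> 0" using xj by (simp add: y_def)
    have d: "dunkl \<gamma> j f x = f' x + \<gamma> $ j / 2 * ((f x - f (?\<sigma> x)) / y)"
      "dunkl \<gamma> j f (?\<sigma> x) = f' (?\<sigma> x) + \<gamma> $ j / 2 * ((f x - f (?\<sigma> x)) / y)"
      if 1: "((\<lambda>t. f (x + t *\<^sub>R axis j 1)) has_real_derivative f' x) (at 0)"
      and 2: "((\<lambda>t. f (?\<sigma> x + t *\<^sub>R axis j 1)) has_real_derivative f' (?\<sigma> x)) (at 0)" for f f'
      unfolding dunkl_def partial_deriv_eq[OF 1] partial_deriv_eq[OF 2] sj coord_refl_refl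
      using xj by (simp_all add: y_def field_simps)
    show ?thesis
      unfolding d[of u u', OF u'(5)[OF x] u'(5)[OF sx]] d[of q q', OF q'(5)[OF x] q'(5)[OF sx]]
        norm_coord_refl sj F_def F'_def w_def w'_def y_def[symmetric] coord_refl_refl
      using y by (simp add: field_simps)
  qed
  have "2 * integral\<^sup>L ?\<mu> ?H = integral\<^sup>L ?\<mu> ?H + (\<integral>x. ?H (?\<sigma> x) \<partial>?\<mu>)"
    using integral_coord_refl(2)[OF Hm, of j] by simp
  also have "\<dots> = (\<integral>x. ?H x + ?H (?\<sigma> x) \<partial>?\<mu>)"
    by (rule Bochner_Integration.integral_add[symmetric, OF Hint integral_coord_refl(3)[OF Hm Hint]])
  also have "\<dots> = (\<integral>x. 2 * ?I x \<partial>?\<mu>)"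
  proof (rule integral_cong_AE)
    show "AE x in ?\<mu>. ?H x + ?H (?\<sigma> x) = 2 * ?I x"
      using AE_ball_measure_coordinate[of j \<alpha> \<gamma>] AE_space by eventually_elim (use sym in auto)
    show "(\<lambda>x. ?H x + ?H (?\<sigma> x)) \<in> borel_measurable ?\<mu>"
      by (rule borel_measurable_add[OF Hm integral_coord_refl(1)[OF Hm]])
    show "(\<lambda>x. 2 * ?I x) \<in> borel_measurable ?\<mu>"
      using ibp(1) by (intro borel_measurable_times borel_measurable_const borel_measurable_integrable)
  qed
  also have "\<dots> = 2 * integral\<^sup>L ?\<mu> ?I" by (rule integral_mult_right_zero)
  also have "\<dots> = 0" using ibp(2) by simp
  finally show ?thesis by simp
qed

lemma poly_le_0_constant: "p \<in> poly_le 0 \<Longrightarrow> \<exists>c. p = (\<lambda>x. c)"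
proof (induction rule: poly_le_induct)
  case (monomial k)
  then show ?case by (intro exI[of _ 1]) (simp add: monomial_def fun_eq_iff)
qed (auto simp: fun_eq_iff)

text \<open>
  For \<open>c = 2 * (\<alpha> + 1)\<close> the function is, up to the sign, the adjoint of the Dunkl operator applied to \<open>q\<close>,
  as read off from \<open>dunkl_by_parts\<close>.
\<close>

lemma dunkl_adjoint_poly_le:
  assumes "q \<in> poly_le N"
  shows "(\<lambda>x. dunkl \<gamma> j q x * (1 - (norm x)\<^sup>2) - c * x $ j * q x) \<in> poly_le (Suc N)"
proof -
  have "(\<lambda>x. (1 - (norm x)\<^sup>2) * dunkl \<gamma> j q x) \<in> poly_le (Suc N)"
  proof (cases N)
    case 0
    then obtain b where "q = (\<lambda>x. b)" using assms poly_le_0_constant by blast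
    then have "dunkl \<gamma> j q x = 0" for x by (simp add: dunkl_def partial_deriv_def)
    then show ?thesis by (simp add: poly_le_zero)
  next
    case (Suc M)
    then have "dunkl \<gamma> j q \<in> poly_le M" using dunkl_poly_le[OF assms, of \<gamma> j] by simp
    then show ?thesis using poly_le_one_minus_norm_square[of "dunkl \<gamma> j q" M] Suc by simp
  qed
  from poly_le_diff[OF this poly_le_scale[OF poly_le_coordinate[OF assms], of c j]]
  show ?thesis by (simp add: mult_ac)
qed

section \<open>The weighted square integrable functions\<close>

lemma L2_ball_iff:
  fixes u :: "real^'n \<Rightarrow> real"
  shows "u \<in> L2_ball \<alpha> \<gamma> \<longleftrightarrow> u \<in> borel_measurable (ball_measure \<alpha> \<gamma>) \<and> integrable (ball_measure \<alpha> \<gamma>) (\<lambda>x. (u x)\<^sup>2)"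
proof (cases "u \<in> borel_measurable (ball_measure \<alpha> \<gamma>)")
  case True
  then have "(\<lambda>x. (u x)\<^sup>2) \<in> borel_measurable (ball_measure \<alpha> \<gamma>)" by (intro borel_measurable_power)
  from integrable_ball_measure_iff[OF this] show ?thesis
    using True by (simp add: L2_ball_def borel_measurable_ball_measure_iff)
qed (simp add: L2_ball_def borel_measurable_ball_measure_iff)

lemma L2_ball_measurable: "u \<in> L2_ball \<alpha> \<gamma> \<Longrightarrow> u \<in> borel_measurable (ball_measure \<alpha> \<gamma>)"
  by (simp add: L2_ball_iff)

lemma L2_inner_eq:
  fixes u v :: "real^'n \<Rightarrow> real"
  assumes "u \<in> borel_measurable (ball_measure \<alpha> \<gamma>)" "v \<in> borel_measurable (ball_measure \<alpha> \<gamma>)"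
  shows "L2_inner \<alpha> \<gamma> u v = (\<integral>x. u x * v x \<partial>ball_measure \<alpha> \<gamma>)"
  unfolding L2_inner_def by (rule integral_ball_measure) (rule borel_measurable_times[OF assms])

lemma L2_integrable_mult:
  fixes u v :: "real^'n \<Rightarrow> real"
  assumes u: "u \<in> L2_ball \<alpha> \<gamma>" and v: "v \<in> L2_ball \<alpha> \<gamma>"
  shows "integrable (ball_measure \<alpha> \<gamma>) (\<lambda>x. u x * v x)"
proof (rule Bochner_Integration.integrable_bound)
  show "integrable (ball_measure \<alpha> \<gamma>) (\<lambda>x. (u x)\<^sup>2 + (v x)\<^sup>2)"
    using u v by (intro Bochner_Integration.integrable_add) (auto simp: L2_ball_iff)
  show "(\<lambda>x. u x * v x) \<in> borel_measurable (ball_measure \<alpha> \<gamma>)"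
    by (intro borel_measurable_times L2_ball_measurable u v)
  have "\<bar>a * b\<bar> \<le> a\<^sup>2 + b\<^sup>2" for a b :: real
  proof -
    have "2 * \<bar>a\<bar> * \<bar>b\<bar> \<le> a\<^sup>2 + b\<^sup>2" using sum_squares_bound[of "\<bar>a\<bar>" "\<bar>b\<bar>"] by simp
    moreover have "0 \<le> \<bar>a\<bar> * \<bar>b\<bar>" by simp
    ultimately show ?thesis unfolding abs_mult by linarith
  qed
  then show "AE x in ball_measure \<alpha> \<gamma>. norm (u x * v x) \<le> norm ((u x)\<^sup>2 + (v x)\<^sup>2)"
    by (intro AE_I2) (simp add: add_nonneg_nonneg)
qed

lemma L2_ball_lincomb:
  fixes u v :: "real^'n \<Rightarrow> real"
  assumes u: "u \<in> L2_ball \<alpha> \<gamma>" and v: "v \<in> L2_ball \<alpha> \<gamma>"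
  shows "(\<lambda>x. a * u x + b * v x) \<in> L2_ball \<alpha> \<gamma>"
proof -
  have eq: "(a * u x + b * v x)\<^sup>2 = a\<^sup>2 * (u x * u x) + 2 * a * b * (u x * v x) + b\<^sup>2 * (v x * v x)" for x
    by (simp add: power2_eq_square algebra_simps)
  have "integrable (ball_measure \<alpha> \<gamma>) (\<lambda>x. (a * u x + b * v x)\<^sup>2)"
    unfolding eq by (intro Bochner_Integration.integrable_add integrable_mult_right L2_integrable_mult u v)
  moreover have "(\<lambda>x. a * u x + b * v x) \<in> borel_measurable (ball_measure \<alpha> \<gamma>)"
    by (intro borel_measurable_add borel_measurable_times borel_measurable_const L2_ball_measurable u v)
  ultimately show ?thesis by (simp add: L2_ball_iff)
qed

lemma L2_ball_diff:
  fixes u v :: "real^'n \<Rightarrow> real"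
  shows "u \<in> L2_ball \<alpha> \<gamma> \<Longrightarrow> v \<in> L2_ball \<alpha> \<gamma> \<Longrightarrow> (\<lambda>x. u x - v x) \<in> L2_ball \<alpha> \<gamma>"
  using L2_ball_lincomb[of u \<alpha> \<gamma> v 1 "-1"] by simp

lemma L2_inner_commute: "L2_inner \<alpha> \<gamma> u v = L2_inner \<alpha> \<gamma> v u"
  by (simp add: L2_inner_def mult.commute)

lemma L2_inner_lincomb:
  fixes u v w :: "real^'n \<Rightarrow> real"
  assumes u: "u \<in> L2_ball \<alpha> \<gamma>" and v: "v \<in> L2_ball \<alpha> \<gamma>" and w: "w \<in> L2_ball \<alpha> \<gamma>"
  shows "L2_inner \<alpha> \<gamma> (\<lambda>x. a * u x + b * v x) w = a * L2_inner \<alpha> \<gamma> u w + b * L2_inner \<alpha> \<gamma> v w"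
proof -
  have "L2_inner \<alpha> \<gamma> (\<lambda>x. a * u x + b * v x) w = (\<integral>x. a * (u x * w x) + b * (v x * w x) \<partial>ball_measure \<alpha> \<gamma>)"
    by (subst L2_inner_eq) (auto intro!: L2_ball_measurable L2_ball_lincomb u v w Bochner_Integration.integral_cong simp: algebra_simps)
  also have "\<dots> = a * (\<integral>x. u x * w x \<partial>ball_measure \<alpha> \<gamma>) + b * (\<integral>x. v x * w x \<partial>ball_measure \<alpha> \<gamma>)"
    using L2_integrable_mult[OF u w] L2_integrable_mult[OF v w] by simp
  finally show ?thesis by (simp add: L2_inner_eq L2_ball_measurable u v w)
qed

lemma L2_inner_diff:
  fixes u v w :: "real^'n \<Rightarrow> real"
  assumes "u \<in> L2_ball \<alpha> \<gamma>" "v \<in> L2_ball \<alpha> \<gamma>" "w \<in> L2_ball \<alpha> \<gamma>"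
  shows "L2_inner \<alpha> \<gamma> (\<lambda>x. u x - v x) w = L2_inner \<alpha> \<gamma> u w - L2_inner \<alpha> \<gamma> v w"
  using L2_inner_lincomb[OF assms, of 1 "-1"] by simp

lemma L2_inner_nonneg: "L2_inner \<alpha> \<gamma> u u \<ge> 0"
  unfolding L2_inner_def set_lebesgue_integral_def
  by (rule Bochner_Integration.integral_nonneg) simp

lemma L2_norm_nonneg [simp]: "L2_norm \<alpha> \<gamma> u \<ge> 0"
  by (simp add: L2_norm_def L2_inner_nonneg)

lemma L2_norm_square: "(L2_norm \<alpha> \<gamma> u)\<^sup>2 = L2_inner \<alpha> \<gamma> u u"
  by (simp add: L2_norm_def L2_inner_nonneg)

lemma L2_inner_cong:
  assumes "\<And>x. x \<in> ball 0 1 \<Longrightarrow> u x = u' x" "\<And>x. x \<in> ball 0 1 \<Longrightarrow> v x = v' x"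
  shows "L2_inner \<alpha> \<gamma> u v = L2_inner \<alpha> \<gamma> u' v'"
  unfolding L2_inner_def by (rule set_lebesgue_integral_cong) (use assms in auto)

lemma L2_norm_cong:
  assumes "\<And>x. x \<in> ball 0 1 \<Longrightarrow> u x = u' x"
  shows "L2_norm \<alpha> \<gamma> u = L2_norm \<alpha> \<gamma> u'"
  unfolding L2_norm_def using L2_inner_cong[OF assms assms] by simp

lemma L2_norm_lincomb_square:
  fixes u v :: "real^'n \<Rightarrow> real"
  assumes u: "u \<in> L2_ball \<alpha> \<gamma>" and v: "v \<in> L2_ball \<alpha> \<gamma>"
  shows "(L2_norm \<alpha> \<gamma> (\<lambda>x. a * u x + b * v x))\<^sup>2 =
    a\<^sup>2 * (L2_norm \<alpha> \<gamma> u)\<^sup>2 + 2 * a * b * L2_inner \<alpha> \<gamma> u v + b\<^sup>2 * (L2_norm \<alpha> \<gamma> v)\<^sup>2"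
proof -
  let ?w = "\<lambda>x. a * u x + b * v x"
  have w: "?w \<in> L2_ball \<alpha> \<gamma>" by (rule L2_ball_lincomb[OF u v])
  have "L2_inner \<alpha> \<gamma> ?w ?w = a * L2_inner \<alpha> \<gamma> ?w u + b * L2_inner \<alpha> \<gamma> ?w v"
    using L2_inner_lincomb[OF u v w] by (simp add: L2_inner_commute)
  also have "L2_inner \<alpha> \<gamma> ?w u = a * L2_inner \<alpha> \<gamma> u u + b * L2_inner \<alpha> \<gamma> v u" by (rule L2_inner_lincomb[OF u v u])
  also have "L2_inner \<alpha> \<gamma> ?w v = a * L2_inner \<alpha> \<gamma> u v + b * L2_inner \<alpha> \<gamma> v v" by (rule L2_inner_lincomb[OF u v v])
  finally show ?thesis
    unfolding L2_norm_square L2_inner_commute[of \<alpha> \<gamma> v u] by (simp add: power2_eq_square algebra_simps)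
qed

lemma L2_cauchy_schwarz:
  fixes u v :: "real^'n \<Rightarrow> real"
  assumes u: "u \<in> L2_ball \<alpha> \<gamma>" and v: "v \<in> L2_ball \<alpha> \<gamma>"
  shows "\<bar>L2_inner \<alpha> \<gamma> u v\<bar> \<le> L2_norm \<alpha> \<gamma> u * L2_norm \<alpha> \<gamma> v"
proof -
  let ?U = "L2_norm \<alpha> \<gamma> u" and ?V = "L2_norm \<alpha> \<gamma> v" and ?B = "L2_inner \<alpha> \<gamma> u v"
  have q: "0 \<le> a\<^sup>2 * ?U\<^sup>2 + 2 * a * b * ?B + b\<^sup>2 * ?V\<^sup>2" for a b
    unfolding L2_norm_lincomb_square[OF u v, symmetric] by simp
  have "?B\<^sup>2 \<le> ?U\<^sup>2 * ?V\<^sup>2"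
  proof (cases "?V = 0")
    case True
    have "?B = 0"
    proof (rule ccontr)
      assume "?B \<noteq> 0"
      then have "?U\<^sup>2 + 2 * (- (?U\<^sup>2 + 1) / (2 * ?B)) * ?B = -1" by (simp add: field_simps)
      then show False using q[of 1 "- (?U\<^sup>2 + 1) / (2 * ?B)"] True by simp
    qed
    then show ?thesis by simp
  next
    case False
    have "0 \<le> (?V\<^sup>2)\<^sup>2 * ?U\<^sup>2 + 2 * ?V\<^sup>2 * (- ?B) * ?B + (- ?B)\<^sup>2 * ?V\<^sup>2" by (rule q)
    then have "0 \<le> ?V\<^sup>2 * (?U\<^sup>2 * ?V\<^sup>2 - ?B\<^sup>2)" by (simp add: power2_eq_square algebra_simps)
    then show ?thesis using False by (simp add: zero_le_mult_iff)
  qed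
  then have "\<bar>?B\<bar>\<^sup>2 \<le> (?U * ?V)\<^sup>2" by (simp add: power_mult_distrib)
  then show ?thesis by (rule power2_le_imp_le) simp
qed

lemma L2_norm_add:
  fixes u v :: "real^'n \<Rightarrow> real"
  assumes u: "u \<in> L2_ball \<alpha> \<gamma>" and v: "v \<in> L2_ball \<alpha> \<gamma>"
  shows "L2_norm \<alpha> \<gamma> (\<lambda>x. u x + v x) \<le> L2_norm \<alpha> \<gamma> u + L2_norm \<alpha> \<gamma> v"
proof (rule power2_le_imp_le)
  have "(L2_norm \<alpha> \<gamma> (\<lambda>x. u x + v x))\<^sup>2 = (L2_norm \<alpha> \<gamma> u)\<^sup>2 + 2 * L2_inner \<alpha> \<gamma> u v + (L2_norm \<alpha> \<gamma> v)\<^sup>2"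
    using L2_norm_lincomb_square[OF u v, of 1 1] by simp
  also have "\<dots> \<le> (L2_norm \<alpha> \<gamma> u + L2_norm \<alpha> \<gamma> v)\<^sup>2"
    using L2_cauchy_schwarz[OF u v] by (simp add: power2_sum)
  finally show "(L2_norm \<alpha> \<gamma> (\<lambda>x. u x + v x))\<^sup>2 \<le> (L2_norm \<alpha> \<gamma> u + L2_norm \<alpha> \<gamma> v)\<^sup>2" .
qed simp

lemma L2_norm_scale:
  fixes u :: "real^'n \<Rightarrow> real"
  assumes u: "u \<in> L2_ball \<alpha> \<gamma>"
  shows "L2_norm \<alpha> \<gamma> (\<lambda>x. c * u x) = \<bar>c\<bar> * L2_norm \<alpha> \<gamma> u"
proof -
  have "(L2_norm \<alpha> \<gamma> (\<lambda>x. c * u x))\<^sup>2 = (\<bar>c\<bar> * L2_norm \<alpha> \<gamma> u)\<^sup>2"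
    using L2_norm_lincomb_square[OF u u, of c 0] by (simp add: power_mult_distrib)
  then show ?thesis by (simp add: power2_eq_iff_nonneg)
qed

lemma L2_norm_diff:
  fixes u v :: "real^'n \<Rightarrow> real"
  assumes u: "u \<in> L2_ball \<alpha> \<gamma>" and v: "v \<in> L2_ball \<alpha> \<gamma>"
  shows "L2_norm \<alpha> \<gamma> (\<lambda>x. u x - v x) \<le> L2_norm \<alpha> \<gamma> u + L2_norm \<alpha> \<gamma> v"
proof -
  have "(\<lambda>x. -1 * v x) \<in> L2_ball \<alpha> \<gamma>" using L2_ball_lincomb[OF v v, of "-1" 0] by simp
  from L2_norm_add[OF u this] L2_norm_scale[OF v, of "-1"] show ?thesis by simp
qed

lemma L2_norm_triangle:
  fixes u v w :: "real^'n \<Rightarrow> real"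
  assumes "u \<in> L2_ball \<alpha> \<gamma>" "v \<in> L2_ball \<alpha> \<gamma>" "w \<in> L2_ball \<alpha> \<gamma>"
  shows "L2_norm \<alpha> \<gamma> (\<lambda>x. u x - w x) \<le> L2_norm \<alpha> \<gamma> (\<lambda>x. u x - v x) + L2_norm \<alpha> \<gamma> (\<lambda>x. v x - w x)"
  using L2_norm_add[OF L2_ball_diff[OF assms(1,2)] L2_ball_diff[OF assms(2,3)]] by simp

text \<open>
  Pythagoras, for \<open>w = (w - p) + p\<close>.
\<close>

lemma L2_norm_projection_le:
  fixes p w :: "real^'n \<Rightarrow> real"
  assumes w: "w \<in> L2_ball \<alpha> \<gamma>" and p: "p \<in> L2_ball \<alpha> \<gamma>" and orth: "L2_inner \<alpha> \<gamma> (\<lambda>x. w x - p x) p = 0"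
  shows "L2_norm \<alpha> \<gamma> p \<le> L2_norm \<alpha> \<gamma> w" "L2_norm \<alpha> \<gamma> (\<lambda>x. w x - p x) \<le> L2_norm \<alpha> \<gamma> w"
proof -
  have "(L2_norm \<alpha> \<gamma> w)\<^sup>2 = (L2_norm \<alpha> \<gamma> (\<lambda>x. w x - p x))\<^sup>2 + (L2_norm \<alpha> \<gamma> p)\<^sup>2"
    using L2_norm_lincomb_square[OF L2_ball_diff[OF w p] p, of 1 1] orth by simp
  then show "L2_norm \<alpha> \<gamma> p \<le> L2_norm \<alpha> \<gamma> w" "L2_norm \<alpha> \<gamma> (\<lambda>x. w x - p x) \<le> L2_norm \<alpha> \<gamma> w"
    by (rule_tac power2_le_imp_le; simp)+
qed

text \<open>
  The weights with parameters \<open>\<alpha>\<close> and \<open>\<alpha> + 1\<close> differ by the factor \<open>1 - \<bar>x\<bar>\<^sup>2\<close>, which lies in \<open>[0, 1]\<close>.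
\<close>

lemma L2_ball_plus_one:
  fixes u :: "real^'n \<Rightarrow> real"
  assumes u: "u \<in> L2_ball \<alpha> \<gamma>"
  shows "u \<in> L2_ball (\<alpha> + 1) \<gamma>"
    and "v \<in> L2_ball \<alpha> \<gamma> \<Longrightarrow> L2_inner (\<alpha> + 1) \<gamma> u v = (\<integral>x. u x * v x * (1 - (norm x)\<^sup>2) \<partial>ball_measure \<alpha> \<gamma>)"
    and "L2_norm (\<alpha> + 1) \<gamma> u \<le> L2_norm \<alpha> \<gamma> u"
proof -
  have meas: "w \<in> borel_measurable (ball_measure (\<alpha> + 1) \<gamma>)" if "w \<in> L2_ball \<alpha> \<gamma>" for w :: "real^'n \<Rightarrow> real"
    using L2_ball_measurable[OF that] by (simp add: borel_measurable_ball_measure_iff)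
  have m2: "(\<lambda>x. (u x)\<^sup>2) \<in> borel_measurable (ball_measure \<alpha> \<gamma>)"
    by (intro borel_measurable_power L2_ball_measurable u)
  have n: "\<bar>1 - (norm x)\<^sup>2\<bar> \<le> 1" "1 - (norm x)\<^sup>2 \<ge> 0" if "x \<in> ball 0 1" for x :: "real^'n"
    using that abs_square_less_1[of "norm x"] by auto
  have int: "integrable (ball_measure \<alpha> \<gamma>) (\<lambda>x. (u x)\<^sup>2 * (1 - (norm x)\<^sup>2))"
  proof (rule Bochner_Integration.integrable_bound)
    show "integrable (ball_measure \<alpha> \<gamma>) (\<lambda>x. (u x)\<^sup>2)" using u by (simp add: L2_ball_iff)
    show "(\<lambda>x. (u x)\<^sup>2 * (1 - (norm x)\<^sup>2)) \<in> borel_measurable (ball_measure \<alpha> \<gamma>)"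
      by (intro borel_measurable_times m2 borel_measurable_ball_continuous continuous_intros)
    show "AE x in ball_measure \<alpha> \<gamma>. norm ((u x)\<^sup>2 * (1 - (norm x)\<^sup>2)) \<le> norm ((u x)\<^sup>2)"
      using AE_space
    proof eventually_elim
      case (elim x)
      then show ?case using n(1)[of x] by (simp add: abs_mult mult_left_le)
    qed
  qed
  show u1: "u \<in> L2_ball (\<alpha> + 1) \<gamma>"
    using meas[OF u] int integrable_ball_measure_plus_one[OF m2] by (simp add: L2_ball_iff)
  have inner: "L2_inner (\<alpha> + 1) \<gamma> u v = (\<integral>x. u x * v x * (1 - (norm x)\<^sup>2) \<partial>ball_measure \<alpha> \<gamma>)" if v: "v \<in> L2_ball \<alpha> \<gamma>" for v
    unfolding L2_inner_eq[OF meas[OF u] meas[OF v]]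
    by (rule integral_ball_measure_plus_one) (intro borel_measurable_times L2_ball_measurable u v)
  then show "v \<in> L2_ball \<alpha> \<gamma> \<Longrightarrow> L2_inner (\<alpha> + 1) \<gamma> u v = (\<integral>x. u x * v x * (1 - (norm x)\<^sup>2) \<partial>ball_measure \<alpha> \<gamma>)" .
  have "L2_inner (\<alpha> + 1) \<gamma> u u \<le> L2_inner \<alpha> \<gamma> u u"
    unfolding inner[OF u] L2_inner_eq[OF L2_ball_measurable[OF u] L2_ball_measurable[OF u]]
  proof (rule integral_mono_AE)
    show "AE x in ball_measure \<alpha> \<gamma>. u x * u x * (1 - (norm x)\<^sup>2) \<le> u x * u x"
      using AE_space by eventually_elim (simp add: mult_left_le)
  qed (use int u in \<open>auto simp: L2_ball_iff power2_eq_square\<close>)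
  then show "L2_norm (\<alpha> + 1) \<gamma> u \<le> L2_norm \<alpha> \<gamma> u" by (simp add: L2_norm_def)
qed

lemma bounded_L2_ball:
  fixes u :: "real^'n \<Rightarrow> real" and \<gamma> :: "real^'n"
  assumes "\<alpha> > -1" "\<And>i. \<gamma> $ i > -1" "u \<in> borel_measurable (ball_measure \<alpha> \<gamma>)" "\<And>x. x \<in> ball 0 1 \<Longrightarrow> \<bar>u x\<bar> \<le> B"
  shows "u \<in> L2_ball \<alpha> \<gamma>"
proof -
  have "integrable (ball_measure \<alpha> \<gamma>) (\<lambda>x. (u x)\<^sup>2)"
  proof (rule integrable_ball_bounded[OF assms(1,2), where B = "B\<^sup>2"])
    show "(\<lambda>x. (u x)\<^sup>2) \<in> borel_measurable (ball_measure \<alpha> \<gamma>)" by (intro borel_measurable_power assms(3))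
    show "\<bar>(u x)\<^sup>2\<bar> \<le> B\<^sup>2" if "x \<in> ball 0 1" for x
      using assms(4)[OF that] by (simp add: abs_le_square_iff[symmetric])
  qed
  then show ?thesis using assms(3) by (simp add: L2_ball_iff)
qed

lemma C1_ball_L2:
  fixes u :: "real^'n \<Rightarrow> real" and \<gamma> :: "real^'n"
  assumes "\<alpha> > -1" "\<And>i. \<gamma> $ i > -1" "u \<in> C1_ball"
  shows "u \<in> L2_ball \<alpha> \<gamma>" "dunkl \<gamma> j u \<in> L2_ball \<alpha> \<gamma>"
proof -
  obtain g B where u: "continuous_on (cball 0 1) u" "\<And>x. x \<in> cball 0 1 \<Longrightarrow> \<bar>u x\<bar> \<le> B"
    using C1_ballE[OF assms(3)] by metis
  have "continuous_on (ball 0 1) u" by (rule continuous_on_subset[OF u(1)]) auto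
  then show "u \<in> L2_ball \<alpha> \<gamma>"
    by (intro bounded_L2_ball[where B = B] assms borel_measurable_ball_continuous u(2)) auto
  obtain B' where "\<And>x. x \<in> ball 0 1 \<Longrightarrow> \<bar>dunkl \<gamma> j u x\<bar> \<le> B'" "dunkl \<gamma> j u \<in> borel_measurable (ball_measure \<alpha> \<gamma>)"
    using dunkl_C1_bounded_measurable[OF assms(3)] by metis
  then show "dunkl \<gamma> j u \<in> L2_ball \<alpha> \<gamma>" by (intro bounded_L2_ball[where B = B'] assms) auto
qed

text \<open>
  The theorem of Riesz and Fischer for a finite measure.  Along a subsequence \<open>r\<close>, the increments \<open>D k\<close>
  satisfy \<open>\<integral> (D k)\<^sup>2 < (1 / 4) ^ k\<close>, hence are absolutely summable almost everywhere, and the subsequence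
  converges almost everywhere to some \<open>v\<close>.  Fatou's lemma turns this into convergence in mean square.
\<close>

lemma L2_complete:
  fixes M :: "'a measure" and U :: "nat \<Rightarrow> 'a \<Rightarrow> real"
  assumes "finite_measure M"
    and meas [measurable]: "\<And>k. U k \<in> borel_measurable M" and int: "\<And>m n. integrable M (\<lambda>x. (U m x - U n x)\<^sup>2)"
    and int0: "\<And>n. integrable M (\<lambda>x. (U n x)\<^sup>2)"
    and cauchy: "\<And>e. e > 0 \<Longrightarrow> \<exists>K. \<forall>m\<ge>K. \<forall>n\<ge>K. (\<integral>x. (U m x - U n x)\<^sup>2 \<partial>M) < e"
  obtains v where "v \<in> borel_measurable M" "integrable M (\<lambda>x. (v x)\<^sup>2)" "(\<lambda>k. \<integral>x. (U k x - v x)\<^sup>2 \<partial>M) \<longlonglongrightarrow> 0"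
proof -
  interpret finite_measure M by fact
  define K where "K = (\<lambda>e. SOME K. \<forall>m\<ge>K. \<forall>n\<ge>K. (\<integral>x. (U m x - U n x)\<^sup>2 \<partial>M) < e)"
  have K: "(\<integral>x. (U m x - U n x)\<^sup>2 \<partial>M) < e" if "e > 0" "m \<ge> K e" "n \<ge> K e" for e m n
  proof -
    have "\<forall>m\<ge>K e. \<forall>n\<ge>K e. (\<integral>x. (U m x - U n x)\<^sup>2 \<partial>M) < e"
      unfolding K_def using cauchy[OF that(1)] by (rule someI_ex)
    then show ?thesis using that(2,3) by simp
  qed
  define r where "r = (\<lambda>k. \<Sum>i\<le>k. K ((1 / 4) ^ i) + 1)"
  have rK: "r k \<ge> K ((1 / 4) ^ k)" for k 
  proof -
    have "K ((1 / 4) ^ k) + 1 \<le> r k" unfolding r_def by (rule member_le_sum) auto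
    then show ?thesis by simp
  qed
  have rk: "r k \<ge> k" for k unfolding r_def by (induction k) auto
  have rmono: "r (Suc k) \<ge> r k" for k by (simp add: r_def)
  define D where "D = (\<lambda>k x. U (r (Suc k)) x - U (r k) x)"
  have D[measurable]: "D k \<in> borel_measurable M" for k unfolding D_def by measurable
  have D2: "(\<integral>x. (D k x)\<^sup>2 \<partial>M) < (1 / 4) ^ k" for k
    unfolding D_def using rK[of k] rmono[of k] by (intro K) auto
  let ?C = "measure M (space M) + 1"
  \<comment> \<open>The weights balance the two terms: after integration both are of order \<open>(1 / 2) ^ k\<close>.\<close>
  have pt: "\<bar>D k x\<bar> \<le> 2 ^ k * (D k x)\<^sup>2 + (1 / 2) ^ k" for k x
  proof -
    have "0 \<le> (2 ^ k * \<bar>D k x\<bar> - 1)\<^sup>2" by simp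
    then have "2 * (2 ^ k * \<bar>D k x\<bar>) \<le> 2 ^ k * (2 ^ k * (D k x)\<^sup>2) + 1"
      by (simp add: power2_eq_square algebra_simps)
    then have "2 ^ k * \<bar>D k x\<bar> \<le> 2 ^ k * (2 ^ k * (D k x)\<^sup>2) + 1" by (smt (verit) mult_nonneg_nonneg abs_ge_zero zero_le_power)
    then have "2 ^ k * \<bar>D k x\<bar> \<le> 2 ^ k * (2 ^ k * (D k x)\<^sup>2 + (1 / 2) ^ k)"
      by (simp add: distrib_left power_mult_distrib[symmetric])
    then show ?thesis by simp
  qed
  have intD: "integrable M (\<lambda>x. (D k x)\<^sup>2)" for k unfolding D_def by (rule int)
  have iD: "integrable M (D k)" for k
  proof (rule Bochner_Integration.integrable_bound)
    show "integrable M (\<lambda>x. 2 ^ k * (D k x)\<^sup>2 + (1 / 2) ^ k)" using intD by simp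
    show "AE x in M. norm (D k x) \<le> norm (2 ^ k * (D k x)\<^sup>2 + (1 / 2) ^ k)"
      using pt by (intro AE_I2) (simp add: add_nonneg_nonneg)
  qed simp
  have D1: "(\<integral>x. \<bar>D k x\<bar> \<partial>M) \<le> ?C * (1 / 2) ^ k" for k
  proof -
    have "(\<integral>x. \<bar>D k x\<bar> \<partial>M) \<le> (\<integral>x. 2 ^ k * (D k x)\<^sup>2 + (1 / 2) ^ k \<partial>M)"
      using iD intD pt by (intro integral_mono) auto
    also have "\<dots> = 2 ^ k * (\<integral>x. (D k x)\<^sup>2 \<partial>M) + measure M (space M) * (1 / 2) ^ k"
      using intD by simp
    also have "2 ^ k * (\<integral>x. (D k x)\<^sup>2 \<partial>M) \<le> 2 ^ k * (1 / 4) ^ k" using D2[of k] by (intro mult_left_mono) auto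
    also have "(2::real) ^ k * (1 / 4) ^ k = (1 / 2) ^ k" by (simp add: power_mult_distrib[symmetric])
    finally show ?thesis by (simp add: algebra_simps)
  qed
  have "(\<integral>\<^sup>+x. (\<Sum>k. ennreal \<bar>D k x\<bar>) \<partial>M) = (\<Sum>k. \<integral>\<^sup>+x. ennreal \<bar>D k x\<bar> \<partial>M)"
    by (rule nn_integral_suminf) measurable
  also have "\<dots> = (\<Sum>k. ennreal (\<integral>x. \<bar>D k x\<bar> \<partial>M))"
    using iD by (intro suminf_cong nn_integral_eq_integral) auto
  also have "\<dots> \<le> (\<Sum>k. ennreal (?C * (1 / 2) ^ k))"
    by (intro suminf_le ennreal_leI D1 summableI)
  also have "\<dots> < \<infinity>"
  proof -
    have "summable (\<lambda>k. ?C * (1 / 2) ^ k)" by (intro summable_mult summable_geometric) simp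
    then show ?thesis by (subst suminf_ennreal2) auto
  qed
  finally have "AE x in M. (\<Sum>k. ennreal \<bar>D k x\<bar>) \<noteq> \<infinity>"
    by (intro nn_integral_PInf_AE) auto
  then have conv: "AE x in M. (\<lambda>k. U (r k) x) \<longlonglongrightarrow> lim (\<lambda>k. U (r k) x)"
  proof eventually_elim
    case (elim x)
    then have "summable (\<lambda>k. \<bar>D k x\<bar>)" by (intro summable_suminf_not_top) auto
    then have "summable (\<lambda>k. D k x)" by (rule summable_rabs_cancel)
    then have "convergent (\<lambda>n. \<Sum>k<n. D k x)" by (simp add: summable_iff_convergent)
    moreover have "(\<Sum>k<n. D k x) = U (r n) x - U (r 0) x" for n
      unfolding D_def by (rule sum_lessThan_telescope)
    ultimately have "convergent (\<lambda>n. U (r n) x - U (r 0) x)" by simp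
    then have "convergent (\<lambda>n. (U (r n) x - U (r 0) x) + U (r 0) x)" by (intro convergent_add convergent_const)
    then show ?case by (simp add: convergent_LIMSEQ_iff)
  qed
  define v where "v = (\<lambda>x. lim (\<lambda>k. U (r k) x))"
  have v[measurable]: "v \<in> borel_measurable M" unfolding v_def by measurable
  have fatou: "(\<integral>\<^sup>+x. ennreal ((U m x - v x)\<^sup>2) \<partial>M) \<le> ennreal e" if e: "e > 0" and m: "m \<ge> K e" for m e
  proof -
    have "(\<integral>\<^sup>+x. ennreal ((U m x - v x)\<^sup>2) \<partial>M) = (\<integral>\<^sup>+x. liminf (\<lambda>k. ennreal ((U m x - U (r k) x)\<^sup>2)) \<partial>M)"
    proof (rule nn_integral_cong_AE)
      show "AE x in M. ennreal ((U m x - v x)\<^sup>2) = liminf (\<lambda>k. ennreal ((U m x - U (r k) x)\<^sup>2))"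
        using conv
      proof eventually_elim
        case (elim x)
        then have "(\<lambda>k. ennreal ((U m x - U (r k) x)\<^sup>2)) \<longlonglongrightarrow> ennreal ((U m x - v x)\<^sup>2)"
          unfolding v_def by (intro tendsto_ennrealI tendsto_power tendsto_diff tendsto_const)
        then show ?case by (intro lim_imp_Liminf[symmetric]) auto
      qed
    qed
    also have "\<dots> \<le> liminf (\<lambda>k. \<integral>\<^sup>+x. ennreal ((U m x - U (r k) x)\<^sup>2) \<partial>M)"
      by (rule nn_integral_liminf) measurable
    also have "\<dots> \<le> limsup (\<lambda>k. \<integral>\<^sup>+x. ennreal ((U m x - U (r k) x)\<^sup>2) \<partial>M)"
      by (intro Liminf_le_Limsup) simp
    also have "\<dots> \<le> ennreal e"
    proof (rule Limsup_bounded)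
      show "\<forall>\<^sub>F k in sequentially. (\<integral>\<^sup>+x. ennreal ((U m x - U (r k) x)\<^sup>2) \<partial>M) \<le> ennreal e"
        using eventually_ge_at_top[of "K e"]
      proof eventually_elim
        case (elim k)
        then have "r k \<ge> K e" using rk[of k] by simp
        then have "(\<integral>x. (U m x - U (r k) x)\<^sup>2 \<partial>M) \<le> e" using K[OF e m] by (intro less_imp_le)
        then show ?case by (subst nn_integral_eq_integral[OF int]) (auto intro: ennreal_leI)
      qed
    qed
    finally show ?thesis .
  qed
  have intv: "integrable M (\<lambda>x. (U m x - v x)\<^sup>2)" if "m \<ge> K 1" for m
    using fatou[of 1 m] that by (intro integrableI_nonneg) (auto simp: le_less_trans)
  have small: "(\<integral>x. (U m x - v x)\<^sup>2 \<partial>M) \<le> e" if "e > 0" "m \<ge> K e" "m \<ge> K 1" for m e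
    using fatou[OF that(1,2)] that(1) by (subst (asm) nn_integral_eq_integral[OF intv[OF that(3)]]) auto
  show thesis
  proof
    show "v \<in> borel_measurable M" by simp
    show "(\<lambda>k. \<integral>x. (U k x - v x)\<^sup>2 \<partial>M) \<longlonglongrightarrow> 0"
    proof (rule LIMSEQ_I)
      fix e :: real assume e: "e > 0"
      have "norm ((\<integral>x. (U m x - v x)\<^sup>2 \<partial>M) - 0) < e" if "m \<ge> max (K (e / 2)) (K 1)" for m
      proof -
        have "(\<integral>x. (U m x - v x)\<^sup>2 \<partial>M) \<le> e / 2" using e that by (intro small) auto
        moreover have "(\<integral>x. (U m x - v x)\<^sup>2 \<partial>M) \<ge> 0" by simp
        ultimately show ?thesis using e by simp
      qed
      then show "\<exists>no. \<forall>n\<ge>no. norm ((\<integral>x. (U n x - v x)\<^sup>2 \<partial>M) - 0) < e" by blast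
    qed
    show "integrable M (\<lambda>x. (v x)\<^sup>2)"
    proof (rule Bochner_Integration.integrable_bound)
      show "integrable M (\<lambda>x. 2 * (U (K 1) x)\<^sup>2 + 2 * (U (K 1) x - v x)\<^sup>2)"
        using int0 intv[of "K 1"] by simp
      have "a\<^sup>2 \<le> 2 * b\<^sup>2 + 2 * (b - a)\<^sup>2" for a b :: real
        using zero_le_power2[of "a - 2 * b"] by (simp add: power2_eq_square algebra_simps)
      then show "AE x in M. norm ((v x)\<^sup>2) \<le> norm (2 * (U (K 1) x)\<^sup>2 + 2 * (U (K 1) x - v x)\<^sup>2)"
        by (intro AE_I2) simp
    qed measurable
  qed
qed

section \<open>Polynomials of norm zero\<close>

lemma poly_le_line:
  assumes "p \<in> poly_le N"
  obtains P :: "real poly" where "\<And>t. p (x + t *\<^sub>R d) = poly P t"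
proof -
  have "\<exists>P :: real poly. \<forall>t. p (x + t *\<^sub>R d) = poly P t"
    using assms
  proof (induction rule: poly_le_induct)
    case (monomial k)
    show ?case
      by (intro exI[of _ "\<Prod>i\<in>UNIV. [:x $ i, d $ i:] ^ k i"]) (simp add: monomial_def poly_prod)
  next
    case zero
    show ?case by (intro exI[of _ 0]) simp
  next
    case (add p q)
    then obtain P Q :: "real poly" where "\<forall>t. p (x + t *\<^sub>R d) = poly P t" "\<forall>t. q (x + t *\<^sub>R d) = poly Q t" by blast
    then show ?case by (intro exI[of _ "P + Q"]) simp
  next
    case (scale c p)
    then obtain P :: "real poly" where "\<forall>t. p (x + t *\<^sub>R d) = poly P t" by blast
    then show ?case by (intro exI[of _ "Polynomial.smult c P"]) simp
  qed
  then show thesis using that by blast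
qed

text \<open>
  On every line through a point of \<open>S\<close>, the polynomial in one variable obtained by restriction has
  infinitely many roots.
\<close>

lemma poly_le_vanishes_on_open:
  fixes p :: "real^'n \<Rightarrow> real"
  assumes p: "p \<in> poly_le N" and S: "open S" "x \<in> S" and zero: "\<And>x. x \<in> S \<Longrightarrow> p x = 0"
  shows "p = (\<lambda>x. 0)"
proof
  fix y :: "real^'n"
  obtain P :: "real poly" where P: "\<And>t. p (x + t *\<^sub>R (y - x)) = poly P t"
    using poly_le_line[OF p, of x "y - x"] by metis
  have "open ((\<lambda>t. x + t *\<^sub>R (y - x)) -` S)"
    by (rule open_vimage[OF S(1)]) (intro continuous_intros)
  moreover have "(0::real) \<in> (\<lambda>t. x + t *\<^sub>R (y - x)) -` S" using S(2) by simp
  ultimately obtain e where e: "e > 0" "ball 0 e \<subseteq> (\<lambda>t. x + t *\<^sub>R (y - x)) -` S"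
    using openE by blast
  have "{0<..<e} \<subseteq> {t. poly P t = 0}"
  proof
    fix t assume "t \<in> {0<..<e}"
    then have "t \<in> ball 0 e" by simp
    then have "x + t *\<^sub>R (y - x) \<in> S" using e(2) by blast
    then show "t \<in> {t. poly P t = 0}" using zero P[of t] by simp
  qed
  moreover have "infinite {0<..<e}" using e(1) by (simp add: infinite_Ioo)
  ultimately have "P = 0" using poly_roots_finite finite_subset by blast
  then show "p y = 0" using P[of 1] by simp
qed

text \<open>
  The weight is positive on a nonempty open set, so \<open>p\<close> vanishes almost everywhere on it, hence everywhere
  on it by continuity.
\<close>

lemma poly_le_definite:
  fixes p :: "real^'n \<Rightarrow> real" and \<gamma> :: "real^'n"
  assumes \<alpha>: "\<alpha> > -1" and \<gamma>: "\<And>i. \<gamma> $ i > -1" and p: "p \<in> poly_le N" and z: "L2_norm \<alpha> \<gamma> p = 0"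
  shows "p = (\<lambda>x. 0)"
proof -
  let ?S = "ball 0 1 \<inter> (\<Inter>i\<in>UNIV. {x :: real^'n. x $ i \<noteq> 0})"
  have pL: "p \<in> L2_ball \<alpha> \<gamma>" by (rule C1_ball_L2(1)[OF \<alpha> \<gamma> poly_le_C1_ball[OF p]])
  have "(\<integral>x. p x * p x \<partial>ball_measure \<alpha> \<gamma>) = 0"
    using z by (simp add: L2_norm_def L2_inner_eq L2_ball_measurable pL)
  then have "AE x in ball_measure \<alpha> \<gamma>. p x * p x = 0"
    by (subst (asm) integral_nonneg_eq_0_iff_AE) (auto intro: L2_integrable_mult pL)
  then have "AE x in restrict_space lborel (ball 0 1). 0 < ennreal (ball_weight \<alpha> \<gamma> x) \<longrightarrow> p x * p x = 0"
    unfolding ball_measure_def by (subst (asm) AE_density) (auto intro!: measurable_restrict_space1)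
  then have AE: "AE x in lborel. x \<in> ball 0 1 \<longrightarrow> 0 < ennreal (ball_weight \<alpha> \<gamma> x) \<longrightarrow> p x * p x = 0"
    by (subst (asm) AE_restrict_space_iff) auto
  have wpos: "ball_weight \<alpha> \<gamma> x > 0" if "x \<in> ?S" for x
  proof -
    have "1 - (norm x)\<^sup>2 > 0" using that abs_square_less_1[of "norm x"] by simp
    moreover have "(\<Prod>i\<in>UNIV. \<bar>x $ i\<bar> powr (\<gamma> $ i)) > 0" using that by (intro prod_pos) auto
    ultimately show ?thesis by (simp add: ball_weight_def)
  qed
  have openS: "open ?S"
  proof (intro open_Int open_ball open_INT ballI)
    show "open {x :: real^'n. x $ i \<noteq> 0}" for i
      by (rule open_Collect_neq) (intro continuous_intros)+
  qed simp
  let ?T = "?S \<inter> {x. p x \<noteq> 0}"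
  have openT: "open ?T"
    by (intro open_Int openS open_Collect_neq continuous_on_poly_le[OF p] continuous_on_const)
  have "AE x in lborel. x \<notin> ?T"
    using AE
  proof eventually_elim
    case (elim x)
    then show ?case using wpos[of x] by auto
  qed
  then have "?T \<in> null_sets lborel"
    using openT by (subst AE_iff_null_sets) auto
  then have "negligible ?T" by (simp add: negligible_iff_null_sets null_sets_completionI)
  then have "?T = {}" using open_not_negligible[OF openT] by blast
  then have zero: "p x = 0" if "x \<in> ?S" for x using that by blast
  let ?x = "(\<chi> i. 1 / (2 * real CARD('n))) :: real^'n"
  have "norm ?x \<le> (\<Sum>i\<in>UNIV. \<bar>?x $ i\<bar>)" by (rule norm_le_l1_cart)
  then have "?x \<in> ?S" by simp
  then show ?thesis by (rule poly_le_vanishes_on_open[OF p openS _ zero])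
qed

section \<open>The norm on continuously differentiable functions\<close>

text \<open>
  In this form the triangle inequality for \<open>L2_set\<close> applies; the index \<open>None\<close> stands for the function
  itself and \<open>Some j\<close> for its Dunkl derivatives.
\<close>

lemma C1_norm_L2_set:
  "C1_norm \<alpha> \<gamma> u = L2_set (case_option (L2_norm \<alpha> \<gamma> u) (\<lambda>j. L2_norm \<alpha> \<gamma> (dunkl \<gamma> j u))) UNIV"
  unfolding C1_norm_def L2_set_def UNIV_option_conv
  by (subst sum.insert) (auto simp: sum.reindex)

lemma C1_norm_nonneg [simp]: "C1_norm \<alpha> \<gamma> u \<ge> 0"
  by (simp add: C1_norm_L2_set)

lemma L2_norm_le_C1_norm: "L2_norm \<alpha> \<gamma> u \<le> C1_norm \<alpha> \<gamma> u"
  using member_le_L2_set[of UNIV None "case_option (L2_norm \<alpha> \<gamma> u) (\<lambda>j. L2_norm \<alpha> \<gamma> (dunkl \<gamma> j u))"]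
  by (simp add: C1_norm_L2_set)

lemma C1_norm_scale:
  fixes u :: "real^'n \<Rightarrow> real" and \<gamma> :: "real^'n"
  assumes \<alpha>: "\<alpha> > -1" and \<gamma>: "\<And>i. \<gamma> $ i > -1" and u: "u \<in> C1_ball"
  shows "C1_norm \<alpha> \<gamma> (\<lambda>x. c * u x) = \<bar>c\<bar> * C1_norm \<alpha> \<gamma> u"
proof -
  note L = C1_ball_L2[OF \<alpha> \<gamma> u]
  have "L2_norm \<alpha> \<gamma> (dunkl \<gamma> j (\<lambda>x. c * u x)) = \<bar>c\<bar> * L2_norm \<alpha> \<gamma> (dunkl \<gamma> j u)" for j
  proof -
    have "L2_norm \<alpha> \<gamma> (dunkl \<gamma> j (\<lambda>x. c * u x)) = L2_norm \<alpha> \<gamma> (\<lambda>x. c * dunkl \<gamma> j u x)"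
      by (rule L2_norm_cong) (use dunkl_C1_lincomb[OF u u, of _ \<gamma> j c 0] in simp)
    then show ?thesis using L2_norm_scale[OF L(2)] by simp
  qed
  then have "(L2_norm \<alpha> \<gamma> (\<lambda>x. c * u x))\<^sup>2 + (\<Sum>j\<in>UNIV. (L2_norm \<alpha> \<gamma> (dunkl \<gamma> j (\<lambda>x. c * u x)))\<^sup>2)
      = c\<^sup>2 * ((L2_norm \<alpha> \<gamma> u)\<^sup>2 + (\<Sum>j\<in>UNIV. (L2_norm \<alpha> \<gamma> (dunkl \<gamma> j u))\<^sup>2))"
    by (simp add: L2_norm_scale[OF L(1)] power_mult_distrib sum_distrib_left[symmetric] distrib_left)
  then show ?thesis by (simp add: C1_norm_def real_sqrt_mult)
qed

lemma C1_norm_add: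
  fixes u v :: "real^'n \<Rightarrow> real" and \<gamma> :: "real^'n"
  assumes \<alpha>: "\<alpha> > -1" and \<gamma>: "\<And>i. \<gamma> $ i > -1" and u: "u \<in> C1_ball" and v: "v \<in> C1_ball"
  shows "C1_norm \<alpha> \<gamma> (\<lambda>x. u x + v x) \<le> C1_norm \<alpha> \<gamma> u + C1_norm \<alpha> \<gamma> v"
proof -
  note Lu = C1_ball_L2[OF \<alpha> \<gamma> u] and Lv = C1_ball_L2[OF \<alpha> \<gamma> v]
  let ?f = "\<lambda>u. case_option (L2_norm \<alpha> \<gamma> u) (\<lambda>j. L2_norm \<alpha> \<gamma> (dunkl \<gamma> j u))"
  have "L2_norm \<alpha> \<gamma> (dunkl \<gamma> j (\<lambda>x. u x + v x)) \<le> L2_norm \<alpha> \<gamma> (dunkl \<gamma> j u) + L2_norm \<alpha> \<gamma> (dunkl \<gamma> j v)" for j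
  proof -
    have "L2_norm \<alpha> \<gamma> (dunkl \<gamma> j (\<lambda>x. u x + v x)) = L2_norm \<alpha> \<gamma> (\<lambda>x. dunkl \<gamma> j u x + dunkl \<gamma> j v x)"
      by (rule L2_norm_cong) (use dunkl_C1_lincomb[OF u v, of _ \<gamma> j 1 1] in simp)
    then show ?thesis using L2_norm_add[OF Lu(2) Lv(2)] by simp
  qed
  then have "L2_set (?f (\<lambda>x. u x + v x)) UNIV \<le> L2_set (\<lambda>i. ?f u i + ?f v i) UNIV"
    by (intro L2_set_mono) (auto split: option.split intro: L2_norm_add[OF Lu(1) Lv(1)])
  also have "\<dots> \<le> L2_set (?f u) UNIV + L2_set (?f v) UNIV" by (rule L2_set_triangle_ineq)
  finally show ?thesis by (simp add: C1_norm_L2_set)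
qed

lemma C1_norm_minus_commute:
  fixes u v :: "real^'n \<Rightarrow> real" and \<gamma> :: "real^'n"
  assumes \<alpha>: "\<alpha> > -1" and \<gamma>: "\<And>i. \<gamma> $ i > -1" and u: "u \<in> C1_ball" and v: "v \<in> C1_ball"
  shows "C1_norm \<alpha> \<gamma> (\<lambda>x. u x - v x) = C1_norm \<alpha> \<gamma> (\<lambda>x. v x - u x)"
  using C1_norm_scale[OF \<alpha> \<gamma> C1_ball_diff[OF u v], of "-1"] by simp

lemma C1_norm_triangle:
  fixes u v w :: "real^'n \<Rightarrow> real" and \<gamma> :: "real^'n"
  assumes \<alpha>: "\<alpha> > -1" and \<gamma>: "\<And>i. \<gamma> $ i > -1" and u: "u \<in> C1_ball" and v: "v \<in> C1_ball" and w: "w \<in> C1_ball"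
  shows "C1_norm \<alpha> \<gamma> (\<lambda>x. u x - w x) \<le> C1_norm \<alpha> \<gamma> (\<lambda>x. u x - v x) + C1_norm \<alpha> \<gamma> (\<lambda>x. v x - w x)"
  using C1_norm_add[OF \<alpha> \<gamma> C1_ball_diff[OF u v] C1_ball_diff[OF v w]] by simp

lemma C1_norm_reverse_triangle:
  fixes u v :: "real^'n \<Rightarrow> real" and \<gamma> :: "real^'n"
  assumes \<alpha>: "\<alpha> > -1" and \<gamma>: "\<And>i. \<gamma> $ i > -1" and u: "u \<in> C1_ball" and v: "v \<in> C1_ball"
  shows "\<bar>C1_norm \<alpha> \<gamma> u - C1_norm \<alpha> \<gamma> v\<bar> \<le> C1_norm \<alpha> \<gamma> (\<lambda>x. u x - v x)"
  using C1_norm_add[OF \<alpha> \<gamma> C1_ball_diff[OF u v] v] C1_norm_add[OF \<alpha> \<gamma> C1_ball_diff[OF v u] u]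
    C1_norm_minus_commute[OF \<alpha> \<gamma> u v] by simp

section \<open>Orthogonal projection onto polynomials\<close>

text \<open>
  The existence of orthogonal projections onto \<open>V\<close>, together with the bound of one norm on \<open>V\<close> by the other:
  both follow by the same induction on the dimension.
\<close>

definition projectable :: "real \<Rightarrow> real^'n \<Rightarrow> (real^'n \<Rightarrow> real) set \<Rightarrow> bool" where
  "projectable \<alpha> \<gamma> V \<longleftrightarrow>
    (\<forall>u\<in>L2_ball \<alpha> \<gamma>. \<exists>p\<in>V. \<forall>q\<in>V. L2_inner \<alpha> \<gamma> (\<lambda>x. u x - p x) q = 0) \<and>
    (\<exists>C\<ge>0. \<forall>p\<in>V. C1_norm \<alpha> \<gamma> p \<le> C * L2_norm \<alpha> \<gamma> p)"

text \<open>
  One step of the Gram-Schmidt process: \<open>f\<close> is the part of \<open>e\<close> orthogonal to \<open>V\<close>.  If its norm is 0, then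
  it vanishes by definiteness and the space does not grow.
\<close>

lemma projectable_extend:
  fixes \<gamma> :: "real^'n" and e :: "real^'n \<Rightarrow> real"
  assumes \<alpha>: "\<alpha> > -1" and \<gamma>: "\<And>i. \<gamma> $ i > -1" and V: "projectable \<alpha> \<gamma> V" "V \<subseteq> poly_le N"
    and lin: "\<And>a b p q. p \<in> V \<Longrightarrow> q \<in> V \<Longrightarrow> (\<lambda>x. a * p x + b * q x) \<in> V" and e: "e \<in> poly_le N"
  shows "projectable \<alpha> \<gamma> {(\<lambda>x. p x + c * e x) | p c. p \<in> V}" (is "projectable \<alpha> \<gamma> ?W")
proof -
  have polyL: "p \<in> L2_ball \<alpha> \<gamma>" if "p \<in> poly_le N" for p
    by (rule C1_ball_L2(1)[OF \<alpha> \<gamma> poly_le_C1_ball[OF that]])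
  have VL: "p \<in> L2_ball \<alpha> \<gamma>" if "p \<in> V" for p using V(2) that by (intro polyL) (rule subsetD)
  have Vp: "\<forall>u\<in>L2_ball \<alpha> \<gamma>. \<exists>p\<in>V. \<forall>q\<in>V. L2_inner \<alpha> \<gamma> (\<lambda>x. u x - p x) q = 0"
    and VC: "\<exists>C\<ge>0. \<forall>p\<in>V. C1_norm \<alpha> \<gamma> p \<le> C * L2_norm \<alpha> \<gamma> p"
    using V(1) unfolding projectable_def by (rule conjunct1, rule conjunct2)
  obtain s0 where s0: "s0 \<in> V" "\<And>q. q \<in> V \<Longrightarrow> L2_inner \<alpha> \<gamma> (\<lambda>x. e x - s0 x) q = 0"
    using bspec[OF Vp polyL[OF e]] by (elim bexE) simp
  define f where "f = (\<lambda>x. e x - s0 x)"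
  have fp: "f \<in> poly_le N" unfolding f_def using e s0(1) V(2) by (intro poly_le_diff) auto
  have fL: "f \<in> L2_ball \<alpha> \<gamma>" by (rule polyL[OF fp])
  have fV: "L2_inner \<alpha> \<gamma> f q = 0" if "q \<in> V" for q using s0(2)[OF that] by (simp add: f_def)
  have W: "w \<in> ?W \<longleftrightarrow> (\<exists>s\<in>V. \<exists>c. w = (\<lambda>x. s x + c * f x))" for w
  proof
    assume "w \<in> ?W"
    then obtain p c where p: "p \<in> V" "w = (\<lambda>x. p x + c * e x)" by blast
    have "(\<lambda>x. 1 * p x + c * s0 x) \<in> V" by (rule lin[OF p(1) s0(1)])
    moreover have "w = (\<lambda>x. (1 * p x + c * s0 x) + c * f x)" by (simp add: p(2) f_def algebra_simps)
    ultimately show "\<exists>s\<in>V. \<exists>c. w = (\<lambda>x. s x + c * f x)"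
      by (intro bexI[of _ "\<lambda>x. 1 * p x + c * s0 x"] exI[of _ c])
  next
    assume "\<exists>s\<in>V. \<exists>c. w = (\<lambda>x. s x + c * f x)"
    then obtain p c where p: "p \<in> V" "w = (\<lambda>x. p x + c * f x)" by blast
    have "(\<lambda>x. 1 * p x + (- c) * s0 x) \<in> V" by (rule lin[OF p(1) s0(1)])
    moreover have "w = (\<lambda>x. (1 * p x + (- c) * s0 x) + c * e x)" by (simp add: p(2) f_def algebra_simps)
    ultimately show "w \<in> ?W"
      by (intro CollectI exI[of _ "\<lambda>x. 1 * p x + (- c) * s0 x"] exI[of _ c] conjI)
  qed
  show ?thesis
  proof (cases "L2_norm \<alpha> \<gamma> f = 0")
    case True
    then have f0: "f x = 0" for x using poly_le_definite[OF \<alpha> \<gamma> fp] by simp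
    have "?W = V"
    proof (rule set_eqI)
      show "w \<in> ?W \<longleftrightarrow> w \<in> V" for w unfolding W by (simp add: f0)
    qed
    then show ?thesis using V(1) by simp
  next
    case False
    then have nf: "L2_norm \<alpha> \<gamma> f > 0" using L2_norm_nonneg[of \<alpha> \<gamma> f] by linarith
    then have ff: "L2_inner \<alpha> \<gamma> f f > 0" unfolding L2_norm_square[symmetric] by simp
    obtain C where C: "C \<ge> 0" "\<And>p. p \<in> V \<Longrightarrow> C1_norm \<alpha> \<gamma> p \<le> C * L2_norm \<alpha> \<gamma> p"
      using VC by (elim exE conjE) simp
    have "\<exists>p\<in>?W. \<forall>q\<in>?W. L2_inner \<alpha> \<gamma> (\<lambda>x. u x - p x) q = 0" if u: "u \<in> L2_ball \<alpha> \<gamma>" for u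
    proof -
      obtain p0 where p0: "p0 \<in> V" "\<And>q. q \<in> V \<Longrightarrow> L2_inner \<alpha> \<gamma> (\<lambda>x. u x - p0 x) q = 0"
        using bspec[OF Vp u] by (elim bexE) simp
      define c where "c = L2_inner \<alpha> \<gamma> u f / L2_inner \<alpha> \<gamma> f f"
      let ?p = "\<lambda>x. p0 x + c * f x"
      note p0L = VL[OF p0(1)]
      have d: "(\<lambda>x. u x - ?p x) = (\<lambda>x. 1 * (u x - p0 x) + (- c) * f x)" by (simp add: algebra_simps)
      have orth: "L2_inner \<alpha> \<gamma> (\<lambda>x. u x - ?p x) q = L2_inner \<alpha> \<gamma> (\<lambda>x. u x - p0 x) q - c * L2_inner \<alpha> \<gamma> f q"
        if "q \<in> L2_ball \<alpha> \<gamma>" for q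
        unfolding d L2_inner_lincomb[OF L2_ball_diff[OF u p0L] fL that] by simp
      have of: "L2_inner \<alpha> \<gamma> (\<lambda>x. u x - ?p x) f = 0"
        using orth[OF fL] L2_inner_diff[OF u p0L fL] fV[OF p0(1)] ff L2_inner_commute[of \<alpha> \<gamma> p0 f] by (simp add: c_def)
      have oV: "L2_inner \<alpha> \<gamma> (\<lambda>x. u x - ?p x) q = 0" if "q \<in> V" for q
        using orth[OF VL[OF that]] p0(2)[OF that] fV[OF that] by simp
      have dL: "(\<lambda>x. u x - ?p x) \<in> L2_ball \<alpha> \<gamma>"
        unfolding d by (intro L2_ball_lincomb L2_ball_diff u p0L fL)
      have "L2_inner \<alpha> \<gamma> (\<lambda>x. u x - ?p x) q = 0" if q: "q \<in> ?W" for q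
      proof -
        obtain s b where s: "s \<in> V" "q = (\<lambda>x. 1 * s x + b * f x)" using q[unfolded W] by auto
        have "L2_inner \<alpha> \<gamma> q (\<lambda>x. u x - ?p x) = 1 * L2_inner \<alpha> \<gamma> s (\<lambda>x. u x - ?p x) + b * L2_inner \<alpha> \<gamma> f (\<lambda>x. u x - ?p x)"
          unfolding s(2) by (rule L2_inner_lincomb[OF VL[OF s(1)] fL dL])
        then show ?thesis using of oV[OF s(1)] by (simp add: L2_inner_commute)
      qed
      moreover have "?p \<in> ?W" unfolding W by (intro bexI[OF _ p0(1)] exI[of _ c] refl)
      ultimately show ?thesis by (intro bexI[of _ ?p] ballI)
    qed
    moreover have "C1_norm \<alpha> \<gamma> w \<le> (C + C1_norm \<alpha> \<gamma> f / L2_norm \<alpha> \<gamma> f) * L2_norm \<alpha> \<gamma> w" if w: "w \<in> ?W" for w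
    proof -
      obtain s b where s: "s \<in> V" "w = (\<lambda>x. s x + b * f x)" using w[unfolded W] by auto
      have sC: "s \<in> C1_ball" and fC: "f \<in> C1_ball" using s(1) V(2) fp poly_le_C1_ball by blast+
      have bfC: "(\<lambda>x. b * f x) \<in> C1_ball" using C1_ball_lincomb[OF fC fC, of b 0] by simp
      have "(L2_norm \<alpha> \<gamma> w)\<^sup>2 = (L2_norm \<alpha> \<gamma> s)\<^sup>2 + b\<^sup>2 * (L2_norm \<alpha> \<gamma> f)\<^sup>2"
        using L2_norm_lincomb_square[OF VL[OF s(1)] fL, of 1 b] fV[OF s(1)] L2_inner_commute[of \<alpha> \<gamma> s f] by (simp add: s(2))
      then have "(L2_norm \<alpha> \<gamma> s)\<^sup>2 \<le> (L2_norm \<alpha> \<gamma> w)\<^sup>2" "(\<bar>b\<bar> * L2_norm \<alpha> \<gamma> f)\<^sup>2 \<le> (L2_norm \<alpha> \<gamma> w)\<^sup>2"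
        by (simp_all add: power_mult_distrib)
      then have 1: "L2_norm \<alpha> \<gamma> s \<le> L2_norm \<alpha> \<gamma> w" "\<bar>b\<bar> * L2_norm \<alpha> \<gamma> f \<le> L2_norm \<alpha> \<gamma> w"
        by (auto intro: power2_le_imp_le)
      have "C1_norm \<alpha> \<gamma> w \<le> C1_norm \<alpha> \<gamma> s + \<bar>b\<bar> * C1_norm \<alpha> \<gamma> f"
        unfolding s(2) using C1_norm_add[OF \<alpha> \<gamma> sC bfC] C1_norm_scale[OF \<alpha> \<gamma> fC] by simp
      also have "C1_norm \<alpha> \<gamma> s \<le> C * L2_norm \<alpha> \<gamma> w"
        using C(2)[OF s(1)] mult_left_mono[OF 1(1) C(1)] by linarith
      also have "\<bar>b\<bar> * C1_norm \<alpha> \<gamma> f \<le> C1_norm \<alpha> \<gamma> f / L2_norm \<alpha> \<gamma> f * L2_norm \<alpha> \<gamma> w"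
      proof -
        have "\<bar>b\<bar> \<le> L2_norm \<alpha> \<gamma> w / L2_norm \<alpha> \<gamma> f" using 1(2) nf by (simp add: pos_le_divide_eq)
        from mult_right_mono[OF this C1_norm_nonneg[of \<alpha> \<gamma> f]] show ?thesis by (simp add: mult.commute)
      qed
      finally show ?thesis by (simp add: algebra_simps)
    qed
    moreover have "C + C1_norm \<alpha> \<gamma> f / L2_norm \<alpha> \<gamma> f \<ge> 0" using C(1) by simp
    ultimately show ?thesis
      unfolding projectable_def by (intro conjI exI[of _ "C + C1_norm \<alpha> \<gamma> f / L2_norm \<alpha> \<gamma> f"] ballI)
  qed
qed

lemma projectable_poly_le:
  fixes \<gamma> :: "real^'n"
  assumes \<alpha>: "\<alpha> > -1" and \<gamma>: "\<And>i. \<gamma> $ i > -1"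
  shows "projectable \<alpha> \<gamma> (poly_le N)"
proof -
  let ?span = "\<lambda>K. {(\<lambda>x. \<Sum>k\<in>K. c k * monomial k x) | c. True} :: (real^'n \<Rightarrow> real) set"
  have sub: "?span K \<subseteq> poly_le N" if "K \<subseteq> {k. total_degree k \<le> N}" for K
    using that by (auto intro!: poly_le_sum poly_le_scale monomial_in_poly_le)
  have proj: "projectable \<alpha> \<gamma> (?span K)" if "K \<subseteq> {k. total_degree k \<le> N}" for K
    using finite_subset[OF that finite_total_degree_le] that
  proof (induction K rule: finite_induct)
    case empty
    have "L2_inner \<alpha> \<gamma> u (\<lambda>x. 0) = 0" for u by (simp add: L2_inner_def)
    moreover have "dunkl \<gamma> j (\<lambda>x. 0) = (\<lambda>x. 0)" for j
      by (rule ext) (simp add: dunkl_def partial_deriv_def)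
    then have "C1_norm \<alpha> \<gamma> (\<lambda>x. 0) = 0" by (simp add: C1_norm_def L2_norm_def L2_inner_def)
    ultimately show ?case by (auto simp: projectable_def)
  next
    case (insert k K)
    have "projectable \<alpha> \<gamma> {(\<lambda>x. p x + c * monomial k x) | p c. p \<in> ?span K}"
    proof (rule projectable_extend[OF \<alpha> \<gamma>])
      show "projectable \<alpha> \<gamma> (?span K)" "?span K \<subseteq> poly_le N" using insert sub by auto
      show "monomial k \<in> poly_le N" using insert.prems by (intro monomial_in_poly_le) auto
      fix a b p q assume "p \<in> ?span K" "q \<in> ?span K"
      then obtain c d where "p = (\<lambda>x. \<Sum>k\<in>K. c k * monomial k x)" "q = (\<lambda>x. \<Sum>k\<in>K. d k * monomial k x)" by blast
      then have "(\<lambda>x. a * p x + b * q x) = (\<lambda>x. \<Sum>k\<in>K. (a * c k + b * d k) * monomial k x)"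
        by (simp add: sum_distrib_left sum.distrib algebra_simps)
      then show "(\<lambda>x. a * p x + b * q x) \<in> ?span K"
        by (intro CollectI exI[of _ "\<lambda>k. a * c k + b * d k"] conjI TrueI)
    qed
    moreover have "{(\<lambda>x. p x + c * monomial k x) | p c. p \<in> ?span K} = ?span (insert k K)"
    proof (intro subset_antisym subsetI)
      fix w assume "w \<in> {(\<lambda>x. p x + c * monomial k x) | p c. p \<in> ?span K}"
      then obtain c b where w: "w = (\<lambda>x. (\<Sum>k\<in>K. c k * monomial k x) + b * monomial k x)" by blast
      have "w = (\<lambda>x. \<Sum>l\<in>insert k K. (c(k := b)) l * monomial l x)"
      proof
        fix x
        have "(\<Sum>l\<in>K. (c(k := b)) l * monomial l x) = (\<Sum>l\<in>K. c l * monomial l x)"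
          using insert.hyps by (intro sum.cong) auto
        then show "w x = (\<Sum>l\<in>insert k K. (c(k := b)) l * monomial l x)"
          using insert.hyps by (simp add: w)
      qed
      then show "w \<in> ?span (insert k K)" by (intro CollectI exI[of _ "c(k := b)"] conjI TrueI)
    next
      fix w assume "w \<in> ?span (insert k K)"
      then obtain c where w: "w = (\<lambda>x. \<Sum>l\<in>insert k K. c l * monomial l x)" by blast
      have "w = (\<lambda>x. (\<Sum>l\<in>K. c l * monomial l x) + c k * monomial k x)"
        using insert.hyps by (simp add: w add.commute)
      then show "w \<in> {(\<lambda>x. p x + c * monomial k x) | p c. p \<in> ?span K}"
        by (intro CollectI exI[of _ "\<lambda>x. \<Sum>l\<in>K. c l * monomial l x"] exI[of _ "c k"] exI[of _ c] conjI TrueI refl)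
    qed
    ultimately show ?case by simp
  qed
  have "?span {k. total_degree k \<le> N} = poly_le N"
    by (auto simp: poly_le_iff_monomial_sum)
  with proj[OF order_refl] show ?thesis by simp
qed

lemma poly_proj:
  fixes \<gamma> :: "real^'n" and u :: "real^'n \<Rightarrow> real"
  assumes \<alpha>: "\<alpha> > -1" and \<gamma>: "\<And>i. \<gamma> $ i > -1" and u: "u \<in> L2_ball \<alpha> \<gamma>"
  shows poly_proj_unique: "\<And>p. p \<in> poly_le N \<Longrightarrow> (\<And>q. q \<in> poly_le N \<Longrightarrow> L2_inner \<alpha> \<gamma> (\<lambda>x. u x - p x) q = 0)
      \<Longrightarrow> poly_proj \<alpha> \<gamma> N u = p"
    and poly_proj_in: "poly_proj \<alpha> \<gamma> N u \<in> poly_le N"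
    and poly_proj_orth: "\<And>q. q \<in> poly_le N \<Longrightarrow> L2_inner \<alpha> \<gamma> (\<lambda>x. u x - poly_proj \<alpha> \<gamma> N u x) q = 0"
proof -
  let ?P = "\<lambda>p. p \<in> poly_le N \<and> (\<forall>q\<in>poly_le N. L2_inner \<alpha> \<gamma> (\<lambda>x. u x - p x) q = 0)"
  have polyL: "p \<in> L2_ball \<alpha> \<gamma>" if "p \<in> poly_le N" for p
    by (rule C1_ball_L2(1)[OF \<alpha> \<gamma> poly_le_C1_ball[OF that]])
  have uniq: "p' = p" if p: "?P p" and p': "?P p'" for p p'
  proof -
    let ?d = "\<lambda>x. p x - p' x"
    have d: "?d \<in> poly_le N" using p p' by (intro poly_le_diff) auto
    have "L2_inner \<alpha> \<gamma> (\<lambda>x. (u x - p' x) - (u x - p x)) ?d = 0"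
      using p p' d by (subst L2_inner_diff) (auto intro: L2_ball_diff u polyL)
    then have "L2_norm \<alpha> \<gamma> ?d = 0" by (simp add: L2_norm_def)
    from poly_le_definite[OF \<alpha> \<gamma> d this] show ?thesis by (simp add: fun_eq_iff)
  qed
  have "\<exists>p\<in>poly_le N. \<forall>q\<in>poly_le N. L2_inner \<alpha> \<gamma> (\<lambda>x. u x - p x) q = 0"
    using projectable_poly_le[OF \<alpha> \<gamma>, of N] u unfolding projectable_def by simp
  then have ex: "\<exists>p. ?P p" by (simp only: Bex_def)
  have ex1: "\<exists>!p. ?P p" by (rule ex_ex1I[OF ex]) (rule uniq; assumption)
  have P: "?P (poly_proj \<alpha> \<gamma> N u)" unfolding poly_proj_def by (rule theI'[OF ex1])
  then show "poly_proj \<alpha> \<gamma> N u \<in> poly_le N" by (rule conjunct1)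
  show "L2_inner \<alpha> \<gamma> (\<lambda>x. u x - poly_proj \<alpha> \<gamma> N u x) q = 0" if "q \<in> poly_le N" for q
    using P that by simp
  show "poly_proj \<alpha> \<gamma> N u = p" if "p \<in> poly_le N" "\<And>q. q \<in> poly_le N \<Longrightarrow> L2_inner \<alpha> \<gamma> (\<lambda>x. u x - p x) q = 0" for p
  proof (rule uniq)
    show "?P p" using that by simp
  qed (rule P)
qed

lemma poly_le_C1_norm_bound:
  fixes \<gamma> :: "real^'n"
  assumes \<alpha>: "\<alpha> > -1" and \<gamma>: "\<And>i. \<gamma> $ i > -1"
  obtains C where "C \<ge> 0" "\<And>p. p \<in> poly_le N \<Longrightarrow> C1_norm \<alpha> \<gamma> p \<le> C * L2_norm \<alpha> \<gamma> p"
  using conjunct2[OF projectable_poly_le[OF \<alpha> \<gamma>, of N, unfolded projectable_def]] by (elim exE conjE) simp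

section \<open>The upper bound for continuously differentiable functions\<close>

text \<open>
  Expand \<open>r\<^sup>2\<close> into products of monomials \<open>c\<^sub>k c\<^sub>l x\<^sup>k x\<^sup>l\<close> and add up \<open>monomial_moment\<close>, which contributes the
  factor \<open>\<bar>k\<bar> + \<bar>l\<bar>\<close>.  Summing over \<open>l\<close> first leaves \<open>\<bar>k\<bar>\<close> times the inner product of \<open>r\<close> with \<open>x\<^sup>k\<close>, which is 0
  unless \<open>\<bar>k\<bar> = m\<close>; so \<open>\<bar>k\<bar>\<close>, and likewise \<open>\<bar>l\<bar>\<close>, may be replaced by \<open>m\<close>.
\<close>

lemma orthogonal_poly_norms:
  fixes \<gamma> :: "real^'n" and r :: "real^'n \<Rightarrow> real"
  assumes \<alpha>: "\<alpha> > -1" and \<gamma>: "\<And>i. \<gamma> $ i > -1" and r: "r \<in> poly_le m"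
    and orth: "\<And>k q. k < m \<Longrightarrow> q \<in> poly_le k \<Longrightarrow> L2_inner (\<alpha> + 1) \<gamma> r q = 0"
  shows "(\<alpha> + 1) * (L2_norm \<alpha> \<gamma> r)\<^sup>2 = (real m + half_homogeneity \<gamma> + \<alpha> + 1) * (L2_norm (\<alpha> + 1) \<gamma> r)\<^sup>2"
proof -
  let ?\<mu> = "ball_measure \<alpha> \<gamma>"
  let ?K = "{k :: 'n \<Rightarrow> nat. total_degree k \<le> m}"
  obtain c where c: "r = (\<lambda>x. \<Sum>k\<in>?K. c k * monomial k x)" using r poly_le_iff_monomial_sum by blast
  have int: "integrable ?\<mu> u" if "continuous_on (cball 0 1) u" for u :: "real^'n \<Rightarrow> real"
    by (rule integrable_continuous[OF \<alpha> \<gamma> that])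
  have cr: "continuous_on (cball 0 1) r" by (rule continuous_on_poly_le[OF r])
  have polyL: "p \<in> L2_ball \<alpha> \<gamma>" if "p \<in> poly_le N" for p N
    by (rule C1_ball_L2(1)[OF \<alpha> \<gamma> poly_le_C1_ball[OF that]])
  define M where "M = (\<lambda>k l. \<integral>x. monomial k x * monomial l x * (1 - (norm x)\<^sup>2) \<partial>?\<mu>)"
  define H where "H = (\<lambda>k l. \<integral>x. monomial k x * monomial l x * (norm x)\<^sup>2 \<partial>?\<mu>)"
  have Msym: "M k l = M l k" for k l by (simp add: M_def mult.commute)
  have MH: "(real (total_degree k) + real (total_degree l) + 2 * half_homogeneity \<gamma>) * M k l = 2 * (\<alpha> + 1) * H k l" for k l
    using monomial_moment[OF \<alpha> \<gamma>, of "\<lambda>i. k i + l i"] by (simp add: M_def H_def monomial_mult sum.distrib)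
  have Mr: "(\<Sum>l\<in>?K. c l * M k l) = L2_inner (\<alpha> + 1) \<gamma> r (monomial k)" for k
  proof -
    have "L2_inner (\<alpha> + 1) \<gamma> r (monomial k) = (\<integral>x. r x * monomial k x * (1 - (norm x)\<^sup>2) \<partial>?\<mu>)"
      by (rule L2_ball_plus_one(2)[OF polyL[OF r] polyL[OF monomial_in_poly_le[OF order_refl]]])
    also have "\<dots> = (\<integral>x. (\<Sum>l\<in>?K. c l * (monomial k x * monomial l x * (1 - (norm x)\<^sup>2))) \<partial>?\<mu>)"
      unfolding c by (intro Bochner_Integration.integral_cong refl) (simp add: sum_distrib_left sum_distrib_right mult_ac)
    also have "\<dots> = (\<Sum>l\<in>?K. c l * M k l)"
      unfolding M_def by (subst Bochner_Integration.integral_sum) (auto intro!: integrable_mult_right int continuous_intros)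
    finally show ?thesis by simp
  qed
  have rr: "(\<Sum>k\<in>?K. c k * L2_inner (\<alpha> + 1) \<gamma> r (monomial k)) = (L2_norm (\<alpha> + 1) \<gamma> r)\<^sup>2"
  proof -
    have "(L2_norm (\<alpha> + 1) \<gamma> r)\<^sup>2 = (\<integral>x. r x * r x * (1 - (norm x)\<^sup>2) \<partial>?\<mu>)"
      unfolding L2_norm_square by (rule L2_ball_plus_one(2)[OF polyL[OF r] polyL[OF r]])
    also have "\<dots> = (\<integral>x. (\<Sum>k\<in>?K. c k * (r x * monomial k x * (1 - (norm x)\<^sup>2))) \<partial>?\<mu>)"
      by (intro Bochner_Integration.integral_cong refl, subst (2) c) (simp add: sum_distrib_left sum_distrib_right mult_ac)
    also have "\<dots> = (\<Sum>k\<in>?K. c k * (\<integral>x. r x * monomial k x * (1 - (norm x)\<^sup>2) \<partial>?\<mu>))"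
      by (subst Bochner_Integration.integral_sum) (auto intro!: integrable_mult_right int continuous_intros cr)
    also have "\<dots> = (\<Sum>k\<in>?K. c k * L2_inner (\<alpha> + 1) \<gamma> r (monomial k))"
      by (simp only: L2_ball_plus_one(2)[OF polyL[OF r] polyL[OF monomial_in_poly_le[OF order_refl]]])
    finally show ?thesis by simp
  qed
  have "(\<Sum>k\<in>?K. \<Sum>l\<in>?K. c k * c l * H k l) = (\<integral>x. r x * r x * (norm x)\<^sup>2 \<partial>?\<mu>)"
  proof -
    have "(\<integral>x. r x * r x * (norm x)\<^sup>2 \<partial>?\<mu>) = (\<integral>x. (\<Sum>k\<in>?K. \<Sum>l\<in>?K. c k * c l * (monomial k x * monomial l x * (norm x)\<^sup>2)) \<partial>?\<mu>)"
      unfolding c by (intro Bochner_Integration.integral_cong refl) (simp add: sum_product sum_distrib_left sum_distrib_right mult_ac)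
    also have "\<dots> = (\<Sum>k\<in>?K. \<Sum>l\<in>?K. c k * c l * H k l)"
      unfolding H_def
      by (subst Bochner_Integration.integral_sum, (intro int continuous_intros)[1],
          intro sum.cong refl, subst Bochner_Integration.integral_sum) (auto intro!: integrable_mult_right int continuous_intros)
    finally show ?thesis by simp
  qed
  also have "\<dots> = (L2_norm \<alpha> \<gamma> r)\<^sup>2 - (L2_norm (\<alpha> + 1) \<gamma> r)\<^sup>2"
  proof -
    have "(L2_norm \<alpha> \<gamma> r)\<^sup>2 - (L2_norm (\<alpha> + 1) \<gamma> r)\<^sup>2 = (\<integral>x. r x * r x \<partial>?\<mu>) - (\<integral>x. r x * r x * (1 - (norm x)\<^sup>2) \<partial>?\<mu>)"
      unfolding L2_norm_square L2_ball_plus_one(2)[OF polyL[OF r] polyL[OF r]]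
      by (simp add: L2_inner_eq L2_ball_measurable[OF polyL[OF r]])
    also have "\<dots> = (\<integral>x. r x * r x - r x * r x * (1 - (norm x)\<^sup>2) \<partial>?\<mu>)"
      by (rule Bochner_Integration.integral_diff[symmetric]) (intro int continuous_intros cr)+
    finally show ?thesis by (simp add: algebra_simps)
  qed
  finally have Hsum: "(\<Sum>k\<in>?K. \<Sum>l\<in>?K. c k * c l * H k l) = (L2_norm \<alpha> \<gamma> r)\<^sup>2 - (L2_norm (\<alpha> + 1) \<gamma> r)\<^sup>2" .
  let ?R = "(L2_norm (\<alpha> + 1) \<gamma> r)\<^sup>2"
  let ?d = "\<lambda>k. real (total_degree k)"
  have deg: "(\<Sum>k\<in>?K. c k * ?d k * L2_inner (\<alpha> + 1) \<gamma> r (monomial k)) = real m * ?R"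
  proof -
    have "c k * ?d k * L2_inner (\<alpha> + 1) \<gamma> r (monomial k) = real m * (c k * L2_inner (\<alpha> + 1) \<gamma> r (monomial k))" if "k \<in> ?K" for k
      using that orth[of "total_degree k" "monomial k"] monomial_in_poly_le[of k "total_degree k"]
      by (cases "total_degree k = m") auto
    then show ?thesis unfolding rr[symmetric] sum_distrib_left by (intro sum.cong) auto
  qed
  have s1: "(\<Sum>k\<in>?K. \<Sum>l\<in>?K. c k * c l * (?d k * M k l)) = real m * ?R"
  proof -
    have "(\<Sum>k\<in>?K. \<Sum>l\<in>?K. c k * c l * (?d k * M k l)) = (\<Sum>k\<in>?K. c k * ?d k * (\<Sum>l\<in>?K. c l * M k l))"
      by (simp add: sum_distrib_left mult_ac)
    then show ?thesis by (simp only: Mr deg)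
  qed
  have s2: "(\<Sum>k\<in>?K. \<Sum>l\<in>?K. c k * c l * (?d l * M k l)) = real m * ?R"
    using s1 by (subst sum.swap) (simp add: Msym mult_ac)
  have s3: "(\<Sum>k\<in>?K. \<Sum>l\<in>?K. c k * c l * M k l) = ?R"
  proof -
    have "(\<Sum>k\<in>?K. \<Sum>l\<in>?K. c k * c l * M k l) = (\<Sum>k\<in>?K. c k * (\<Sum>l\<in>?K. c l * M k l))"
      by (simp add: sum_distrib_left mult_ac)
    then show ?thesis by (simp only: Mr rr)
  qed
  have "2 * (\<alpha> + 1) * (\<Sum>k\<in>?K. \<Sum>l\<in>?K. c k * c l * H k l) = (\<Sum>k\<in>?K. \<Sum>l\<in>?K. c k * c l * (2 * (\<alpha> + 1) * H k l))"
    by (simp add: sum_distrib_left mult_ac)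
  also have "\<dots> = (\<Sum>k\<in>?K. \<Sum>l\<in>?K. c k * c l * (?d k * M k l) + c k * c l * (?d l * M k l) + 2 * half_homogeneity \<gamma> * (c k * c l * M k l))"
    by (intro sum.cong refl) (simp only: MH[symmetric], simp add: algebra_simps)
  also have "\<dots> = real m * ?R + real m * ?R + 2 * half_homogeneity \<gamma> * ?R"
    by (simp only: sum.distrib s1 s2 sum_distrib_left[symmetric] s3)
  finally show ?thesis unfolding Hsum by (simp add: algebra_simps)
qed

text \<open>
  Let \<open>w\<close> be the projection of \<open>v\<close> for the parameter \<open>\<alpha>\<close>, and \<open>r = p - w\<close>.  For \<open>q\<close> of degree at most \<open>M - 2\<close>, the
  inner product of \<open>v - w\<close> with \<open>q\<close> for the parameter \<open>\<alpha> + 1\<close> is that with \<open>(1 - \<bar>x\<bar>\<^sup>2) q\<close> for \<open>\<alpha>\<close>, hence 0;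
  so \<open>r\<close> is orthogonal to such \<open>q\<close>.  Consequently \<open>r = r1 + r2\<close>, where \<open>r1\<close> and \<open>r2\<close> have degree at most \<open>M\<close> and \<open>M - 1\<close>
  and are orthogonal, for \<open>\<alpha> + 1\<close>, to all lower degrees: \<open>orthogonal_poly_norms\<close> bounds both.
\<close>

lemma next_weight_projection_bound:
  fixes \<gamma> :: "real^'n" and v p :: "real^'n \<Rightarrow> real"
  assumes \<alpha>: "\<alpha> > -1" and \<gamma>: "\<And>i. \<gamma> $ i > -1" and v: "v \<in> L2_ball \<alpha> \<gamma>" and p: "p \<in> poly_le M"
    and orth: "\<And>q. q \<in> poly_le M \<Longrightarrow> L2_inner (\<alpha> + 1) \<gamma> (\<lambda>x. v x - p x) q = 0"
  shows "L2_norm \<alpha> \<gamma> p \<le> (1 + 2 * sqrt ((real M + half_homogeneity \<gamma> + \<alpha> + 1) / (\<alpha> + 1))) * L2_norm \<alpha> \<gamma> v"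
proof -
  define c where "c = sqrt ((real M + half_homogeneity \<gamma> + \<alpha> + 1) / (\<alpha> + 1))"
  have \<alpha>1: "\<alpha> + 1 > -1" using \<alpha> by simp
  have h: "half_homogeneity \<gamma> > 0" by (rule half_homogeneity_pos[OF \<gamma>])
  have c0: "c \<ge> 0" using \<alpha> h by (simp add: c_def)
  have polyL: "p \<in> L2_ball \<beta> \<gamma>" if "p \<in> poly_le N" "\<beta> > -1" for p N \<beta>
    by (rule C1_ball_L2(1)[OF that(2) \<gamma> poly_le_C1_ball[OF that(1)]])
  note pL = polyL[OF p \<alpha>] and pL1 = polyL[OF p \<alpha>1]
  have band: "L2_norm \<alpha> \<gamma> s \<le> c * L2_norm (\<alpha> + 1) \<gamma> s"
    if s: "s \<in> poly_le m" "m \<le> M" and o: "\<And>k q. k < m \<Longrightarrow> q \<in> poly_le k \<Longrightarrow> L2_inner (\<alpha> + 1) \<gamma> s q = 0" for s m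
  proof (rule power2_le_imp_le)
    have "(\<alpha> + 1) * (L2_norm \<alpha> \<gamma> s)\<^sup>2 = (real m + half_homogeneity \<gamma> + \<alpha> + 1) * (L2_norm (\<alpha> + 1) \<gamma> s)\<^sup>2"
      by (rule orthogonal_poly_norms[OF \<alpha> \<gamma> s(1) o])
    also have "\<dots> \<le> (real M + half_homogeneity \<gamma> + \<alpha> + 1) * (L2_norm (\<alpha> + 1) \<gamma> s)\<^sup>2"
      using s(2) by (intro mult_right_mono) auto
    finally have "(L2_norm \<alpha> \<gamma> s)\<^sup>2 \<le> (real M + half_homogeneity \<gamma> + \<alpha> + 1) * (L2_norm (\<alpha> + 1) \<gamma> s)\<^sup>2 / (\<alpha> + 1)"
      using \<alpha> by (simp add: pos_le_divide_eq mult.commute)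
    then show "(L2_norm \<alpha> \<gamma> s)\<^sup>2 \<le> (c * L2_norm (\<alpha> + 1) \<gamma> s)\<^sup>2"
      using \<alpha> h by (simp add: c_def power_mult_distrib)
    show "0 \<le> c * L2_norm (\<alpha> + 1) \<gamma> s" using c0 by simp
  qed
  define w where "w = poly_proj \<alpha> \<gamma> M v"
  have w: "w \<in> poly_le M" unfolding w_def by (rule poly_proj_in[OF \<alpha> \<gamma> v])
  have wo: "L2_inner \<alpha> \<gamma> (\<lambda>x. v x - w x) q = 0" if "q \<in> poly_le M" for q
    unfolding w_def by (rule poly_proj_orth[OF \<alpha> \<gamma> v that])
  note wL = polyL[OF w \<alpha>]
  have vwL: "(\<lambda>x. v x - w x) \<in> L2_ball \<alpha> \<gamma>" by (rule L2_ball_diff[OF v wL])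
  have vpL: "(\<lambda>x. v x - p x) \<in> L2_ball \<alpha> \<gamma>" by (rule L2_ball_diff[OF v pL])
  define r where "r = (\<lambda>x. p x - w x)"
  have r: "r \<in> poly_le M" unfolding r_def by (rule poly_le_diff[OF p w])
  note rL = polyL[OF r \<alpha>] and rL1 = polyL[OF r \<alpha>1]
  have rdiff: "r = (\<lambda>x. (v x - w x) - (v x - p x))" by (simp add: r_def)
  have ro: "L2_inner (\<alpha> + 1) \<gamma> r q = 0" if k: "k + 2 \<le> M" and q: "q \<in> poly_le k" for k q
  proof -
    note qL = polyL[OF q \<alpha>]
    have qM: "q \<in> poly_le M" using poly_le_mono[OF _ q] k by simp
    have q2: "(\<lambda>x. (1 - (norm x)\<^sup>2) * q x) \<in> poly_le M"
      using poly_le_mono[OF k poly_le_one_minus_norm_square[OF q]] .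
    have "L2_inner (\<alpha> + 1) \<gamma> (\<lambda>x. v x - w x) q = (\<integral>x. (v x - w x) * ((1 - (norm x)\<^sup>2) * q x) \<partial>ball_measure \<alpha> \<gamma>)"
      unfolding L2_ball_plus_one(2)[OF vwL qL] by (simp add: mult_ac)
    also have "\<dots> = L2_inner \<alpha> \<gamma> (\<lambda>x. v x - w x) (\<lambda>x. (1 - (norm x)\<^sup>2) * q x)"
      by (rule L2_inner_eq[symmetric]) (intro L2_ball_measurable vwL polyL[OF q2 \<alpha>])+
    also have "\<dots> = 0" by (rule wo[OF q2])
    finally show ?thesis
      unfolding rdiff using orth[OF qM]
      by (subst L2_inner_diff[OF L2_ball_plus_one(1)[OF vwL] L2_ball_plus_one(1)[OF vpL] polyL[OF q \<alpha>1]]) simp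
  qed
  have rn: "L2_norm (\<alpha> + 1) \<gamma> r \<le> L2_norm \<alpha> \<gamma> v"
  proof -
    have "L2_norm (\<alpha> + 1) \<gamma> r \<le> L2_norm (\<alpha> + 1) \<gamma> (\<lambda>x. v x - w x)"
      by (rule L2_norm_projection_le(1)[OF L2_ball_plus_one(1)[OF vwL] rL1]) (use orth[OF r] in \<open>simp add: r_def\<close>)
    also have "\<dots> \<le> L2_norm \<alpha> \<gamma> (\<lambda>x. v x - w x)" by (rule L2_ball_plus_one(3)[OF vwL])
    also have "\<dots> \<le> L2_norm \<alpha> \<gamma> v" by (rule L2_norm_projection_le(2)[OF v wL wo[OF w]])
    finally show ?thesis .
  qed
  have wn: "L2_norm \<alpha> \<gamma> w \<le> L2_norm \<alpha> \<gamma> v" by (rule L2_norm_projection_le(1)[OF v wL wo[OF w]])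
  have "L2_norm \<alpha> \<gamma> r \<le> 2 * c * L2_norm \<alpha> \<gamma> v"
  proof (cases "M = 0")
    case True
    have "L2_norm \<alpha> \<gamma> r \<le> c * L2_norm (\<alpha> + 1) \<gamma> r"
      by (rule band[OF r order_refl]) (simp add: True)
    also have "\<dots> \<le> c * L2_norm \<alpha> \<gamma> v" by (rule mult_left_mono[OF rn c0])
    also have "\<dots> \<le> 2 * c * L2_norm \<alpha> \<gamma> v" using c0 by (simp add: mult_right_mono)
    finally show ?thesis .
  next
    case False
    define r2 where "r2 = poly_proj (\<alpha> + 1) \<gamma> (M - 1) r"
    define r1 where "r1 = (\<lambda>x. r x - r2 x)"
    have r2: "r2 \<in> poly_le (M - 1)" unfolding r2_def by (rule poly_proj_in[OF \<alpha>1 \<gamma> rL1])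
    have r1o: "L2_inner (\<alpha> + 1) \<gamma> r1 q = 0" if "q \<in> poly_le (M - 1)" for q
      unfolding r1_def r2_def by (rule poly_proj_orth[OF \<alpha>1 \<gamma> rL1 that])
    note r2L1 = polyL[OF r2 \<alpha>1]
    have r1: "r1 \<in> poly_le M" unfolding r1_def by (rule poly_le_diff[OF r poly_le_mono[OF _ r2]]) simp
    have r2diff: "r2 = (\<lambda>x. r x - r1 x)" by (simp add: r1_def)
    have n1: "L2_norm \<alpha> \<gamma> r1 \<le> c * L2_norm (\<alpha> + 1) \<gamma> r1"
    proof (rule band[OF r1 order_refl])
      fix k and q :: "real^'n \<Rightarrow> real" assume "k < M" "q \<in> poly_le k"
      then show "L2_inner (\<alpha> + 1) \<gamma> r1 q = 0" using poly_le_mono[of k "M - 1" q] by (intro r1o) simp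
    qed
    have n2: "L2_norm \<alpha> \<gamma> r2 \<le> c * L2_norm (\<alpha> + 1) \<gamma> r2"
    proof (rule band[OF r2])
      fix k and q :: "real^'n \<Rightarrow> real" assume k: "k < M - 1" and q: "q \<in> poly_le k"
      have "L2_inner (\<alpha> + 1) \<gamma> r1 q = 0" using poly_le_mono[of k "M - 1" q] k q by (intro r1o) simp
      moreover have "L2_inner (\<alpha> + 1) \<gamma> r q = 0" using k by (intro ro[OF _ q]) simp
      ultimately show "L2_inner (\<alpha> + 1) \<gamma> r2 q = 0"
        unfolding r2diff by (subst L2_inner_diff[OF rL1 polyL[OF r1 \<alpha>1] polyL[OF q \<alpha>1]]) simp
    qed simp
    have o12: "L2_inner (\<alpha> + 1) \<gamma> (\<lambda>x. r x - r2 x) r2 = 0" using r1o[OF r2] by (simp add: r1_def)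
    have m1: "L2_norm (\<alpha> + 1) \<gamma> r1 \<le> L2_norm \<alpha> \<gamma> v"
      using L2_norm_projection_le(2)[OF rL1 r2L1 o12] rn unfolding r1_def by linarith
    have m2: "L2_norm (\<alpha> + 1) \<gamma> r2 \<le> L2_norm \<alpha> \<gamma> v"
      using L2_norm_projection_le(1)[OF rL1 r2L1 o12] rn by linarith
    have "r = (\<lambda>x. r1 x + r2 x)" by (simp add: r1_def)
    then have "L2_norm \<alpha> \<gamma> r \<le> L2_norm \<alpha> \<gamma> r1 + L2_norm \<alpha> \<gamma> r2"
      using L2_norm_add[OF polyL[OF r1 \<alpha>] polyL[OF r2 \<alpha>]] by simp
    then show ?thesis using n1 n2 mult_left_mono[OF m1 c0] mult_left_mono[OF m2 c0] by linarith
  qed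
  moreover have "L2_norm \<alpha> \<gamma> p \<le> L2_norm \<alpha> \<gamma> w + L2_norm \<alpha> \<gamma> r"
    using L2_norm_add[OF wL rL] by (simp add: r_def)
  ultimately have "L2_norm \<alpha> \<gamma> p \<le> L2_norm \<alpha> \<gamma> v + 2 * c * L2_norm \<alpha> \<gamma> v" using wn by linarith
  then show ?thesis by (simp add: c_def algebra_simps)
qed

text \<open>
  Integration by parts moves the Dunkl operator to \<open>q\<close>, where its adjoint produces a polynomial of degree at
  most \<open>N\<close>; the projection error of \<open>u\<close> is orthogonal to it.
\<close>

lemma dunkl_poly_proj:
  fixes \<gamma> :: "real^'n" and u :: "real^'n \<Rightarrow> real"
  assumes \<alpha>: "\<alpha> > -1" and \<gamma>: "\<And>i. \<gamma> $ i > -1" and u: "u \<in> C1_ball" and N: "N \<ge> 1" and q: "q \<in> poly_le (N - 1)"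
  shows "L2_inner (\<alpha> + 1) \<gamma> (\<lambda>x. dunkl \<gamma> j u x - dunkl \<gamma> j (poly_proj \<alpha> \<gamma> N u) x) q = 0"
proof -
  let ?\<mu> = "ball_measure \<alpha> \<gamma>"
  note uL = C1_ball_L2(1)[OF \<alpha> \<gamma> u]
  define p where "p = poly_proj \<alpha> \<gamma> N u"
  have p: "p \<in> poly_le N" unfolding p_def by (rule poly_proj_in[OF \<alpha> \<gamma> uL])
  note pC = poly_le_C1_ball[OF p] and qC = poly_le_C1_ball[OF q]
  define w where "w = (\<lambda>x. u x - p x)"
  have w: "w \<in> C1_ball" unfolding w_def by (rule C1_ball_diff[OF u pC])
  note wL = C1_ball_L2[OF \<alpha> \<gamma> w] and qL = C1_ball_L2(1)[OF \<alpha> \<gamma> qC]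
  let ?a = "\<lambda>x. dunkl \<gamma> j q x * (1 - (norm x)\<^sup>2) - (2 * (\<alpha> + 1)) * x $ j * q x"
  have a: "?a \<in> poly_le N" using dunkl_adjoint_poly_le[OF q, of \<gamma> j "2 * (\<alpha> + 1)"] N by simp
  note aL = C1_ball_L2(1)[OF \<alpha> \<gamma> poly_le_C1_ball[OF a]]
  have q1: "(\<lambda>x. (1 - (norm x)\<^sup>2) * q x) \<in> L2_ball \<alpha> \<gamma>"
    by (rule C1_ball_L2(1)[OF \<alpha> \<gamma> poly_le_C1_ball[OF poly_le_one_minus_norm_square[OF q]]])
  have "L2_inner (\<alpha> + 1) \<gamma> (dunkl \<gamma> j w) q = (\<integral>x. dunkl \<gamma> j w x * q x * (1 - (norm x)\<^sup>2) \<partial>?\<mu>)"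
    by (rule L2_ball_plus_one(2)[OF wL(2) qL])
  moreover have "(\<integral>x. w x * ?a x \<partial>?\<mu>) = 0"
  proof -
    have "L2_inner \<alpha> \<gamma> w ?a = 0" unfolding w_def p_def by (rule poly_proj_orth[OF \<alpha> \<gamma> uL a])
    then show ?thesis by (simp only: L2_inner_eq[OF L2_ball_measurable[OF wL(1)] L2_ball_measurable[OF aL]])
  qed
  moreover have "(\<integral>x. dunkl \<gamma> j w x * q x * (1 - (norm x)\<^sup>2) \<partial>?\<mu>) + (\<integral>x. w x * ?a x \<partial>?\<mu>) = 0"
  proof -
    have "integrable ?\<mu> (\<lambda>x. dunkl \<gamma> j w x * q x * (1 - (norm x)\<^sup>2))"
      using L2_integrable_mult[OF wL(2) q1] by (simp add: mult_ac)
    from Bochner_Integration.integral_add[OF this L2_integrable_mult[OF wL(1) aL]]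
    show ?thesis using dunkl_by_parts[OF \<alpha> \<gamma> w qC, of j] by simp
  qed
  ultimately have "L2_inner (\<alpha> + 1) \<gamma> (dunkl \<gamma> j w) q = 0" by simp
  moreover have "L2_inner (\<alpha> + 1) \<gamma> (dunkl \<gamma> j w) q = L2_inner (\<alpha> + 1) \<gamma> (\<lambda>x. dunkl \<gamma> j u x - dunkl \<gamma> j p x) q"
    by (rule L2_inner_cong) (simp_all add: w_def dunkl_C1_diff[OF u pC] del: mem_ball)
  ultimately show ?thesis by (simp add: p_def)
qed

theorem C1_projection_bound:
  fixes \<gamma> :: "real^'n"
  assumes \<alpha>: "\<alpha> > -1" and \<gamma>: "\<And>i. \<gamma> $ i > -1"
  obtains C where "C > 0" "\<And>u N. u \<in> C1_ball \<Longrightarrow> N \<ge> 1 \<Longrightarrow>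
    C1_norm \<alpha> \<gamma> (\<lambda>x. u x - poly_proj \<alpha> \<gamma> N u x) \<le> C * sqrt (real N) * C1_norm \<alpha> \<gamma> u"
proof -
  have h: "half_homogeneity \<gamma> > 0" by (rule half_homogeneity_pos[OF \<gamma>])
  define C where "C = 2 + 2 * sqrt ((1 + half_homogeneity \<gamma> + \<alpha> + 1) / (\<alpha> + 1))"
  have "C > 0" using \<alpha> h by (auto simp: C_def intro!: add_pos_nonneg)
  moreover have "C1_norm \<alpha> \<gamma> (\<lambda>x. u x - poly_proj \<alpha> \<gamma> N u x) \<le> C * sqrt (real N) * C1_norm \<alpha> \<gamma> u"
    if u: "u \<in> C1_ball" and N: "N \<ge> 1" for u :: "real^'n \<Rightarrow> real" and N
  proof -
    note uL = C1_ball_L2[OF \<alpha> \<gamma> u]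
    define p where "p = poly_proj \<alpha> \<gamma> N u"
    have p: "p \<in> poly_le N" unfolding p_def by (rule poly_proj_in[OF \<alpha> \<gamma> uL(1)])
    note pC = poly_le_C1_ball[OF p]
    note pL = C1_ball_L2[OF \<alpha> \<gamma> pC]
    define c where "c = sqrt ((real (N - 1) + half_homogeneity \<gamma> + \<alpha> + 1) / (\<alpha> + 1))"
    define K where "K = 2 + 2 * c"
    have c0: "c \<ge> 0" using \<alpha> h by (simp add: c_def)
    have K0: "K \<ge> 1" using c0 by (simp add: K_def)
    have KC: "K \<le> C * sqrt (real N)"
    proof -
      have N1: "real N \<ge> 1" using N by simp
      have "real (N - 1) + half_homogeneity \<gamma> + \<alpha> + 1 \<le> real N * (1 + half_homogeneity \<gamma> + \<alpha> + 1)"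
        using N1 h \<alpha> mult_right_mono[OF N1, of "half_homogeneity \<gamma> + \<alpha> + 1"] by (simp add: algebra_simps of_nat_diff N)
      then have "(real (N - 1) + half_homogeneity \<gamma> + \<alpha> + 1) / (\<alpha> + 1) \<le> real N * (1 + half_homogeneity \<gamma> + \<alpha> + 1) / (\<alpha> + 1)"
        using \<alpha> by (intro divide_right_mono) auto
      then have "c \<le> sqrt (real N * ((1 + half_homogeneity \<gamma> + \<alpha> + 1) / (\<alpha> + 1)))"
        unfolding c_def by (intro real_sqrt_le_mono) simp
      then have "c \<le> sqrt (real N) * sqrt ((1 + half_homogeneity \<gamma> + \<alpha> + 1) / (\<alpha> + 1))" by (simp only: real_sqrt_mult)
      moreover have "1 \<le> sqrt (real N)" using N1 by simp
      ultimately have "K \<le> 2 * sqrt (real N) + 2 * (sqrt (real N) * sqrt ((1 + half_homogeneity \<gamma> + \<alpha> + 1) / (\<alpha> + 1)))"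
        unfolding K_def by linarith
      also have "\<dots> = C * sqrt (real N)" unfolding C_def by (simp only: distrib_left distrib_right mult_ac)
      finally show ?thesis .
    qed
    let ?f = "\<lambda>u. case_option (L2_norm \<alpha> \<gamma> u) (\<lambda>j. L2_norm \<alpha> \<gamma> (dunkl \<gamma> j u))"
    have 1: "L2_norm \<alpha> \<gamma> (\<lambda>x. u x - p x) \<le> K * L2_norm \<alpha> \<gamma> u"
    proof -
      have "L2_norm \<alpha> \<gamma> (\<lambda>x. u x - p x) \<le> 1 * L2_norm \<alpha> \<gamma> u"
        using L2_norm_projection_le(2)[OF uL(1) pL(1)] poly_proj_orth[OF \<alpha> \<gamma> uL(1) p] by (simp add: p_def)
      also have "\<dots> \<le> K * L2_norm \<alpha> \<gamma> u" using K0 by (intro mult_right_mono) auto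
      finally show ?thesis .
    qed
    have 2: "L2_norm \<alpha> \<gamma> (dunkl \<gamma> j (\<lambda>x. u x - p x)) \<le> K * L2_norm \<alpha> \<gamma> (dunkl \<gamma> j u)" for j
    proof -
      have "L2_norm \<alpha> \<gamma> (dunkl \<gamma> j (\<lambda>x. u x - p x)) = L2_norm \<alpha> \<gamma> (\<lambda>x. dunkl \<gamma> j u x - dunkl \<gamma> j p x)"
        by (rule L2_norm_cong) (rule dunkl_C1_diff[OF u pC])
      also have "\<dots> \<le> L2_norm \<alpha> \<gamma> (dunkl \<gamma> j u) + L2_norm \<alpha> \<gamma> (dunkl \<gamma> j p)"
        by (rule L2_norm_diff[OF uL(2) pL(2)])
      also have "L2_norm \<alpha> \<gamma> (dunkl \<gamma> j p) \<le> (1 + 2 * c) * L2_norm \<alpha> \<gamma> (dunkl \<gamma> j u)"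
        unfolding c_def
      proof (rule next_weight_projection_bound[OF \<alpha> \<gamma> uL(2) dunkl_poly_le[OF p]])
        show "L2_inner (\<alpha> + 1) \<gamma> (\<lambda>x. dunkl \<gamma> j u x - dunkl \<gamma> j p x) q = 0" if "q \<in> poly_le (N - 1)" for q
          unfolding p_def by (rule dunkl_poly_proj[OF \<alpha> \<gamma> u N that])
      qed
      finally show ?thesis by (simp add: K_def algebra_simps)
    qed
    have "L2_set (?f (\<lambda>x. u x - p x)) UNIV \<le> L2_set (\<lambda>i. K * ?f u i) UNIV"
      by (intro L2_set_mono) (auto split: option.split intro: 1 2)
    also have "\<dots> = K * L2_set (?f u) UNIV" using K0 by (subst L2_set_right_distrib) auto
    also have "\<dots> \<le> C * sqrt (real N) * L2_set (?f u) UNIV" by (rule mult_right_mono[OF KC]) simp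
    finally show ?thesis by (simp add: C1_norm_L2_set p_def)
  qed
  ultimately show thesis using that by blast
qed

section \<open>Passage to the completion\<close>

context
  fixes \<alpha> :: real and \<gamma> :: "real^'n"
  assumes \<alpha>: "\<alpha> > -1" and \<gamma>: "\<And>i. \<gamma> $ i > -1"
begin

lemma C1_norm_diff_self: "u \<in> C1_ball \<Longrightarrow> C1_norm \<alpha> \<gamma> (\<lambda>x. u x - u x) = 0"
  using C1_norm_scale[OF \<alpha> \<gamma>, of u 0] by simp

lemma C1_CauchyD: "U \<in> C1_Cauchy \<alpha> \<gamma> \<Longrightarrow> U k \<in> C1_ball"
  by (simp add: C1_Cauchy_def)

lemma C1_Cauchy_const: "u \<in> C1_ball \<Longrightarrow> (\<lambda>k. u) \<in> C1_Cauchy \<alpha> \<gamma>"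
  unfolding C1_Cauchy_def by (auto simp only: mem_Collect_eq C1_norm_diff_self)

lemma C1_norm_diff_diff:
  assumes "u \<in> C1_ball" "v \<in> C1_ball" "u' \<in> C1_ball" "v' \<in> C1_ball"
  shows "C1_norm \<alpha> \<gamma> (\<lambda>x. (u x - v x) - (u' x - v' x)) \<le> C1_norm \<alpha> \<gamma> (\<lambda>x. u x - u' x) + C1_norm \<alpha> \<gamma> (\<lambda>x. v x - v' x)"
proof -
  have eq: "(\<lambda>x. (u x - v x) - (u' x - v' x)) = (\<lambda>x. (u x - u' x) + (v' x - v x))" by (simp add: algebra_simps)
  show ?thesis
    unfolding eq using C1_norm_add[OF \<alpha> \<gamma> C1_ball_diff[OF assms(1,3)] C1_ball_diff[OF assms(4,2)]]
      C1_norm_minus_commute[OF \<alpha> \<gamma> assms(4,2)] by simp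
qed

lemma C1_Cauchy_diff:
  assumes U: "U \<in> C1_Cauchy \<alpha> \<gamma>" and V: "V \<in> C1_Cauchy \<alpha> \<gamma>"
  shows "(\<lambda>k x. U k x - V k x) \<in> C1_Cauchy \<alpha> \<gamma>"
  unfolding C1_Cauchy_def
proof (intro CollectI conjI allI impI)
  show "(\<lambda>x. U k x - V k x) \<in> C1_ball" for k by (intro C1_ball_diff C1_CauchyD U V)
  fix e :: real assume "e > 0"
  then have e: "e / 2 > 0" by simp
  obtain M1 where M1: "\<And>m n. m \<ge> M1 \<Longrightarrow> n \<ge> M1 \<Longrightarrow> C1_norm \<alpha> \<gamma> (\<lambda>x. U m x - U n x) < e / 2"
    using U e unfolding C1_Cauchy_def by (elim CollectE conjE allE[of _ "e / 2"] impE) auto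
  obtain M2 where M2: "\<And>m n. m \<ge> M2 \<Longrightarrow> n \<ge> M2 \<Longrightarrow> C1_norm \<alpha> \<gamma> (\<lambda>x. V m x - V n x) < e / 2"
    using V e unfolding C1_Cauchy_def by (elim CollectE conjE allE[of _ "e / 2"] impE) auto
  show "\<exists>M. \<forall>m\<ge>M. \<forall>n\<ge>M. C1_norm \<alpha> \<gamma> (\<lambda>x. (U m x - V m x) - (U n x - V n x)) < e"
  proof (intro exI[of _ "max M1 M2"] allI impI)
    fix m n assume "max M1 M2 \<le> m" "max M1 M2 \<le> n"
    then have "m \<ge> M1" "n \<ge> M1" "m \<ge> M2" "n \<ge> M2" by simp_all
    from M1[OF this(1,2)] M2[OF this(3,4)]
    have "C1_norm \<alpha> \<gamma> (\<lambda>x. U m x - U n x) < e / 2" "C1_norm \<alpha> \<gamma> (\<lambda>x. V m x - V n x) < e / 2" .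
    then show "C1_norm \<alpha> \<gamma> (\<lambda>x. (U m x - V m x) - (U n x - V n x)) < e"
      using C1_norm_diff_diff[OF C1_CauchyD[OF U] C1_CauchyD[OF V] C1_CauchyD[OF U] C1_CauchyD[OF V], of m m n n] by linarith
  qed
qed

lemma H1_rel_refl: 
  assumes U: "U \<in> C1_Cauchy \<alpha> \<gamma>"
  shows "(U, U) \<in> H1_rel \<alpha> \<gamma>"
  using U C1_norm_diff_self[OF C1_CauchyD[OF U]] unfolding H1_rel_def by simp

lemma H1_relD:
  assumes "(U, V) \<in> H1_rel \<alpha> \<gamma>"
  shows "U \<in> C1_Cauchy \<alpha> \<gamma>" "V \<in> C1_Cauchy \<alpha> \<gamma>" "(\<lambda>k. C1_norm \<alpha> \<gamma> (\<lambda>x. U k x - V k x)) \<longlonglongrightarrow> 0"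
  using assms by (auto simp: H1_rel_def)

lemma C1_norm_limit:
  assumes U: "U \<in> C1_Cauchy \<alpha> \<gamma>"
  obtains l where "\<And>V. (U, V) \<in> H1_rel \<alpha> \<gamma> \<Longrightarrow> (\<lambda>k. C1_norm \<alpha> \<gamma> (V k)) \<longlonglongrightarrow> l"
proof -
  have "Cauchy (\<lambda>k. C1_norm \<alpha> \<gamma> (U k))"
  proof (rule metric_CauchyI)
    fix e :: real assume e: "e > 0"
    obtain M where M: "\<And>m n. m \<ge> M \<Longrightarrow> n \<ge> M \<Longrightarrow> C1_norm \<alpha> \<gamma> (\<lambda>x. U m x - U n x) < e"
      using U e unfolding C1_Cauchy_def by (elim CollectE conjE allE[of _ e] impE) auto
    have "dist (C1_norm \<alpha> \<gamma> (U m)) (C1_norm \<alpha> \<gamma> (U n)) < e" if "m \<ge> M" "n \<ge> M" for m n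
      using C1_norm_reverse_triangle[OF \<alpha> \<gamma> C1_CauchyD[OF U] C1_CauchyD[OF U], of m n] M[OF that]
      by (simp add: dist_real_def)
    then show "\<exists>M. \<forall>m\<ge>M. \<forall>n\<ge>M. dist (C1_norm \<alpha> \<gamma> (U m)) (C1_norm \<alpha> \<gamma> (U n)) < e" by blast
  qed
  then obtain l where l: "(\<lambda>k. C1_norm \<alpha> \<gamma> (U k)) \<longlonglongrightarrow> l" using Cauchy_convergent convergentD by blast
  have "(\<lambda>k. C1_norm \<alpha> \<gamma> (V k)) \<longlonglongrightarrow> l" if V: "(U, V) \<in> H1_rel \<alpha> \<gamma>" for V
  proof -
    note VD = H1_relD[OF V]
    have "(\<lambda>k. C1_norm \<alpha> \<gamma> (U k) - C1_norm \<alpha> \<gamma> (V k)) \<longlonglongrightarrow> 0"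
    proof (rule Lim_null_comparison[OF _ VD(3)], rule eventuallyI)
      show "norm (C1_norm \<alpha> \<gamma> (U k) - C1_norm \<alpha> \<gamma> (V k)) \<le> C1_norm \<alpha> \<gamma> (\<lambda>x. U k x - V k x)" for k
        using C1_norm_reverse_triangle[OF \<alpha> \<gamma> C1_CauchyD[OF U] C1_CauchyD[OF VD(2)]] by simp
    qed
    from tendsto_diff[OF l this] show ?thesis by simp
  qed
  then show thesis using that by blast
qed

lemma H1_norm_limit:
  assumes U: "U \<in> C1_Cauchy \<alpha> \<gamma>" "U \<in> X" and X: "\<And>V. V \<in> X \<Longrightarrow> (U, V) \<in> H1_rel \<alpha> \<gamma>"
  shows "(\<lambda>k. C1_norm \<alpha> \<gamma> (U k)) \<longlonglongrightarrow> H1_norm \<alpha> \<gamma> X"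
proof -
  obtain l where l: "\<And>V. (U, V) \<in> H1_rel \<alpha> \<gamma> \<Longrightarrow> (\<lambda>k. C1_norm \<alpha> \<gamma> (V k)) \<longlonglongrightarrow> l"
    using C1_norm_limit[OF U(1)] by metis
  have "H1_norm \<alpha> \<gamma> X = l"
    unfolding H1_norm_def
  proof (rule the_equality)
    show "\<forall>U\<in>X. (\<lambda>k. C1_norm \<alpha> \<gamma> (U k)) \<longlonglongrightarrow> l" using l X by blast
    show "l' = l" if "\<forall>U\<in>X. (\<lambda>k. C1_norm \<alpha> \<gamma> (U k)) \<longlonglongrightarrow> l'" for l'
      using LIMSEQ_unique[OF bspec[OF that U(2)] l[OF X[OF U(2)]]] .
  qed
  then show ?thesis using l[OF X[OF U(2)]] by simp
qed

lemma H1_class_norm_limit: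
  assumes U: "U \<in> C1_Cauchy \<alpha> \<gamma>"
  shows "(\<lambda>k. C1_norm \<alpha> \<gamma> (U k)) \<longlonglongrightarrow> H1_norm \<alpha> \<gamma> (H1_rel \<alpha> \<gamma> `` {U})"
  by (rule H1_norm_limit[OF U]) (use H1_rel_refl[OF U] in auto)

text \<open>
  \<open>H1_diff\<close> collects the classes of the differences of all representatives.  They all coincide, since replacing
  representatives changes the difference by a sequence of norm tending to 0.
\<close>

lemma H1_diff_norm_limit:
  assumes U: "U \<in> C1_Cauchy \<alpha> \<gamma>" and p: "p \<in> C1_ball"
  shows "(\<lambda>k. C1_norm \<alpha> \<gamma> (\<lambda>x. U k x - p x)) \<longlonglongrightarrow> H1_norm \<alpha> \<gamma> (H1_diff \<alpha> \<gamma> (H1_rel \<alpha> \<gamma> `` {U}) (H1_of_C1 \<alpha> \<gamma> p))"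
proof -
  let ?W = "\<lambda>k x. U k x - p x"
  note pc = C1_Cauchy_const[OF p]
  have W: "?W \<in> C1_Cauchy \<alpha> \<gamma>" using C1_Cauchy_diff[OF U pc] .
  show ?thesis
  proof (rule H1_norm_limit[OF W])
    show "?W \<in> H1_diff \<alpha> \<gamma> (H1_rel \<alpha> \<gamma> `` {U}) (H1_of_C1 \<alpha> \<gamma> p)"
      unfolding H1_diff_def H1_of_C1_def
      by (intro UN_I[of U] UN_I[of "\<lambda>k. p"] ImageI[OF _ singletonI] H1_rel_refl U pc W)
    fix Z assume "Z \<in> H1_diff \<alpha> \<gamma> (H1_rel \<alpha> \<gamma> `` {U}) (H1_of_C1 \<alpha> \<gamma> p)"
    then obtain U' V where UV: "(U, U') \<in> H1_rel \<alpha> \<gamma>" "(\<lambda>k. p, V) \<in> H1_rel \<alpha> \<gamma>" "(\<lambda>k x. U' k x - V k x, Z) \<in> H1_rel \<alpha> \<gamma>"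
      unfolding H1_diff_def H1_of_C1_def by auto
    note D1 = H1_relD[OF UV(1)] and D2 = H1_relD[OF UV(2)] and D3 = H1_relD[OF UV(3)]
    have bound: "C1_norm \<alpha> \<gamma> (\<lambda>x. ?W k x - Z k x) \<le> C1_norm \<alpha> \<gamma> (\<lambda>x. U k x - U' k x) + C1_norm \<alpha> \<gamma> (\<lambda>x. p x - V k x)
        + C1_norm \<alpha> \<gamma> (\<lambda>x. (U' k x - V k x) - Z k x)" for k
    proof -
      have "C1_norm \<alpha> \<gamma> (\<lambda>x. ?W k x - Z k x) \<le> C1_norm \<alpha> \<gamma> (\<lambda>x. ?W k x - (U' k x - V k x)) + C1_norm \<alpha> \<gamma> (\<lambda>x. (U' k x - V k x) - Z k x)"
        by (rule C1_norm_triangle[OF \<alpha> \<gamma> C1_CauchyD[OF W] C1_CauchyD[OF D3(1)] C1_CauchyD[OF D3(2)]])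
      moreover have "C1_norm \<alpha> \<gamma> (\<lambda>x. ?W k x - (U' k x - V k x)) \<le> C1_norm \<alpha> \<gamma> (\<lambda>x. U k x - U' k x) + C1_norm \<alpha> \<gamma> (\<lambda>x. p x - V k x)"
        by (rule C1_norm_diff_diff[OF C1_CauchyD[OF U] p C1_CauchyD[OF D1(2)] C1_CauchyD[OF D2(2)]])
      ultimately show ?thesis by linarith
    qed
    have "(\<lambda>k. C1_norm \<alpha> \<gamma> (\<lambda>x. U k x - U' k x) + C1_norm \<alpha> \<gamma> (\<lambda>x. p x - V k x)
        + C1_norm \<alpha> \<gamma> (\<lambda>x. (U' k x - V k x) - Z k x)) \<longlonglongrightarrow> 0"
      using tendsto_add[OF tendsto_add[OF D1(3) D2(3)] D3(3)] by simp
    then have "(\<lambda>k. C1_norm \<alpha> \<gamma> (\<lambda>x. ?W k x - Z k x)) \<longlonglongrightarrow> 0"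
      by (rule Lim_null_comparison[rotated]) (use bound in \<open>auto intro!: eventuallyI\<close>)
    then show "(?W, Z) \<in> H1_rel \<alpha> \<gamma>" using W D3(2) by (simp add: H1_rel_def)
  qed
qed

lemma H1_to_L2:
  assumes U: "U \<in> C1_Cauchy \<alpha> \<gamma>"
  defines "v \<equiv> H1_to_L2 \<alpha> \<gamma> (H1_rel \<alpha> \<gamma> `` {U})"
  shows "v \<in> L2_ball \<alpha> \<gamma>" "(\<lambda>k. L2_norm \<alpha> \<gamma> (\<lambda>x. U k x - v x)) \<longlonglongrightarrow> 0"
proof -
  let ?\<mu> = "ball_measure \<alpha> \<gamma>" and ?X = "H1_rel \<alpha> \<gamma> `` {U}"
  have UL: "U k \<in> L2_ball \<alpha> \<gamma>" for k by (rule C1_ball_L2(1)[OF \<alpha> \<gamma> C1_CauchyD[OF U]])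
  have sq: "(\<integral>x. (f x - g x)\<^sup>2 \<partial>?\<mu>) = (L2_norm \<alpha> \<gamma> (\<lambda>x. f x - g x))\<^sup>2"
    if "f \<in> L2_ball \<alpha> \<gamma>" "g \<in> L2_ball \<alpha> \<gamma>" for f g
    unfolding L2_norm_square using L2_ball_measurable[OF L2_ball_diff[OF that]]
    by (simp add: L2_inner_eq power2_eq_square)
  obtain v0 where v0: "v0 \<in> borel_measurable ?\<mu>" "integrable ?\<mu> (\<lambda>x. (v0 x)\<^sup>2)" "(\<lambda>k. \<integral>x. (U k x - v0 x)\<^sup>2 \<partial>?\<mu>) \<longlonglongrightarrow> 0"
  proof (rule L2_complete[of ?\<mu> U])
    show "finite_measure ?\<mu>" by (rule finite_measure_ball_measure[OF \<alpha> \<gamma>])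
    show "U k \<in> borel_measurable ?\<mu>" for k by (rule L2_ball_measurable[OF UL])
    show "integrable ?\<mu> (\<lambda>x. (U m x - U n x)\<^sup>2)" for m n using L2_ball_diff[OF UL UL] by (simp add: L2_ball_iff)
    show "integrable ?\<mu> (\<lambda>x. (U n x)\<^sup>2)" for n using UL by (simp add: L2_ball_iff)
    fix e :: real assume e: "e > 0"
    then have "sqrt e > 0" by simp
    then obtain M where M: "\<And>m n. m \<ge> M \<Longrightarrow> n \<ge> M \<Longrightarrow> C1_norm \<alpha> \<gamma> (\<lambda>x. U m x - U n x) < sqrt e"
      using U unfolding C1_Cauchy_def by (elim CollectE conjE allE[of _ "sqrt e"] impE) auto
    have "(\<integral>x. (U m x - U n x)\<^sup>2 \<partial>?\<mu>) < e" if "m \<ge> M" "n \<ge> M" for m n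
    proof -
      have "L2_norm \<alpha> \<gamma> (\<lambda>x. U m x - U n x) < sqrt e" using L2_norm_le_C1_norm M[OF that] by (rule le_less_trans)
      then have "(L2_norm \<alpha> \<gamma> (\<lambda>x. U m x - U n x))\<^sup>2 < (sqrt e)\<^sup>2" by (intro power_strict_mono) auto
      then show ?thesis using e by (simp add: sq UL)
    qed
    then show "\<exists>K. \<forall>m\<ge>K. \<forall>n\<ge>K. (\<integral>x. (U m x - U n x)\<^sup>2 \<partial>?\<mu>) < e" by blast
  qed
  have v0L: "v0 \<in> L2_ball \<alpha> \<gamma>" using v0 by (simp add: L2_ball_iff)
  have lim0: "(\<lambda>k. L2_norm \<alpha> \<gamma> (\<lambda>x. U k x - v0 x)) \<longlonglongrightarrow> 0"
    using tendsto_real_sqrt[OF v0(3)] by (simp add: sq UL v0L)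
  let ?Q = "\<lambda>v. v \<in> L2_ball \<alpha> \<gamma> \<and> (\<forall>V\<in>?X. (\<lambda>k. L2_norm \<alpha> \<gamma> (\<lambda>x. V k x - v x)) \<longlonglongrightarrow> 0)"
  have "v0 \<in> L2_ball \<alpha> \<gamma> \<and> (\<forall>V\<in>?X. (\<lambda>k. L2_norm \<alpha> \<gamma> (\<lambda>x. V k x - v0 x)) \<longlonglongrightarrow> 0)"
  proof (intro conjI ballI v0L)
    fix V assume "V \<in> ?X"
    then have V: "(U, V) \<in> H1_rel \<alpha> \<gamma>" by simp
    note VD = H1_relD[OF V]
    have VL: "V k \<in> L2_ball \<alpha> \<gamma>" for k by (rule C1_ball_L2(1)[OF \<alpha> \<gamma> C1_CauchyD[OF VD(2)]])
    have bound: "norm (L2_norm \<alpha> \<gamma> (\<lambda>x. V k x - v0 x)) \<le> C1_norm \<alpha> \<gamma> (\<lambda>x. U k x - V k x) + L2_norm \<alpha> \<gamma> (\<lambda>x. U k x - v0 x)" for k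
    proof -
      have "L2_norm \<alpha> \<gamma> (\<lambda>x. V k x - v0 x) \<le> L2_norm \<alpha> \<gamma> (\<lambda>x. V k x - U k x) + L2_norm \<alpha> \<gamma> (\<lambda>x. U k x - v0 x)"
        by (rule L2_norm_triangle[OF VL UL v0L])
      also have "L2_norm \<alpha> \<gamma> (\<lambda>x. V k x - U k x) \<le> C1_norm \<alpha> \<gamma> (\<lambda>x. V k x - U k x)" by (rule L2_norm_le_C1_norm)
      also have "\<dots> = C1_norm \<alpha> \<gamma> (\<lambda>x. U k x - V k x)"
        by (rule C1_norm_minus_commute[OF \<alpha> \<gamma> C1_CauchyD[OF VD(2)] C1_CauchyD[OF U]])
      finally show ?thesis by simp
    qed
    show "(\<lambda>k. L2_norm \<alpha> \<gamma> (\<lambda>x. V k x - v0 x)) \<longlonglongrightarrow> 0"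
      by (rule Lim_null_comparison[OF eventuallyI[OF bound]]) (use tendsto_add[OF VD(3) lim0] in simp)
  qed
  then have "v \<in> L2_ball \<alpha> \<gamma> \<and> (\<forall>V\<in>?X. (\<lambda>k. L2_norm \<alpha> \<gamma> (\<lambda>x. V k x - v x)) \<longlonglongrightarrow> 0)"
    unfolding v_def H1_to_L2_def by (rule someI[of ?Q v0])
  moreover have "U \<in> ?X" using H1_rel_refl[OF U] by simp
  ultimately show "v \<in> L2_ball \<alpha> \<gamma>" "(\<lambda>k. L2_norm \<alpha> \<gamma> (\<lambda>x. U k x - v x)) \<longlonglongrightarrow> 0" by auto
qed

text \<open>
  Projection contracts the \<open>L\<^sup>2\<close> norm, and on polynomials of bounded degree this norm controls the stronger one.
\<close>

lemma poly_proj_limit: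
  assumes U: "U \<in> C1_Cauchy \<alpha> \<gamma>" and v: "v \<in> L2_ball \<alpha> \<gamma>" "(\<lambda>k. L2_norm \<alpha> \<gamma> (\<lambda>x. U k x - v x)) \<longlonglongrightarrow> 0"
  shows "(\<lambda>k. C1_norm \<alpha> \<gamma> (\<lambda>x. poly_proj \<alpha> \<gamma> N (U k) x - poly_proj \<alpha> \<gamma> N v x)) \<longlonglongrightarrow> 0"
proof -
  let ?P = "poly_proj \<alpha> \<gamma> N"
  have UL: "U k \<in> L2_ball \<alpha> \<gamma>" for k by (rule C1_ball_L2(1)[OF \<alpha> \<gamma> C1_CauchyD[OF U]])
  have polyL: "p \<in> L2_ball \<alpha> \<gamma>" if "p \<in> poly_le N" for p
    by (rule C1_ball_L2(1)[OF \<alpha> \<gamma> poly_le_C1_ball[OF that]])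
  note Pv = poly_proj_in[OF \<alpha> \<gamma> v(1), of N] and PU = poly_proj_in[OF \<alpha> \<gamma> UL, of N]
  obtain C where C: "C \<ge> 0" "\<And>p. p \<in> poly_le N \<Longrightarrow> C1_norm \<alpha> \<gamma> p \<le> C * L2_norm \<alpha> \<gamma> p"
    using poly_le_C1_norm_bound[OF \<alpha> \<gamma>] by metis
  have bound: "norm (C1_norm \<alpha> \<gamma> (\<lambda>x. ?P (U k) x - ?P v x)) \<le> C * L2_norm \<alpha> \<gamma> (\<lambda>x. U k x - v x)" for k
  proof -
    let ?d = "\<lambda>x. ?P (U k) x - ?P v x"
    have d: "?d \<in> poly_le N" by (rule poly_le_diff[OF PU Pv])
    note dL = polyL[OF d]
    have "L2_norm \<alpha> \<gamma> ?d \<le> L2_norm \<alpha> \<gamma> (\<lambda>x. U k x - v x)"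
    proof (rule L2_norm_projection_le(1)[OF L2_ball_diff[OF UL v(1)] dL])
      have eq: "(\<lambda>x. (U k x - v x) - ?d x) = (\<lambda>x. (U k x - ?P (U k) x) - (v x - ?P v x))" by (simp add: algebra_simps)
      show "L2_inner \<alpha> \<gamma> (\<lambda>x. (U k x - v x) - ?d x) ?d = 0"
        unfolding eq L2_inner_diff[OF L2_ball_diff[OF UL polyL[OF PU]] L2_ball_diff[OF v(1) polyL[OF Pv]] dL]
        using poly_proj_orth[OF \<alpha> \<gamma> UL d] poly_proj_orth[OF \<alpha> \<gamma> v(1) d] by simp
    qed
    then show ?thesis using C(2)[OF d] mult_left_mono[OF _ C(1)] by (simp, meson order_trans)
  qed
  show ?thesis
    by (rule Lim_null_comparison[OF eventuallyI[OF bound]]) (rule tendsto_mult_right_zero[OF v(2)])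
qed

theorem H1_projection_bound:
  obtains C where "C > 0" "\<And>X N. X \<in> H1_ball \<alpha> \<gamma> \<Longrightarrow> N \<ge> 1 \<Longrightarrow>
    H1_norm \<alpha> \<gamma> (H1_diff \<alpha> \<gamma> X (H1_proj \<alpha> \<gamma> N X)) \<le> C * sqrt (real N) * H1_norm \<alpha> \<gamma> X"
proof -
  obtain C where C: "C > 0" "\<And>u N. u \<in> C1_ball \<Longrightarrow> N \<ge> 1 \<Longrightarrow>
    C1_norm \<alpha> \<gamma> (\<lambda>x. u x - poly_proj \<alpha> \<gamma> N u x) \<le> C * sqrt (real N) * C1_norm \<alpha> \<gamma> u"
    using C1_projection_bound[OF \<alpha> \<gamma>] by metis
  have "H1_norm \<alpha> \<gamma> (H1_diff \<alpha> \<gamma> X (H1_proj \<alpha> \<gamma> N X)) \<le> C * sqrt (real N) * H1_norm \<alpha> \<gamma> X"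
    if X: "X \<in> H1_ball \<alpha> \<gamma>" and N: "N \<ge> 1" for X N
  proof -
    obtain U where U: "U \<in> C1_Cauchy \<alpha> \<gamma>" and XU: "X = H1_rel \<alpha> \<gamma> `` {U}"
      using X unfolding H1_ball_def by (rule quotientE)
    define v where "v = H1_to_L2 \<alpha> \<gamma> X"
    note v = H1_to_L2[OF U, folded XU, folded v_def]
    define p where "p = poly_proj \<alpha> \<gamma> N v"
    have p: "p \<in> C1_ball" unfolding p_def by (rule poly_le_C1_ball[OF poly_proj_in[OF \<alpha> \<gamma> v(1)]])
    have UL: "U k \<in> L2_ball \<alpha> \<gamma>" for k by (rule C1_ball_L2(1)[OF \<alpha> \<gamma> C1_CauchyD[OF U]])
    have lhs: "(\<lambda>k. C1_norm \<alpha> \<gamma> (\<lambda>x. U k x - p x)) \<longlonglongrightarrow> H1_norm \<alpha> \<gamma> (H1_diff \<alpha> \<gamma> X (H1_proj \<alpha> \<gamma> N X))"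
      using H1_diff_norm_limit[OF U p, folded XU] by (simp only: H1_proj_def v_def[symmetric] p_def[symmetric])
    have "(\<lambda>k. C1_norm \<alpha> \<gamma> (U k)) \<longlonglongrightarrow> H1_norm \<alpha> \<gamma> X"
      unfolding XU by (rule H1_class_norm_limit[OF U])
    from tendsto_add[OF tendsto_mult[OF tendsto_const this] poly_proj_limit[OF U v, of N]]
    have rhs: "(\<lambda>k. C * sqrt (real N) * C1_norm \<alpha> \<gamma> (U k) + C1_norm \<alpha> \<gamma> (\<lambda>x. poly_proj \<alpha> \<gamma> N (U k) x - p x))
        \<longlonglongrightarrow> C * sqrt (real N) * H1_norm \<alpha> \<gamma> X" by (simp add: p_def)
    have bound: "C1_norm \<alpha> \<gamma> (\<lambda>x. U k x - p x) \<le> C * sqrt (real N) * C1_norm \<alpha> \<gamma> (U k) + C1_norm \<alpha> \<gamma> (\<lambda>x. poly_proj \<alpha> \<gamma> N (U k) x - p x)" for k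
      using C1_norm_triangle[OF \<alpha> \<gamma> C1_CauchyD[OF U] poly_le_C1_ball[OF poly_proj_in[OF \<alpha> \<gamma> UL]] p, of k N k] C(2)[OF C1_CauchyD[OF U] N, of k]
      by linarith
    show ?thesis by (rule LIMSEQ_le[OF lhs rhs]) (use bound in blast)
  qed
  then show thesis using that C(1) by blast
qed

end

section \<open>Orthogonal polynomials normalised at an endpoint\<close>

text \<open>
  The model is \<open>\<Lambda> p = \<integral> p(t) t\<^sup>K\<^sup>-\<^sup>1 (1 - t)\<^sup>a\<^sup>-\<^sup>1 dt\<close> over the unit interval; the last axiom then says that the
  integral of the derivative of \<open>h(t) t\<^sup>K (1 - t)\<^sup>a\<close> is 0.  The variable \<open>t\<close> is \<open>[:0, 1:]\<close>, and \<open>1 - t\<close> is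
  \<open>[:1, -1:]\<close>.
\<close>

locale jacobi_functional =
  fixes \<Lambda> :: "real poly \<Rightarrow> real" and K a :: real
  assumes K_pos: "K > 0" and a_pos: "a > 0"
    and add: "\<Lambda> (p + q) = \<Lambda> p + \<Lambda> q"
    and smult: "\<Lambda> (smult c p) = c * \<Lambda> p"
    and pos: "p \<noteq> 0 \<Longrightarrow> \<Lambda> (p * p) > 0"
    and pos': "p \<noteq> 0 \<Longrightarrow> \<Lambda> ([:1, -1:] * (p * p)) > 0"
    and by_parts: "\<Lambda> ([:1, -1:] * ([:0, 1:] * pderiv h + Polynomial.smult K h)) = a * \<Lambda> ([:0, 1:] * h)"
begin

lemma zero [simp]: "\<Lambda> 0 = 0"
  using smult[of 0 0] by simp

lemma minus: "\<Lambda> (p - q) = \<Lambda> p - \<Lambda> q"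
  using add[of "p - q" q] by simp

lemma sum: "\<Lambda> (\<Sum>i\<in>I. f i) = (\<Sum>i\<in>I. \<Lambda> (f i))"
  by (induction I rule: infinite_finite_induct) (auto simp: add)

lemma split_one: "\<Lambda> p = \<Lambda> ([:0, 1:] * p) + \<Lambda> ([:1, -1:] * p)"
proof -
  have "p = [:0, 1:] * p + [:1, -1:] * p" by (simp add: algebra_simps)
  then show ?thesis by (metis add)
qed

text \<open>
  Orthogonality refers to \<open>p \<mapsto> \<Lambda> ((1 - t) p)\<close>.
\<close>

definition orth :: "nat \<Rightarrow> real poly \<Rightarrow> bool" where
  "orth m p \<longleftrightarrow> degree p \<le> m \<and> poly p 1 = 1 \<and> (\<forall>q. degree q < m \<longrightarrow> \<Lambda> ([:1, -1:] * (p * q)) = 0)"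

lemma degree_cancel_leading_coeff:
  fixes p q :: "real poly"
  assumes "degree p \<le> Suc n" "degree q \<le> Suc n" "coeff q (Suc n) \<noteq> 0"
  shows "degree (p - Polynomial.smult (coeff p (Suc n) / coeff q (Suc n)) q) \<le> n"
proof (rule degree_le, intro allI impI)
  fix i assume "n < i"
  then consider "i = Suc n" | "i > Suc n" by linarith
  then show "coeff (p - Polynomial.smult (coeff p (Suc n) / coeff q (Suc n)) q) i = 0"
    using assms by cases (auto simp: coeff_eq_0)
qed

lemma root_one_factor:
  fixes p :: "real poly"
  assumes "poly p 1 = 0"
  obtains r where "p = [:1, -1:] * r" "p \<noteq> 0 \<Longrightarrow> degree r < degree p" "degree p \<le> Suc m \<Longrightarrow> degree r \<le> m"
proof -
  have "[:-1, 1:] dvd p" using assms by (simp add: poly_eq_0_iff_dvd)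
  then obtain s where s: "p = [:-1, 1:] * s" by (rule dvdE)
  show thesis
  proof
    show r: "p = [:1, -1:] * (- s)" using s by simp
    show d: "degree (- s) < degree p" if "p \<noteq> 0"
    proof -
      have "s \<noteq> 0" using that s by auto
      then have "degree p = degree [:-1, 1::real:] + degree s" unfolding s by (intro degree_mult_eq) auto
      then show ?thesis by simp
    qed
    show "degree (- s) \<le> m" if "degree p \<le> Suc m"
    proof (cases "p = 0")
      case True
      then have "s = 0" using s by (metis mult_eq_0_iff pCons_eq_0_iff zero_neq_one)
      then show ?thesis by simp
    qed (use that d in auto)
  qed
qed

lemma degree_X_pderiv:
  fixes p :: "real poly"
  shows "degree ([:0, 1:] * pderiv p) \<le> degree p"
proof (rule degree_le, intro allI impI)
  fix i assume "degree p < i"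
  then show "coeff ([:0, 1:] * pderiv p) i = 0"
    by (cases i) (auto simp: coeff_pderiv coeff_eq_0)
qed

text \<open>
  The Gram-Schmidt process for the powers of \<open>t\<close>.
\<close>

lemma monic_orthogonal_exists:
  "\<exists>p. degree p = m \<and> coeff p m = 1 \<and> (\<forall>q. degree q < m \<longrightarrow> \<Lambda> ([:1, -1:] * (p * q)) = 0)"
proof (induction m rule: less_induct)
  case (less m)
  then obtain P where P: "\<And>i. i < m \<Longrightarrow> degree (P i) = i \<and> coeff (P i) i = 1 \<and>
      (\<forall>q. degree q < i \<longrightarrow> \<Lambda> ([:1, -1:] * (P i * q)) = 0)"
    by metis
  let ?Y = "[:1, -1:] :: real poly"
  define c where "c = (\<lambda>i. \<Lambda> (?Y * (monom 1 m * P i)) / \<Lambda> (?Y * (P i * P i)))"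
  define p where "p = monom 1 m - (\<Sum>i<m. Polynomial.smult (c i) (P i))"
  have orthP: "\<Lambda> (?Y * (P i * P j)) = 0" if "i \<noteq> j" "i < m" "j < m" for i j
    using that P[of i] P[of j] by (metis linorder_neqE_nat mult.commute)
  have p0: "\<Lambda> (?Y * (p * P j)) = 0" if j: "j < m" for j
  proof -
    have "?Y * (p * P j) = ?Y * (monom 1 m * P j) - (\<Sum>i<m. Polynomial.smult (c i) (?Y * (P i * P j)))"
      unfolding p_def by (simp add: left_diff_distrib right_diff_distrib sum_distrib_left sum_distrib_right)
    then have "\<Lambda> (?Y * (p * P j)) = \<Lambda> (?Y * (monom 1 m * P j)) - (\<Sum>i<m. c i * \<Lambda> (?Y * (P i * P j)))"
      by (simp only: minus sum smult)
    also have "(\<Sum>i<m. c i * \<Lambda> (?Y * (P i * P j))) = c j * \<Lambda> (?Y * (P j * P j))"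
      using j orthP by (subst sum.remove[of _ j]) (auto intro!: sum.neutral)
    also have "\<dots> = \<Lambda> (?Y * (monom 1 m * P j))"
    proof -
      have "P j \<noteq> 0" using P[OF j] by auto
      then show ?thesis using pos'[of "P j"] by (simp add: c_def)
    qed
    finally show ?thesis by simp
  qed
  have low: "coeff (\<Sum>i<m. Polynomial.smult (c i) (P i)) n = 0" if "n \<ge> m" for n
    unfolding coeff_sum using that P by (intro sum.neutral) (auto intro!: coeff_eq_0)
  have cm: "coeff p m = 1" using low[of m] by (simp add: p_def)
  moreover have "degree p \<le> m"
    by (rule degree_le) (use low in \<open>auto simp: p_def\<close>)
  ultimately have dm: "degree p = m" by (metis le_antisym le_degree zero_neq_one)
  have "\<Lambda> (?Y * (p * q)) = 0" if "degree q < m" for q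
    using that
  proof (induction "degree q" arbitrary: q rule: less_induct)
    case less
    let ?d = "degree q"
    let ?r = "q - Polynomial.smult (coeff q ?d) (P ?d)"
    have "\<Lambda> (?Y * (p * ?r)) = 0"
    proof (cases "?r = 0")
      case False
      have "degree ?r < degree q"
      proof -
        have "degree ?r \<le> ?d" using P[OF less.prems] degree_smult_le[of "coeff q ?d" "P ?d"] by (intro degree_diff_le) auto
        moreover have "coeff ?r ?d = 0" using P[OF less.prems] by simp
        ultimately show ?thesis using False
          by (metis leading_coeff_0_iff le_neq_implies_less)
      qed
      then show ?thesis using less.hyps less.prems by auto
    qed simp
    moreover have "?Y * (p * ?r) = ?Y * (p * q) - Polynomial.smult (coeff q ?d) (?Y * (p * P ?d))"
      by (simp add: right_diff_distrib)
    ultimately show ?case using p0[OF less.prems] by (simp only: minus smult)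
  qed
  then show ?case using cm dm by blast
qed

text \<open>
  An orthogonal polynomial \<open>p\<close> of degree \<open>m\<close> does not vanish at 1, and so can be normalised there: from \<open>p = (1 - t) r\<close>
  and orthogonality to \<open>r\<close> it would follow that \<open>\<Lambda> (p\<^sup>2) = \<Lambda> ((1 - t) p r) = 0\<close>.
\<close>

lemma orth_exists: "\<exists>p. orth m p"
proof -
  let ?Y = "[:1, -1:] :: real poly"
  obtain p where p: "degree p = m" "coeff p m = 1" "\<And>q. degree q < m \<Longrightarrow> \<Lambda> (?Y * (p * q)) = 0"
    using monic_orthogonal_exists by blast
  have p0: "p \<noteq> 0" using p(2) by auto
  have "poly p 1 \<noteq> 0"
  proof
    assume "poly p 1 = 0"
    then obtain r where r: "p = ?Y * r" "degree r < degree p"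
      using root_one_factor[of p] p0 by metis
    then have "degree r < m" using p(1) by simp
    then have "\<Lambda> (?Y * (p * r)) = 0" by (rule p(3))
    moreover have "?Y * (p * r) = p * (?Y * r)" by (simp only: mult_ac)
    then have "?Y * (p * r) = p * p" by (simp only: r(1)[symmetric])
    ultimately show False using pos[OF p0] by simp
  qed
  then have "orth m (Polynomial.smult (1 / poly p 1) p)"
    using p unfolding orth_def by (auto simp: smult)
  then show ?thesis ..
qed

text \<open>
  Jacobi polynomials with value 1 at 1.  By \<open>phi_reproduces\<close> below, \<open>\<phi> m\<close> minimises \<open>\<Lambda> (p\<^sup>2)\<close> among the
  polynomials \<open>p\<close> of degree at most \<open>m\<close> with \<open>p(1) = 1\<close>, and \<open>\<eta> m\<close> is the minimum.
\<close>

definition \<phi> :: "nat \<Rightarrow> real poly" where "\<phi> m = (SOME p. orth m p)"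
definition \<eta> :: "nat \<Rightarrow> real" where "\<eta> m = \<Lambda> (\<phi> m * \<phi> m)"
abbreviation "A m \<equiv> 2 * real m + K + a"

lemma orth_phi: "orth m (\<phi> m)"
  unfolding \<phi>_def using orth_exists by (rule someI_ex)

lemma degree_phi: "degree (\<phi> m) \<le> m" and phi_one [simp]: "poly (\<phi> m) 1 = 1"
  and phi_orth: "degree q < m \<Longrightarrow> \<Lambda> ([:1, -1:] * (\<phi> m * q)) = 0"
  using orth_phi[of m] by (auto simp: orth_def)

lemma phi_nonzero: "\<phi> m \<noteq> 0"
  using phi_one[of m] by (metis poly_0 zero_neq_one)

lemma eta_pos: "\<eta> m > 0"
  unfolding \<eta>_def by (rule pos[OF phi_nonzero])

text \<open>
  The polynomial \<open>p - p(1) \<phi>\<^sub>m\<close> vanishes at 1, hence is \<open>1 - t\<close> times a polynomial of lower degree, to which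
  \<open>\<phi>\<^sub>m\<close> is orthogonal.
\<close>

lemma phi_reproduces:
  assumes "degree p \<le> m"
  shows "\<Lambda> (\<phi> m * p) = poly p 1 * \<eta> m"
proof -
  let ?q = "p - Polynomial.smult (poly p 1) (\<phi> m)"
  have "\<Lambda> (\<phi> m * ?q) = 0"
  proof (cases "?q = 0")
    case False
    have "poly ?q 1 = 0" by simp
    then obtain r where r: "?q = [:1, -1:] * r" "degree r < degree ?q" 
      using root_one_factor[of ?q] False by metis
    have "degree ?q \<le> m"
      using assms degree_phi[of m] degree_smult_le[of "poly p 1" "\<phi> m"] by (intro degree_diff_le) auto
    then have "\<Lambda> ([:1, -1:] * (\<phi> m * r)) = 0" using r(2) by (intro phi_orth) linarith
    moreover have "\<phi> m * ?q = [:1, -1:] * (\<phi> m * r)" unfolding r(1) by (simp only: mult_ac)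
    ultimately show ?thesis by simp
  qed simp
  moreover have "\<phi> m * ?q = \<phi> m * p - Polynomial.smult (poly p 1) (\<phi> m * \<phi> m)"
    by (simp add: right_diff_distrib)
  ultimately show ?thesis by (simp only: minus smult \<eta>_def)
qed

lemma degree_euler:
  fixes p :: "real poly"
  assumes "degree p \<le> m"
  shows "m = 0 \<Longrightarrow> [:0, 1:] * pderiv p - Polynomial.smult (real m) p = 0"
    and "m > 0 \<Longrightarrow> degree ([:0, 1:] * pderiv p - Polynomial.smult (real m) p) < m"
proof -
  let ?q = "[:0, 1:] * pderiv p - Polynomial.smult (real m) p"
  have c: "coeff ?q i = (real i - real m) * coeff p i" for i
    by (cases i) (auto simp: coeff_pderiv algebra_simps)
  have z: "coeff ?q i = 0" if "i \<ge> m" for i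
    using that assms c[of i] by (cases "i = m") (auto simp: coeff_eq_0)
  show "?q = 0" if "m = 0" using z that by (intro poly_eqI) simp
  show "degree ?q < m" if "m > 0"
  proof -
    have "degree ?q \<le> m - 1" by (rule degree_le) (use z that in auto)
    then show ?thesis using that by linarith
  qed
qed

text \<open>
  The operator \<open>t d/dt\<close> multiplies the coefficient of \<open>t\<^sup>m\<close> by \<open>m\<close>, and \<open>\<phi>\<^sub>m\<close> does not see lower degrees.
\<close>

lemma orth_euler:
  assumes "degree q \<le> m"
  shows "\<Lambda> ([:1, -1:] * (\<phi> m * ([:0, 1:] * pderiv q))) = real m * \<Lambda> ([:1, -1:] * (\<phi> m * q))"
proof -
  let ?r = "[:0, 1:] * pderiv q - Polynomial.smult (real m) q"
  have "\<Lambda> ([:1, -1:] * (\<phi> m * ?r)) = 0"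
    using degree_euler[OF assms] phi_orth[of ?r m] by (cases "m = 0") auto
  moreover have "[:1, -1:] * (\<phi> m * ?r) = [:1, -1:] * (\<phi> m * ([:0, 1:] * pderiv q))
      - Polynomial.smult (real m) ([:1, -1:] * (\<phi> m * q))"
    by (simp only: right_diff_distrib mult_smult_right)
  ultimately show ?thesis by (simp only: minus smult)
qed

text \<open>
  Integration by parts for \<open>h = \<phi>\<^sub>m\<^sup>2\<close>.  It expresses the norm for the weight with \<open>1 - t\<close> by the one without;
  the factor \<open>a / A m\<close> is the one-dimensional form of \<open>orthogonal_poly_norms\<close>.
\<close>

lemma phi_norm: "\<Lambda> ([:1, -1:] * (\<phi> m * \<phi> m)) = a * \<eta> m / A m"
proof -
  let ?\<nu> = "\<Lambda> ([:1, -1:] * (\<phi> m * \<phi> m))"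
  have "[:1, -1:] * ([:0, 1:] * pderiv (\<phi> m * \<phi> m) + Polynomial.smult K (\<phi> m * \<phi> m)) =
      [:1, -1:] * (\<phi> m * ([:0, 1:] * pderiv (\<phi> m))) + [:1, -1:] * (\<phi> m * ([:0, 1:] * pderiv (\<phi> m))) + Polynomial.smult K ([:1, -1:] * (\<phi> m * \<phi> m))"
    by (simp only: pderiv_mult distrib_left mult_smult_right mult_ac)
  then have "real m * ?\<nu> + real m * ?\<nu> + K * ?\<nu> = a * \<Lambda> ([:0, 1:] * (\<phi> m * \<phi> m))"
    using by_parts[of "\<phi> m * \<phi> m"] by (simp only: add smult orth_euler[OF degree_phi])
  also have "\<Lambda> ([:0, 1:] * (\<phi> m * \<phi> m)) = \<eta> m - ?\<nu>"
    using split_one[of "\<phi> m * \<phi> m"] by (simp add: \<eta>_def)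
  finally have "(2 * real m + K + a) * ?\<nu> = a * \<eta> m" by (simp add: algebra_simps)
  moreover have "2 * real m + K + a > 0" using K_pos a_pos by simp
  ultimately show ?thesis by (simp add: field_simps)
qed

lemma phi_orth_phi: "i < m \<Longrightarrow> \<Lambda> ([:1, -1:] * (\<phi> m * \<phi> i)) = 0"
  using degree_phi[of i] by (intro phi_orth) linarith

text \<open>
  The expansion of \<open>p\<close> in the orthogonal polynomials \<open>\<phi>\<^sub>i\<close>, evaluated at 1, where each \<open>\<phi>\<^sub>i\<close> is 1.  The second
  factor is the inverse square of the norm of \<open>\<phi>\<^sub>i\<close>, by \<open>phi_norm\<close>.
\<close>

lemma evaluation_expansion:
  "degree p \<le> m \<Longrightarrow> poly p 1 = (\<Sum>i\<le>m. \<Lambda> ([:1, -1:] * (p * \<phi> i)) * (A i / (a * \<eta> i)))"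
proof (induction m arbitrary: p)
  case 0
  then obtain c where c: "p = [:c:]" by (metis degree_0_id le_zero_eq)
  have "\<phi> 0 = 1" using degree_phi[of 0] phi_one[of 0] by (metis degree_0_id le_zero_eq one_pCons poly_pCons poly_0 add_0_right mult_zero_right)
  then have "\<Lambda> ([:1, -1:] * (p * \<phi> 0)) = c * (a * \<eta> 0 / A 0)"
    using phi_norm[of 0] smult[of c "[:1, -1:]"] c by simp
  moreover have "a * \<eta> 0 \<noteq> 0" "A 0 \<noteq> 0" using a_pos eta_pos[of 0] K_pos by auto
  ultimately show ?case using c by (simp add: field_simps)
next
  case (Suc m)
  let ?Y = "[:1, -1:] :: real poly"
  have lead: "coeff (\<phi> (Suc m)) (Suc m) \<noteq> 0"
  proof
    assume "coeff (\<phi> (Suc m)) (Suc m) = 0"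
    then have "degree (\<phi> (Suc m)) < Suc m"
      using degree_phi[of "Suc m"] phi_nonzero[of "Suc m"] by (metis leading_coeff_0_iff le_neq_implies_less)
    then show False using phi_orth[of "\<phi> (Suc m)" "Suc m"] pos'[OF phi_nonzero[of "Suc m"]] by simp
  qed
  define c where "c = coeff p (Suc m) / coeff (\<phi> (Suc m)) (Suc m)"
  define r where "r = p - Polynomial.smult c (\<phi> (Suc m))"
  have dr: "degree r \<le> m"
    unfolding r_def c_def using Suc.prems degree_phi lead by (rule degree_cancel_leading_coeff)
  have p: "p = r + Polynomial.smult c (\<phi> (Suc m))" by (simp add: r_def)
  have pr: "\<Lambda> (?Y * (p * \<phi> i)) = \<Lambda> (?Y * (r * \<phi> i)) + c * \<Lambda> (?Y * (\<phi> (Suc m) * \<phi> i))" for i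
    unfolding p by (simp only: distrib_left distrib_right mult_smult_left mult_smult_right add smult)
  have top: "\<Lambda> (?Y * (p * \<phi> (Suc m))) = c * (a * \<eta> (Suc m) / A (Suc m))"
    unfolding pr phi_norm using phi_orth[of r "Suc m"] dr by (simp add: mult.commute[of r])
  have nz: "a * \<eta> (Suc m) \<noteq> 0" "A (Suc m) \<noteq> 0"
    using a_pos eta_pos[of "Suc m"] K_pos by (auto simp: add_nonneg_eq_0_iff)
  have "(\<Sum>i\<le>m. \<Lambda> (?Y * (p * \<phi> i)) * (A i / (a * \<eta> i))) = (\<Sum>i\<le>m. \<Lambda> (?Y * (r * \<phi> i)) * (A i / (a * \<eta> i)))"
    by (intro sum.cong refl) (simp only: pr phi_orth_phi atMost_iff less_Suc_eq_le mult_zero_right add_0_right)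
  also have "\<dots> = poly r 1" using Suc.IH[OF dr] by simp
  finally have "(\<Sum>i\<le>Suc m. \<Lambda> (?Y * (p * \<phi> i)) * (A i / (a * \<eta> i)))
      = poly r 1 + c * (a * \<eta> (Suc m) / A (Suc m)) * (A (Suc m) / (a * \<eta> (Suc m)))"
    by (simp only: sum.atMost_Suc top)
  also have "c * (a * \<eta> (Suc m) / A (Suc m)) * (A (Suc m) / (a * \<eta> (Suc m))) = c"
    using nz by (simp add: divide_simps)
  finally show ?case using p phi_one[of "Suc m"] by (metis mult.right_neutral poly_add poly_smult)
qed

text \<open>
  This is \<open>a\<close> times the sum of the inverse squared norms of \<open>\<phi>\<^sub>i\<close> for \<open>i < m\<close>, that is, \<open>a\<close> times the value at
  \<open>(1, 1)\<close> of the reproducing kernel of the polynomials of degree less than \<open>m\<close>.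
\<close>

definition S :: "nat \<Rightarrow> real" where "S m = (\<Sum>i<m. A i / \<eta> i)"

text \<open>
  \<open>evaluation_expansion\<close> for \<open>t \<phi>\<^sub>m'\<close>.  For \<open>i < m\<close>, integration by parts with \<open>h = \<phi>\<^sub>m \<phi>\<^sub>i\<close> shows that its inner
  product with \<open>\<phi>\<^sub>i\<close> is \<open>a \<eta>\<^sub>m\<close>, independently of \<open>i\<close>.
\<close>

lemma deriv_phi_one: "poly (pderiv (\<phi> m)) 1 = \<eta> m * S m + real m"
proof -
  let ?Y = "[:1, -1:] :: real poly" and ?X = "[:0, 1:] :: real poly"
  let ?p = "?X * pderiv (\<phi> m)"
  have d: "degree ?p \<le> m"
    using degree_X_pderiv[of "\<phi> m"] degree_phi[of m] by linarith
  have low: "\<Lambda> (?Y * (?p * \<phi> i)) = a * \<eta> m" if i: "i < m" for i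
  proof -
    have "degree (?X * pderiv (\<phi> i)) < m"
      using degree_X_pderiv[of "\<phi> i"] degree_phi[of i] i by linarith
    then have z: "\<Lambda> (?Y * (\<phi> m * (?X * pderiv (\<phi> i)))) = 0" by (rule phi_orth)
    have "?Y * (?X * pderiv (\<phi> m * \<phi> i) + Polynomial.smult K (\<phi> m * \<phi> i)) =
       ?Y * (?p * \<phi> i) + ?Y * (\<phi> m * (?X * pderiv (\<phi> i))) + Polynomial.smult K (?Y * (\<phi> m * \<phi> i))"
      by (simp only: pderiv_mult distrib_left mult_smult_right mult_ac add_ac)
    then have "\<Lambda> (?Y * (?p * \<phi> i)) = a * \<Lambda> (?X * (\<phi> m * \<phi> i))"
      using by_parts[of "\<phi> m * \<phi> i"] by (simp only: add smult z phi_orth_phi[OF i])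
    also have "\<Lambda> (?X * (\<phi> m * \<phi> i)) = \<eta> m"
      using split_one[of "\<phi> m * \<phi> i"] phi_orth_phi[OF i] phi_reproduces[of "\<phi> i" m] degree_phi[of i] i by simp
    finally show ?thesis .
  qed
  have top: "\<Lambda> (?Y * (?p * \<phi> m)) = real m * (a * \<eta> m / A m)"
    using orth_euler[OF degree_phi[of m]] phi_norm[of m] by (simp only: mult_ac)
  have nz: "a \<noteq> 0" "\<eta> m \<noteq> 0" "A m \<noteq> 0" using a_pos eta_pos[of m] K_pos by (auto simp: add_nonneg_eq_0_iff)
  have "poly (pderiv (\<phi> m)) 1 = poly ?p 1" by simp
  also have "\<dots> = (\<Sum>i\<le>m. \<Lambda> (?Y * (?p * \<phi> i)) * (A i / (a * \<eta> i)))"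
    by (rule evaluation_expansion[OF d])
  also have "\<dots> = (\<Sum>i<m. \<Lambda> (?Y * (?p * \<phi> i)) * (A i / (a * \<eta> i))) + real m * (a * \<eta> m / A m) * (A m / (a * \<eta> m))"
    unfolding lessThan_Suc_atMost[symmetric] sum.lessThan_Suc top ..
  also have "real m * (a * \<eta> m / A m) * (A m / (a * \<eta> m)) = real m" using nz by (simp add: divide_simps)
  also have "(\<Sum>i<m. \<Lambda> (?Y * (?p * \<phi> i)) * (A i / (a * \<eta> i))) = (\<Sum>i<m. \<eta> m * (A i / \<eta> i))"
    by (intro sum.cong refl) (use low nz in auto)
  finally show ?thesis by (simp add: S_def sum_distrib_left)
qed

text \<open>
  Let \<open>\<phi>\<^sub>m - \<phi>\<^sub>m\<^sub>+\<^sub>1 = (1 - t) \<psi>\<close>.  By \<open>phi_reproduces\<close> the inner product of \<open>\<psi>\<close> with each \<open>\<phi>\<^sub>i\<close>, \<open>i \<le> m\<close>, is \<open>\<eta>\<^sub>m - \<eta>\<^sub>m\<^sub>+\<^sub>1\<close>, so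
  \<open>evaluation_expansion\<close> gives \<open>\<psi>(1)\<close>.  Differentiation at 1 gives \<open>\<psi>(1) = \<phi>\<^sub>m\<^sub>+\<^sub>1'(1) - \<phi>\<^sub>m'(1)\<close>, and \<open>deriv_phi_one\<close>
  expresses this by the same quantities.
\<close>

lemma eta_difference: "(a + 1) * ((\<eta> m - \<eta> (Suc m)) * S (Suc m)) = a * (1 + A m)"
proof -
  let ?Y = "[:1, -1:] :: real poly"
  have "poly (\<phi> m - \<phi> (Suc m)) 1 = 0" by simp
  moreover have "degree (\<phi> m - \<phi> (Suc m)) \<le> Suc m"
    using degree_phi[of m] degree_phi[of "Suc m"] by (intro degree_diff_le) auto
  ultimately obtain \<psi> where \<psi>: "\<phi> m - \<phi> (Suc m) = ?Y * \<psi>" "degree \<psi> \<le> m"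
    using root_one_factor[of "\<phi> m - \<phi> (Suc m)"] by metis
  have low: "\<Lambda> (?Y * (\<psi> * \<phi> i)) = \<eta> m - \<eta> (Suc m)" if "i \<le> m" for i
  proof -
    have "?Y * (\<psi> * \<phi> i) = \<phi> m * \<phi> i - \<phi> (Suc m) * \<phi> i"
      unfolding left_diff_distrib[symmetric] \<psi>(1) by (simp only: mult_ac)
    then show ?thesis
      using phi_reproduces[of "\<phi> i" m] phi_reproduces[of "\<phi> i" "Suc m"] degree_phi[of i] that by (simp add: minus)
  qed
  have a0: "a \<noteq> 0" using a_pos by simp
  have "poly \<psi> 1 = (\<Sum>i\<le>m. (\<eta> m - \<eta> (Suc m)) / a * (A i / \<eta> i))"
    unfolding evaluation_expansion[OF \<psi>(2)] by (intro sum.cong refl) (use low a0 in auto)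
  also have "\<dots> = (\<eta> m - \<eta> (Suc m)) / a * S (Suc m)"
    by (simp only: S_def lessThan_Suc_atMost sum_distrib_left)
  finally have psi1: "poly \<psi> 1 = (\<eta> m - \<eta> (Suc m)) / a * S (Suc m)" .
  have "poly (pderiv (\<phi> m - \<phi> (Suc m))) 1 = - poly \<psi> 1"
    unfolding \<psi>(1) pderiv_mult by (simp add: pderiv_pCons)
  then have "\<eta> (Suc m) * S (Suc m) + real (Suc m) - (\<eta> m * S m + real m) = (\<eta> m - \<eta> (Suc m)) / a * S (Suc m)"
    unfolding psi1 pderiv_diff by (simp add: deriv_phi_one)
  moreover have "\<eta> m * S m = \<eta> m * S (Suc m) - A m"
    using eta_pos[of m] by (simp add: S_def field_simps)
  ultimately have "1 + A m - (\<eta> m - \<eta> (Suc m)) * S (Suc m) = (\<eta> m - \<eta> (Suc m)) / a * S (Suc m)"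
    by (simp add: algebra_simps)
  then show ?thesis using a0 by (simp add: field_simps)
qed

text \<open>
  \<open>eta_difference\<close> is a recursion for the products of \<open>\<eta>\<close> and \<open>S\<close>; these are its solutions.
\<close>

lemma eta_sum: "(a + 1) * (\<eta> m * S m) = real m * (real m + K - 1)"
  and eta_sum_Suc: "(a + 1) * (\<eta> m * S (Suc m)) = (real m + a + 1) * (real m + a + K)"
proof -
  have step: "(a + 1) * (\<eta> m * S (Suc m)) = (real m + a + 1) * (real m + a + K)"
    if "(a + 1) * (\<eta> m * S m) = real m * (real m + K - 1)" for m
  proof -
    have "\<eta> m * S (Suc m) = \<eta> m * S m + A m" using eta_pos[of m] by (simp add: S_def field_simps)
    then have "(a + 1) * (\<eta> m * S (Suc m)) = real m * (real m + K - 1) + (a + 1) * A m"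
      using that by (simp add: algebra_simps)
    then show ?thesis by (simp add: algebra_simps)
  qed
  have main: "(a + 1) * (\<eta> m * S m) = real m * (real m + K - 1)" for m
  proof (induction m)
    case 0
    then show ?case by (simp add: S_def)
  next
    case (Suc m)
    have "(a + 1) * (\<eta> (Suc m) * S (Suc m)) = (real m + a + 1) * (real m + a + K) - a * (1 + A m)"
      using step[OF Suc] eta_difference[of m] by (simp add: algebra_simps)
    then show ?case by (simp add: algebra_simps)
  qed
  show "(a + 1) * (\<eta> m * S m) = real m * (real m + K - 1)" by (rule main)
  show "(a + 1) * (\<eta> m * S (Suc m)) = (real m + a + 1) * (real m + a + K)" by (rule step[OF main])
qed

lemma eta_ratio: "\<eta> (Suc m) * ((real m + a + 1) * (real m + a + K)) = \<eta> m * ((real m + 1) * (real m + K))"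
proof -
  have 1: "(a + 1) * (\<eta> (Suc m) * S (Suc m)) = (real m + 1) * (real m + K)"
    using eta_sum[of "Suc m"] by (simp add: algebra_simps)
  have "\<eta> (Suc m) * ((real m + a + 1) * (real m + a + K)) = \<eta> m * ((a + 1) * (\<eta> (Suc m) * S (Suc m)))"
    unfolding eta_sum_Suc[symmetric] by (simp only: mult_ac)
  then show ?thesis unfolding 1 .
qed

end

section \<open>Polynomials with large projection error, in one variable\<close>

lemma antiderivative_exists:
  fixes p :: "real poly"
  shows "\<exists>q. pderiv q = p \<and> degree q \<le> Suc (degree p)"
proof -
  let ?q = "\<Sum>i\<le>degree p. monom (coeff p i / real (Suc i)) (Suc i)"
  have "pderiv (monom (coeff p i / real (Suc i)) (Suc i)) = monom (coeff p i) i" for i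
    by (simp add: pderiv_monom)
  then have "pderiv ?q = (\<Sum>i\<le>degree p. monom (coeff p i) i)"
    by (simp add: higher_pderiv_sum[of 1, simplified])
  moreover have "degree ?q \<le> Suc (degree p)"
    by (intro degree_sum_le) (auto intro: order_trans[OF degree_monom_le])
  ultimately show ?thesis using poly_as_sum_of_monoms[of p] by auto
qed

text \<open>
  The model is the integral of \<open>p(\<bar>x\<bar>\<^sup>2)\<close> against the weight on the ball or, up to a constant,
  \<open>L p = \<integral> p(t) t\<^sup>\<kappa>\<^sup>-\<^sup>1 (1 - t)\<^sup>a\<^sup>-\<^sup>1 dt\<close> over the unit interval.  Derivatives of radial functions carry the additional
  factor \<open>t\<close>, hence the second functional \<open>p \<mapsto> L (t p)\<close>.
\<close>

locale radial_functional =
  fixes L :: "real poly \<Rightarrow> real" and \<kappa> a :: real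
  assumes \<kappa>_pos: "\<kappa> > 0" and a_pos: "a > 0"
    and add: "L (p + q) = L p + L q"
    and smult: "L (smult c p) = c * L p"
    and nonneg: "L (p * p) \<ge> 0"
    and pos: "p \<noteq> 0 \<Longrightarrow> L ([:0, 1:] * ([:1, -1:] * (p * p))) > 0"
    and by_parts: "L ([:1, -1:] * ([:0, 1:] * pderiv h + smult \<kappa> h)) = a * L ([:0, 1:] * h)"
begin

lemma zero [simp]: "L 0 = 0"
  using smult[of 0 0] by simp

lemma minus: "L (p - q) = L p - L q"
  using add[of "p - q" q] by simp

lemma split_one: "L p = L ([:0, 1:] * p) + L ([:1, -1:] * p)"
proof -
  have "p = [:0, 1:] * p + [:1, -1:] * p" by (simp add: algebra_simps)
  then show ?thesis by (metis add)
qed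

sublocale J: jacobi_functional "\<lambda>p. L ([:0, 1:] * p)" "\<kappa> + 1" a
proof
  let ?Y = "[:1, -1:] :: real poly" and ?X = "[:0, 1:] :: real poly"
  show "\<kappa> + 1 > 0" "a > 0" using \<kappa>_pos a_pos by auto
  show "L (?X * (p + q)) = L (?X * p) + L (?X * q)" for p q
    by (simp only: distrib_left add)
  show "L (?X * Polynomial.smult c p) = c * L (?X * p)" for c p
    by (simp only: mult_smult_right smult)
  show "L (?X * (?Y * (p * p))) > 0" if "p \<noteq> 0" for p
    using pos[OF that] .
  show "L (?X * (p * p)) > 0" if "p \<noteq> 0" for p
  proof -
    have "L (?X * (p * p)) = L ((?X * p) * (?X * p)) + L (?X * (?Y * (p * p)))"
      using split_one[of "?X * (p * p)"] by (simp only: mult_ac)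
    then show ?thesis using pos[OF that] nonneg[of "?X * p"] by linarith
  qed
  show "L (?X * (?Y * (?X * pderiv h + Polynomial.smult (\<kappa> + 1) h))) = a * L (?X * (?X * h))" for h
  proof -
    have X': "pderiv ?X = 1" by (simp add: pderiv_pCons)
    have "?X * pderiv (?X * h) + Polynomial.smult \<kappa> (?X * h) = ?X * (?X * pderiv h + Polynomial.smult (\<kappa> + 1) h)"
      unfolding pderiv_mult X' by (simp only: smult_add_left distrib_left mult_smult_right mult_smult_left mult_1_right mult_1_left smult_1_left mult_ac add_ac)
    then have "?X * (?Y * (?X * pderiv h + Polynomial.smult (\<kappa> + 1) h)) = ?Y * (?X * pderiv (?X * h) + Polynomial.smult \<kappa> (?X * h))"
      by (simp only: mult_ac)
    then show ?thesis using by_parts[of "?X * h"] by (simp only:)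
  qed
qed

text \<open>
  Up to the sign, the adjoint of \<open>d/dt\<close> from \<open>L\<close> to the functional \<open>p \<mapsto> L (t (1 - t) p)\<close>.
\<close>

definition D :: "real poly \<Rightarrow> real poly" where
  "D B = [:1, -1:] * ([:0, 1:] * pderiv B + Polynomial.smult \<kappa> B) - Polynomial.smult a ([:0, 1:] * B)"

lemma adjoint: "L (G * D B) = - L ([:0, 1:] * ([:1, -1:] * (pderiv G * B)))"
proof -
  let ?Y = "[:1, -1:] :: real poly" and ?X = "[:0, 1:] :: real poly"
  have ring: "y * (x * (G * B' + B * G') + Polynomial.smult \<kappa> (G * B)) =
      G * (y * (x * B' + Polynomial.smult \<kappa> B) - Polynomial.smult a (x * B)) + Polynomial.smult a (x * (G * B)) + x * (y * (G' * B))"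
    for x y B' G' :: "real poly"
    by (simp add: algebra_simps)
  have "?Y * (?X * pderiv (G * B) + Polynomial.smult \<kappa> (G * B)) =
      G * D B + Polynomial.smult a (?X * (G * B)) + ?X * (?Y * (pderiv G * B))"
    unfolding D_def pderiv_mult by (rule ring)
  then show ?thesis using by_parts[of "G * B"] by (simp only: add smult)
qed

text \<open>
  The operator \<open>D\<close> maps \<open>t\<^sup>n\<close> to a polynomial of degree exactly \<open>n + 1\<close>, so its range misses only the constants.
\<close>

lemma adjoint_range:
  "degree q \<le> n \<Longrightarrow> \<exists>c B. q = [:c:] + D B \<and> (n = 0 \<longrightarrow> B = 0) \<and> (n > 0 \<longrightarrow> degree B < n)"
proof (induction n arbitrary: q)
  case 0
  then show ?case by (intro exI[of _ "coeff q 0"] exI[of _ 0]) (auto simp: D_def degree_0_id[symmetric])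
next
  case (Suc n)
  have cD: "coeff (D B) i = (real i + \<kappa>) * coeff B i - (if i = 0 then 0 else (real i - 1 + \<kappa> + a) * coeff B (i - 1))" for B i
  proof (cases i)
    case (Suc k)
    then show ?thesis by (cases k) (auto simp: D_def coeff_pderiv algebra_simps)
  qed (simp add: D_def)
  define b where "b = - coeff q (Suc n) / (real n + \<kappa> + a)"
  have nz: "real n + \<kappa> + a > 0" using \<kappa>_pos a_pos by simp
  let ?r = "q - D (monom b n)"
  have "degree ?r \<le> n"
  proof (rule degree_le, intro allI impI)
    fix i assume "n < i"
    then consider "i = Suc n" | "i > Suc n" by linarith
    then show "coeff ?r i = 0"
      using Suc.prems nz by cases (auto simp: cD b_def coeff_eq_0 divide_simps)
  qed
  then obtain c B where B: "?r = [:c:] + D B" "n = 0 \<longrightarrow> B = 0" "n > 0 \<longrightarrow> degree B < n"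
    using Suc.IH by blast
  have D_add: "D (P + Q) = D P + D Q" for P Q
    unfolding D_def by (simp add: pderiv_add algebra_simps smult_add_right)
  have "q = [:c:] + D (B + monom b n)"
    using B(1) unfolding D_add by (simp add: algebra_simps)
  moreover have "degree (B + monom b n) < Suc n"
    using B(2,3) degree_monom_le[of b n] by (cases "n = 0") (auto simp: less_Suc_eq_le intro!: degree_add_le)
  ultimately show ?case by blast
qed

lemma L_one_pos: "L 1 > 0"
proof -
  have "L ([:0, 1:] * 1) > 0" using J.pos[of 1] by simp
  moreover have "L ([:1, -1:] * ([:0, 1:] * 0 + Polynomial.smult \<kappa> 1)) = a * L ([:0, 1:] * 1)"
    using by_parts[of 1] by simp
  then have "\<kappa> * L ([:1, -1:] * 1) = a * L ([:0, 1:] * 1)"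
    by (simp only: mult_zero_right add_0_left mult_smult_right smult)
  ultimately have "L ([:1, -1:] * 1) > 0"
    using \<kappa>_pos a_pos by (metis mult_pos_pos zero_less_mult_pos)
  with \<open>L ([:0, 1:] * 1) > 0\<close> show ?thesis using split_one[of 1] by linarith
qed

text \<open>
  A primitive of \<open>\<phi>\<^sub>n\<close> is orthogonal to the range of \<open>D\<close> in degrees up to \<open>n\<close>, and the constant of integration makes it
  orthogonal to constants.  For the bound, \<open>t \<phi>\<^sub>n - (n + 1) G\<close> has degree at most \<open>n\<close>, so that
  \<open>(n + 1) L (G\<^sup>2) = L (G t \<phi>\<^sub>n)\<close>; expanding the square of that polynomial yields \<open>(n + 1)\<^sup>2 L (G\<^sup>2) \<le> L (t\<^sup>2 \<phi>\<^sub>n\<^sup>2)\<close>.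
\<close>

lemma phi_primitive:
  obtains G where "pderiv G = J.\<phi> n" "degree G \<le> Suc n" "\<And>q. degree q \<le> n \<Longrightarrow> L (G * q) = 0"
    "(real n + 1)\<^sup>2 * L (G * G) \<le> J.\<eta> n"
proof -
  let ?Y = "[:1, -1:] :: real poly" and ?X = "[:0, 1:] :: real poly"
  obtain G0 where G0: "pderiv G0 = J.\<phi> n" "degree G0 \<le> Suc (degree (J.\<phi> n))"
    using antiderivative_exists by blast
  define G where "G = G0 - Polynomial.smult (L G0 / L 1) 1"
  have dG: "pderiv G = J.\<phi> n" by (simp add: G_def pderiv_diff pderiv_smult G0)
  have degG: "degree G \<le> Suc n"
    using G0(2) J.degree_phi[of n] degree_smult_le[of "L G0 / L 1" "1::real poly"]
    unfolding G_def by (intro degree_diff_le) auto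
  have "L G = L G0 - L G0 / L 1 * L 1" by (simp only: G_def minus smult)
  then have LG: "L G = 0" using L_one_pos by simp
  have orth: "L (G * q) = 0" if q: "degree q \<le> n" for q
  proof -
    obtain c B where B: "q = [:c:] + D B" "n = 0 \<longrightarrow> B = 0" "n > 0 \<longrightarrow> degree B < n"
      using adjoint_range[OF q] by blast
    have "L (?X * (?Y * (pderiv G * B))) = 0"
      unfolding dG using B(2,3) J.phi_orth[of B n] by (cases "n = 0") auto
    then have "L (G * D B) = 0" using adjoint[of G B] by simp
    moreover have "G * q = Polynomial.smult c G + G * D B" unfolding B(1) by (simp add: algebra_simps)
    ultimately show ?thesis by (simp only: add smult LG)
  qed
  let ?N = "real n + 1"
  let ?r = "?X * J.\<phi> n - Polynomial.smult ?N G"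
  have "degree ?r \<le> n"
    using J.degree_euler(2)[OF degG] by (simp add: dG algebra_simps less_Suc_eq_le)
  then have "L (G * ?r) = 0" by (rule orth)
  moreover have "G * ?r = ?X * (G * J.\<phi> n) - Polynomial.smult ?N (G * G)"
    by (simp only: right_diff_distrib mult_smult_right mult_ac)
  ultimately have eq: "L (?X * (G * J.\<phi> n)) = ?N * L (G * G)" by (simp only: minus smult)
  have ring: "(x * p - Polynomial.smult c g) * (x * p - Polynomial.smult c g) = (x * p) * (x * p)
      - Polynomial.smult c (x * (g * p)) - Polynomial.smult c (x * (g * p)) + Polynomial.smult (c * c) (g * g)"
    for x p g :: "real poly" and c
    by (simp add: algebra_simps)
  have "L (?r * ?r) = L ((?X * J.\<phi> n) * (?X * J.\<phi> n)) - ?N * (?N * L (G * G)) - ?N * (?N * L (G * G)) + ?N * ?N * L (G * G)"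
    by (simp only: ring add minus smult eq)
  then have "0 \<le> L ((?X * J.\<phi> n) * (?X * J.\<phi> n)) - ?N * (?N * L (G * G))"
    using nonneg[of ?r] by simp
  moreover have "J.\<eta> n = L ((?X * J.\<phi> n) * (?X * J.\<phi> n)) + L (?X * (?Y * (J.\<phi> n * J.\<phi> n)))"
    using split_one[of "?X * (J.\<phi> n * J.\<phi> n)"] unfolding J.\<eta>_def by (simp only: mult_ac)
  ultimately have "(real n + 1)\<^sup>2 * L (G * G) \<le> J.\<eta> n"
    using pos[OF J.phi_nonzero[of n]] by (simp add: power2_eq_square)
  then show thesis using that dG degG orth by blast
qed

text \<open>
  Take \<open>f = F - G\<close> with primitives \<open>F\<close> of \<open>\<phi>\<^sub>m\<close> and \<open>G\<close> of \<open>\<phi>\<^sub>m\<^sub>+\<^sub>1\<close>; then \<open>F\<close> is the projection of \<open>f\<close>.  The derivative of \<open>f\<close> has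
  squared norm \<open>\<eta>\<^sub>m - \<eta>\<^sub>m\<^sub>+\<^sub>1\<close>, that of the error \<open>- G\<close> has \<open>\<eta>\<^sub>m\<^sub>+\<^sub>1\<close>, and by \<open>eta_ratio\<close> the former is of the order of
  \<open>\<eta>\<^sub>m\<^sub>+\<^sub>1 / m\<close>.  By \<open>phi_primitive\<close>, \<open>L (f\<^sup>2)\<close> is of the order of \<open>\<eta>\<^sub>m\<^sub>+\<^sub>1 / m\<^sup>2\<close>.
\<close>

lemma projection_energy_blowup:
  obtains C where "C > 0" "\<And>m. \<exists>f F. degree f \<le> m + 2 \<and> degree F \<le> m + 1
      \<and> (\<forall>q. degree q \<le> m + 1 \<longrightarrow> L ((f - F) * q) = 0)
      \<and> L ([:0, 1:] * (pderiv (f - F) * pderiv (f - F))) > 0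
      \<and> (real m + 1) * (L (f * f) + 4 * L ([:0, 1:] * (pderiv f * pderiv f)))
          \<le> C * L ([:0, 1:] * (pderiv (f - F) * pderiv (f - F)))"
proof
  let ?K = "\<kappa> + 1"
  define C where "C = 4 * (1 + a)\<^sup>2 + 4 * (a * (2 + ?K + a))"
  show "C > 0" using a_pos \<kappa>_pos by (auto simp: C_def intro!: add_pos_pos mult_pos_pos)
  fix m
  let ?X = "[:0, 1:] :: real poly"
  obtain F where F: "pderiv F = J.\<phi> m" "degree F \<le> Suc m" "\<And>q. degree q \<le> m \<Longrightarrow> L (F * q) = 0"
    "(real m + 1)\<^sup>2 * L (F * F) \<le> J.\<eta> m"
    using phi_primitive[of m] by blast
  obtain G where G: "pderiv G = J.\<phi> (Suc m)" "degree G \<le> Suc (Suc m)" "\<And>q. degree q \<le> Suc m \<Longrightarrow> L (G * q) = 0"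
    "(real (Suc m) + 1)\<^sup>2 * L (G * G) \<le> J.\<eta> (Suc m)"
    using phi_primitive[of "Suc m"] by blast
  define f where "f = F - G"
  define M where "M = real m + 1"
  have M: "M \<ge> 1" by (simp add: M_def)
  have ep: "J.\<eta> (Suc m) > 0" "J.\<eta> m > 0" using J.eta_pos by auto
  have rat: "J.\<eta> (Suc m) * ((M + a) * (M + \<kappa> + a)) = J.\<eta> m * (M * (M + \<kappa>))"
    using J.eta_ratio[of m] by (simp add: M_def algebra_simps)
  have mono1: "J.\<eta> m \<le> (1 + a)\<^sup>2 * J.\<eta> (Suc m)"
  proof -
    have "(M + a) \<le> (1 + a) * M" "(M + \<kappa> + a) \<le> (1 + a) * (M + \<kappa>)"
      using M a_pos \<kappa>_pos mult_left_mono[of 1 M a] mult_left_mono[of 1 "M + \<kappa>" a] by (auto simp: algebra_simps)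
    then have "(M + a) * (M + \<kappa> + a) \<le> ((1 + a) * M) * ((1 + a) * (M + \<kappa>))"
      using M a_pos \<kappa>_pos by (intro mult_mono) auto
    then have "J.\<eta> m * (M * (M + \<kappa>)) \<le> J.\<eta> (Suc m) * (((1 + a) * M) * ((1 + a) * (M + \<kappa>)))"
      unfolding rat[symmetric] using ep by (intro mult_left_mono) auto
    then have "J.\<eta> m * (M * (M + \<kappa>)) \<le> ((1 + a)\<^sup>2 * J.\<eta> (Suc m)) * (M * (M + \<kappa>))"
      by (simp add: power2_eq_square mult_ac)
    then show ?thesis using M \<kappa>_pos by (simp add: mult_le_cancel_right mult_less_0_iff)
  qed
  have diff: "M * (J.\<eta> m - J.\<eta> (Suc m)) \<le> a * (2 + ?K + a) * J.\<eta> (Suc m)"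
  proof -
    have "(J.\<eta> m - J.\<eta> (Suc m)) * (M * (M + \<kappa>)) = J.\<eta> (Suc m) * (a * (2 * M + \<kappa> + a))"
      using rat by (simp add: algebra_simps)
    also have "\<dots> \<le> J.\<eta> (Suc m) * (a * ((2 + ?K + a) * (M + \<kappa>)))"
    proof -
      have "(2 + ?K + a) * (M + \<kappa>) \<ge> (2 + ?K + a) * M"
        using \<kappa>_pos a_pos by (intro mult_left_mono) auto
      moreover have "(?K + a) * M \<ge> (?K + a) * 1"
        using \<kappa>_pos a_pos M by (intro mult_left_mono) auto
      ultimately have "2 * M + \<kappa> + a \<le> (2 + ?K + a) * (M + \<kappa>)" by (simp add: algebra_simps)
      then show ?thesis using ep a_pos by (intro mult_left_mono) auto
    qed
    finally have "(M * (J.\<eta> m - J.\<eta> (Suc m))) * (M + \<kappa>) \<le> (a * (2 + ?K + a) * J.\<eta> (Suc m)) * (M + \<kappa>)"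
      by (simp add: mult_ac)
    then show ?thesis using M \<kappa>_pos by (simp add: mult_le_cancel_right)
  qed
  have fF: "f - F = - G" by (simp add: f_def)
  have dfF: "pderiv (f - F) * pderiv (f - F) = J.\<phi> (Suc m) * J.\<phi> (Suc m)"
    unfolding fF by (simp add: pderiv_minus G(1))
  have eG: "L (?X * (pderiv (f - F) * pderiv (f - F))) = J.\<eta> (Suc m)"
    unfolding dfF J.\<eta>_def ..
  have two: "Polynomial.smult 2 p = p + p" for p :: "real poly"
    using smult_add_left[of 1 1 p] by (simp only: smult_1_left one_add_one)
  have ring: "x * ((u - v) * (u - v)) = x * (u * u) - Polynomial.smult 2 (x * (v * u)) + x * (v * v)"
    for x u v :: "real poly"
    unfolding two by (simp add: algebra_simps)
  have "pderiv f = J.\<phi> m - J.\<phi> (Suc m)" by (simp add: f_def pderiv_diff F(1) G(1))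
  then have "?X * (pderiv f * pderiv f) = ?X * (J.\<phi> m * J.\<phi> m) - Polynomial.smult 2 (?X * (J.\<phi> (Suc m) * J.\<phi> m))
      + ?X * (J.\<phi> (Suc m) * J.\<phi> (Suc m))"
    by (simp only: ring)
  then have "L (?X * (pderiv f * pderiv f)) = J.\<eta> m - 2 * L (?X * (J.\<phi> (Suc m) * J.\<phi> m)) + J.\<eta> (Suc m)"
    unfolding J.\<eta>_def by (simp only: add minus smult)
  also have "L (?X * (J.\<phi> (Suc m) * J.\<phi> m)) = J.\<eta> (Suc m)"
    using J.phi_reproduces[of "J.\<phi> m" "Suc m"] J.degree_phi[of m] by (simp only: J.phi_one le_SucI mult_1_left)
  finally have df: "L (?X * (pderiv f * pderiv f)) = J.\<eta> m - J.\<eta> (Suc m)" by simp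
  have "f * f + (F + G) * (F + G) = Polynomial.smult 2 (F * F) + Polynomial.smult 2 (G * G)"
    unfolding f_def two by (simp add: algebra_simps)
  then have "L (f * f) + L ((F + G) * (F + G)) = 2 * L (F * F) + 2 * L (G * G)"
    by (metis add smult)
  then have ff: "L (f * f) \<le> 2 * L (F * F) + 2 * L (G * G)" using nonneg[of "F + G"] by linarith
  have FF: "M * L (F * F) \<le> (1 + a)\<^sup>2 * J.\<eta> (Suc m)"
  proof -
    have "M * 1 \<le> M * M" using M by (intro mult_left_mono) auto
    then have "M * L (F * F) \<le> (real m + 1)\<^sup>2 * L (F * F)"
      using nonneg[of F] by (intro mult_right_mono) (auto simp: M_def power2_eq_square)
    then show ?thesis using F(4) mono1 by linarith
  qed
  have GG: "M * L (G * G) \<le> (1 + a)\<^sup>2 * J.\<eta> (Suc m)"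
  proof -
    have "M * 1 \<le> (M + 1) * (M + 1)" using M by (intro mult_mono) auto
    then have "M * L (G * G) \<le> (real (Suc m) + 1)\<^sup>2 * L (G * G)"
      using nonneg[of G] by (intro mult_right_mono) (auto simp: M_def power2_eq_square algebra_simps)
    moreover have "1 * J.\<eta> (Suc m) \<le> (1 + a)\<^sup>2 * J.\<eta> (Suc m)"
      using ep a_pos by (intro mult_right_mono) auto
    ultimately show ?thesis using G(4) by linarith
  qed
  have "M * L (f * f) \<le> M * (2 * L (F * F) + 2 * L (G * G))" using ff M by (intro mult_left_mono) auto
  then have "M * (L (f * f) + 4 * (J.\<eta> m - J.\<eta> (Suc m))) \<le> C * J.\<eta> (Suc m)"
    using FF GG diff by (simp add: C_def algebra_simps)
  then have main: "(real m + 1) * (L (f * f) + 4 * L (?X * (pderiv f * pderiv f))) \<le> C * L (?X * (pderiv (f - F) * pderiv (f - F)))"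
    unfolding eG df by (simp add: M_def)
  have "degree f \<le> m + 2" unfolding f_def using F(2) G(2) by (intro degree_diff_le) auto
  moreover have "L ((f - F) * q) = 0" if "degree q \<le> m + 1" for q
    using G(3)[of q] that minus[of 0 "G * q"] by (simp add: fF)
  ultimately show "\<exists>f F. degree f \<le> m + 2 \<and> degree F \<le> m + 1
      \<and> (\<forall>q. degree q \<le> m + 1 \<longrightarrow> L ((f - F) * q) = 0)
      \<and> L ([:0, 1:] * (pderiv (f - F) * pderiv (f - F))) > 0
      \<and> (real m + 1) * (L (f * f) + 4 * L ([:0, 1:] * (pderiv f * pderiv f)))
          \<le> C * L ([:0, 1:] * (pderiv (f - F) * pderiv (f - F)))"
    using main F(2) ep(1) eG by (intro exI[of _ f] exI[of _ F]) auto
qed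

end

section \<open>Radial functions\<close>

lemma norm_square_derivative:
  "((\<lambda>t. (norm (x + t *\<^sub>R axis j 1))\<^sup>2) has_real_derivative 2 * x $ j) (at 0)"
proof -
  have "(norm (x + t *\<^sub>R axis j 1))\<^sup>2 = (norm x)\<^sup>2 + 2 * t * x $ j + t\<^sup>2" for t
    unfolding power2_norm_eq_inner
    by (simp add: inner_add_left inner_add_right inner_axis inner_axis' power2_eq_square algebra_simps)
  then show ?thesis by (auto intro!: derivative_eq_intros)
qed

lemma radial_partial:
  "((\<lambda>t. poly h ((norm (x + t *\<^sub>R axis j 1))\<^sup>2)) has_real_derivative 2 * x $ j * poly (pderiv h) ((norm x)\<^sup>2)) (at 0)"
proof -
  have "(poly h has_real_derivative poly (pderiv h) ((norm (x + 0 *\<^sub>R axis j 1))\<^sup>2)) (at ((norm (x + 0 *\<^sub>R axis j 1))\<^sup>2))"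
    by (rule poly_DERIV)
  from DERIV_chain2[OF this norm_square_derivative] show ?thesis by (simp add: mult.commute)
qed

lemma radial_poly_le: "degree h \<le> n \<Longrightarrow> (\<lambda>x::real^'n. poly h ((norm x)\<^sup>2)) \<in> poly_le (2 * n)"
proof -
  assume h: "degree h \<le> n"
  have pw: "(\<lambda>x::real^'n. (norm x)\<^sup>2 ^ j) \<in> poly_le (2 * j)" for j
  proof (induction j)
    case 0
    have "monomial (\<lambda>_. 0) = (\<lambda>x :: real^'n. 1)" by (simp add: monomial_def fun_eq_iff)
    moreover have "monomial (\<lambda>_. 0) \<in> (poly_le 0 :: (real^'n \<Rightarrow> real) set)" by (rule monomial_in_poly_le) simp
    ultimately show ?case by simp
  next
    case (Suc j)
    then show ?case using poly_le_norm_square[OF Suc] by simp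
  qed
  have "(\<lambda>x::real^'n. \<Sum>j\<le>degree h. coeff h j * (norm x)\<^sup>2 ^ j) \<in> poly_le (2 * n)"
    using h by (intro poly_le_sum poly_le_scale poly_le_mono[OF _ pw]) auto
  then show ?thesis by (simp only: poly_altdef)
qed

lemma dunkl_radial:
  "dunkl \<gamma> j (\<lambda>x. poly h ((norm x)\<^sup>2)) x = 2 * x $ j * poly (pderiv h) ((norm x)\<^sup>2)"
  by (simp add: dunkl_def partial_deriv_eq[OF radial_partial])

context
  fixes \<alpha> :: real and \<gamma> :: "real^'n"
  assumes \<alpha>: "\<alpha> > -1" and \<gamma>: "\<And>i. \<gamma> $ i > -1"
begin

lemma integrable_cball:
  fixes u :: "real^'n \<Rightarrow> real"
  shows "continuous_on (cball 0 1) u \<Longrightarrow> integrable (ball_measure \<alpha> \<gamma>) u"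
  by (rule integrable_continuous[OF \<alpha> \<gamma>])

text \<open>
  \<open>monomial_moment\<close> for \<open>\<bar>x\<bar>\<^sup>2\<^sup>j x\<^sup>k\<close>, a sum of monomials of the same degree, since \<open>\<bar>x\<bar>\<^sup>2 = \<Sum>\<^sub>i x\<^sub>i\<^sup>2\<close>.
\<close>

lemma radial_moment:
  "(2 * real j + real (total_degree k) + 2 * half_homogeneity \<gamma>) * (\<integral>x. (norm x)\<^sup>2 ^ j * monomial k x * (1 - (norm x)\<^sup>2) \<partial>ball_measure \<alpha> \<gamma>)
    = 2 * (\<alpha> + 1) * (\<integral>x. (norm x)\<^sup>2 ^ Suc j * monomial k x \<partial>ball_measure \<alpha> \<gamma>)"
proof (induction j arbitrary: k)
  case 0
  then show ?case using monomial_moment[OF \<alpha> \<gamma>, of k] by (simp add: mult.commute)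
next
  case (Suc j)
  let ?k = "\<lambda>i. k(i := Suc (Suc (k i)))"
  have up: "(norm x)\<^sup>2 * monomial k x = (\<Sum>i\<in>UNIV. monomial (?k i) x)" for x
  proof -
    have "(x $ i)\<^sup>2 * monomial k x = monomial (?k i) x" for i
      using monomial_coordinate[of x i k] monomial_coordinate[of x i "k(i := Suc (k i))"]
      by (simp add: power2_eq_square mult.assoc)
    then show ?thesis by (simp add: norm_square_sum sum_distrib_right)
  qed
  have deg: "total_degree (?k i) = total_degree k + 2" for i
    using total_degree_fun_upd[of k i "Suc (Suc (k i))"] by simp
  have "(norm x)\<^sup>2 ^ Suc j * monomial k x * (1 - (norm x)\<^sup>2) = (\<Sum>i\<in>UNIV. (norm x)\<^sup>2 ^ j * monomial (?k i) x * (1 - (norm x)\<^sup>2))" for x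
  proof -
    have "(norm x)\<^sup>2 ^ Suc j * monomial k x * (1 - (norm x)\<^sup>2) = (norm x)\<^sup>2 ^ j * ((norm x)\<^sup>2 * monomial k x) * (1 - (norm x)\<^sup>2)"
      by (simp add: mult_ac)
    then show ?thesis unfolding up by (simp only: sum_distrib_left sum_distrib_right)
  qed
  then have l: "(\<integral>x. (norm x)\<^sup>2 ^ Suc j * monomial k x * (1 - (norm x)\<^sup>2) \<partial>ball_measure \<alpha> \<gamma>)
      = (\<Sum>i\<in>UNIV. \<integral>x. (norm x)\<^sup>2 ^ j * monomial (?k i) x * (1 - (norm x)\<^sup>2) \<partial>ball_measure \<alpha> \<gamma>)"
    by (simp only:) (rule Bochner_Integration.integral_sum, intro integrable_cball continuous_intros)
  have "(norm x)\<^sup>2 ^ Suc (Suc j) * monomial k x = (\<Sum>i\<in>UNIV. (norm x)\<^sup>2 ^ Suc j * monomial (?k i) x)" for x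
  proof -
    have "(norm x)\<^sup>2 ^ Suc (Suc j) * monomial k x = (norm x)\<^sup>2 ^ Suc j * ((norm x)\<^sup>2 * monomial k x)"
      by (simp add: mult_ac)
    then show ?thesis unfolding up by (simp only: sum_distrib_left)
  qed
  then have r: "(\<integral>x. (norm x)\<^sup>2 ^ Suc (Suc j) * monomial k x \<partial>ball_measure \<alpha> \<gamma>)
      = (\<Sum>i\<in>UNIV. \<integral>x. (norm x)\<^sup>2 ^ Suc j * monomial (?k i) x \<partial>ball_measure \<alpha> \<gamma>)"
    by (simp only:) (rule Bochner_Integration.integral_sum, intro integrable_cball continuous_intros)
  have shift: "(2 * real j + real (total_degree (?k i)) + 2 * half_homogeneity \<gamma>) = (2 * real (Suc j) + real (total_degree k) + 2 * half_homogeneity \<gamma>)" for i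
    by (simp only: deg) simp
  show ?case
    unfolding l r sum_distrib_left
  proof (intro sum.cong refl)
    fix i
    show "(2 * real (Suc j) + real (total_degree k) + 2 * half_homogeneity \<gamma>)
        * (\<integral>x. (norm x)\<^sup>2 ^ j * monomial (?k i) x * (1 - (norm x)\<^sup>2) \<partial>ball_measure \<alpha> \<gamma>)
      = 2 * (\<alpha> + 1) * (\<integral>x. (norm x)\<^sup>2 ^ Suc j * monomial (?k i) x \<partial>ball_measure \<alpha> \<gamma>)"
      unfolding shift[of i, symmetric] by (rule Suc)
  qed
qed

definition radial_integral :: "real poly \<Rightarrow> real" where
  "radial_integral h = (\<integral>x. poly h ((norm x)\<^sup>2) \<partial>ball_measure \<alpha> \<gamma>)"

lemma radial_integral_add: "radial_integral (p + q) = radial_integral p + radial_integral q"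
  unfolding radial_integral_def poly_add
  by (rule Bochner_Integration.integral_add) (intro integrable_cball continuous_intros)+

lemma radial_integral_smult: "radial_integral (Polynomial.smult c p) = c * radial_integral p"
  unfolding radial_integral_def by simp

lemma radial_integral_pos:
  assumes "h \<noteq> 0"
  shows "radial_integral ([:0, 1:] * ([:1, -1:] * (h * h))) > 0"
proof -
  let ?\<mu> = "ball_measure \<alpha> \<gamma>"
  let ?u = "\<lambda>x::real^'n. poly h ((norm x)\<^sup>2)"
  let ?g = "\<lambda>x::real^'n. (norm x)\<^sup>2 * ((1 - (norm x)\<^sup>2) * (?u x * ?u x))"
  have eq: "radial_integral ([:0, 1:] * ([:1, -1:] * (h * h))) = integral\<^sup>L ?\<mu> ?g"
    unfolding radial_integral_def by (intro Bochner_Integration.integral_cong refl) (simp add: algebra_simps)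
  have int: "integrable ?\<mu> ?g" by (intro integrable_cball continuous_intros)
  have nn: "AE x in ?\<mu>. 0 \<le> ?g x"
    using AE_space
  proof eventually_elim
    case (elim x)
    then have "1 - (norm x)\<^sup>2 \<ge> 0" using abs_square_less_1[of "norm x"] by simp
    then show ?case by simp
  qed
  have "integral\<^sup>L ?\<mu> ?g \<noteq> 0"
  proof
    assume "integral\<^sup>L ?\<mu> ?g = 0"
    then have "AE x in ?\<mu>. ?g x = 0" using integral_nonneg_eq_0_iff_AE[OF int nn] by simp
    then have AE: "AE x in ?\<mu>. ?u x * ?u x = 0"
      using AE_ball_measure_coordinate[of undefined \<alpha> \<gamma>] AE_space
    proof eventually_elim
      case (elim x)
      then have "1 - (norm x)\<^sup>2 > 0" using abs_square_less_1[of "norm x"] by simp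
      moreover have "x \<noteq> 0" using elim(2) by auto
      ultimately show ?case using elim(1) by simp
    qed
    have up: "?u \<in> poly_le (2 * degree h)" by (rule radial_poly_le) simp
    note uL = C1_ball_L2(1)[OF \<alpha> \<gamma> poly_le_C1_ball[OF up]]
    have "L2_inner \<alpha> \<gamma> ?u ?u = 0"
      unfolding L2_inner_eq[OF L2_ball_measurable[OF uL] L2_ball_measurable[OF uL]]
      by (rule integral_eq_zero_AE[OF AE])
    then have "?u = (\<lambda>x. 0)" by (intro poly_le_definite[OF \<alpha> \<gamma> up]) (simp add: L2_norm_def)
    then have z: "poly h ((norm x)\<^sup>2) = 0" for x :: "real^'n" by (rule fun_cong)
    have "{0..} \<subseteq> {t. poly h t = 0}"
    proof
      fix t :: real assume "t \<in> {0..}"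
      then have "(norm (sqrt t *\<^sub>R axis undefined 1 :: real^'n))\<^sup>2 = t" by simp
      with z[of "sqrt t *\<^sub>R axis undefined 1"] show "t \<in> {t. poly h t = 0}" by simp
    qed
    then show False
      using poly_roots_finite[OF assms] infinite_Ici[of "0::real"] finite_subset by blast
  qed
  then show ?thesis
    unfolding eq using integral_nonneg_AE[OF nn] by linarith
qed

lemma radial_integral_by_parts:
  "radial_integral ([:1, -1:] * ([:0, 1:] * pderiv h + Polynomial.smult (half_homogeneity \<gamma>) h)) = (\<alpha> + 1) * radial_integral ([:0, 1:] * h)"
proof -
  let ?Y = "[:1, -1:] :: real poly" and ?X = "[:0, 1:] :: real poly"
  let ?A = "\<lambda>h. radial_integral (?Y * (?X * pderiv h + Polynomial.smult (half_homogeneity \<gamma>) h)) - (\<alpha> + 1) * radial_integral (?X * h)"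
  have one: "monomial (\<lambda>_. 0) x = 1" for x :: "real^'n" by (simp add: monomial_def)
  have mono: "?A (monom c j) = 0" for c j
  proof -
    have p: "poly (?Y * (?X * pderiv (monom c j) + Polynomial.smult (half_homogeneity \<gamma>) (monom c j))) t
        = c * (real j + half_homogeneity \<gamma>) * (t ^ j * 1 * (1 - t))" for t
      by (cases j) (simp_all add: pderiv_monom poly_monom algebra_simps)
    have "radial_integral (?Y * (?X * pderiv (monom c j) + Polynomial.smult (half_homogeneity \<gamma>) (monom c j)))
        = c * (real j + half_homogeneity \<gamma>) * (\<integral>x. (norm x)\<^sup>2 ^ j * monomial (\<lambda>_. 0) x * (1 - (norm x)\<^sup>2) \<partial>ball_measure \<alpha> \<gamma>)"
      unfolding radial_integral_def p one by (rule integral_mult_right_zero)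
    moreover have q: "poly (?X * monom c j) t = c * (t ^ Suc j * 1)" for t
      by (simp add: poly_monom)
    have "radial_integral (?X * monom c j) = c * (\<integral>x. (norm x)\<^sup>2 ^ Suc j * monomial (\<lambda>_. 0) x \<partial>ball_measure \<alpha> \<gamma>)"
      unfolding radial_integral_def q one by (rule integral_mult_right_zero)
    moreover have "(real j + half_homogeneity \<gamma>) * (\<integral>x. (norm x)\<^sup>2 ^ j * monomial (\<lambda>_. 0) x * (1 - (norm x)\<^sup>2) \<partial>ball_measure \<alpha> \<gamma>)
        = (\<alpha> + 1) * (\<integral>x. (norm x)\<^sup>2 ^ Suc j * monomial (\<lambda>_. 0) x \<partial>ball_measure \<alpha> \<gamma>)"
      using radial_moment[of j "\<lambda>_. 0"] by (simp add: algebra_simps)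
    ultimately show ?thesis by (simp only: mult.assoc mult.left_commute[of "\<alpha> + 1" c])
  qed
  have add: "?A (p + q) = ?A p + ?A q" for p q
  proof -
    have "?Y * (?X * pderiv (p + q) + Polynomial.smult (half_homogeneity \<gamma>) (p + q)) =
        ?Y * (?X * pderiv p + Polynomial.smult (half_homogeneity \<gamma>) p) + ?Y * (?X * pderiv q + Polynomial.smult (half_homogeneity \<gamma>) q)"
      by (simp only: pderiv_add smult_add_right distrib_left add_ac)
    then show ?thesis by (simp only: distrib_left radial_integral_add)
  qed
  have zero: "?A 0 = 0" by (simp add: radial_integral_def)
  have "?A (\<Sum>i\<in>I. monom (coeff h i) i) = 0" for I
    by (induction I rule: infinite_finite_induct) (simp_all only: sum.infinite sum.empty sum.insert zero add mono add_0_left simp_thms)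
  from this[of "{..degree h}"] show ?thesis by (simp only: poly_as_sum_of_monoms)
qed

interpretation R: radial_functional radial_integral "half_homogeneity \<gamma>" "\<alpha> + 1"
proof
  show "half_homogeneity \<gamma> > 0" by (rule half_homogeneity_pos[OF \<gamma>])
  show "\<alpha> + 1 > 0" using \<alpha> by simp
  show "radial_integral (p * p) \<ge> 0" for p by (simp add: radial_integral_def)
qed (rule radial_integral_add radial_integral_smult radial_integral_pos radial_integral_by_parts; assumption?)+

text \<open>
  For a monomial \<open>x\<^sup>k\<close> of even degree \<open>2 l\<close>, \<open>radial_moment\<close> shows that the integrals of \<open>\<bar>x\<bar>\<^sup>2\<^sup>j x\<^sup>k\<close> and \<open>\<bar>x\<bar>\<^sup>2\<^sup>j \<bar>x\<bar>\<^sup>2\<^sup>l\<close> satisfy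
  the same recursion in \<open>j\<close>, so they differ by a factor independent of \<open>j\<close>, and \<open>x\<^sup>k\<close> may be replaced by \<open>t\<^sup>l\<close>.  If the
  degree is odd, then some exponent is odd, and the reflection in that coordinate shows that the integral is 0.
\<close>

lemma radial_orthogonal:
  assumes g: "\<And>q. degree q \<le> m \<Longrightarrow> radial_integral (g * q) = 0" and q: "q \<in> poly_le (2 * m)"
  shows "L2_inner \<alpha> \<gamma> (\<lambda>x. poly g ((norm x)\<^sup>2)) q = 0"
proof -
  let ?\<mu> = "ball_measure \<alpha> \<gamma>"
  let ?g = "\<lambda>x::real^'n. poly g ((norm x)\<^sup>2)"
  define E where "E = (\<lambda>k j. \<integral>x. (norm x)\<^sup>2 ^ j * monomial k x \<partial>?\<mu>)"
  let ?o = "(\<lambda>_. 0) :: 'n \<Rightarrow> nat"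
  have one: "monomial ?o x = 1" for x :: "real^'n" by (simp add: monomial_def)
  let ?\<rho> = "\<lambda>s. (s + half_homogeneity \<gamma>) / (s + half_homogeneity \<gamma> + \<alpha> + 1)"
  have h: "half_homogeneity \<gamma> > 0" by (rule half_homogeneity_pos[OF \<gamma>])
  have rec: "E k (Suc j) = ?\<rho> (real j + real (total_degree k) / 2) * E k j" for k j
  proof -
    have "(\<integral>x. (norm x)\<^sup>2 ^ j * monomial k x * (1 - (norm x)\<^sup>2) \<partial>?\<mu>) = (\<integral>x. (norm x)\<^sup>2 ^ j * monomial k x - (norm x)\<^sup>2 ^ Suc j * monomial k x \<partial>?\<mu>)"
      by (intro Bochner_Integration.integral_cong refl) (simp add: algebra_simps)
    also have "\<dots> = E k j - E k (Suc j)"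
      unfolding E_def by (rule Bochner_Integration.integral_diff) (intro integrable_cball continuous_intros)+
    finally have "(2 * real j + real (total_degree k) + 2 * half_homogeneity \<gamma>) * (E k j - E k (Suc j)) = 2 * (\<alpha> + 1) * E k (Suc j)"
      using radial_moment[of j k] by (simp only: E_def)
    then have "E k (Suc j) * (real j + real (total_degree k) / 2 + half_homogeneity \<gamma> + \<alpha> + 1) = (real j + real (total_degree k) / 2 + half_homogeneity \<gamma>) * E k j"
      by (simp add: algebra_simps)
    moreover have "real j + real (total_degree k) / 2 + half_homogeneity \<gamma> + \<alpha> + 1 > 0"
    proof -
      have "real (total_degree k) / 2 \<ge> 0" by (rule divide_nonneg_nonneg) (rule of_nat_0_le_iff, simp)
      then show ?thesis using h \<alpha> by linarith
    qed
    ultimately show ?thesis by (simp add: field_simps)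
  qed
  have rec0: "E ?o (Suc j) = ?\<rho> (real j) * E ?o j" for j using rec[of ?o j] by simp
  have E0: "E ?o j > 0" for j
  proof (induction j)
    case 0
    have "E ?o 0 = radial_integral 1" by (simp add: E_def radial_integral_def one)
    then show ?case using R.L_one_pos by simp
  next
    case (Suc j)
    have "?\<rho> (real j) > 0" using h \<alpha> by (intro divide_pos_pos) auto
    then show ?case using Suc unfolding rec0 by (rule mult_pos_pos)
  qed
  have Eint: "integrable ?\<mu> (\<lambda>x. (norm x)\<^sup>2 ^ j * monomial k x)" for j k
    by (intro integrable_cball continuous_intros)
  have gint: "integrable ?\<mu> (\<lambda>x. ?g x * monomial k x)" for k by (intro integrable_cball continuous_intros)
  have mono: "(\<integral>x. ?g x * monomial k x \<partial>?\<mu>) = 0" if k: "total_degree k \<le> 2 * m" for k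
  proof (cases "even (total_degree k)")
    case False
    have "\<exists>i. odd (k i)"
    proof (rule ccontr)
      assume "\<nexists>i. odd (k i)"
      then have "even (total_degree k)" by (intro dvd_sum) auto
      then show False using False by simp
    qed
    then obtain i where i: "odd (k i)" by blast
    have refl: "monomial k (coord_refl i x) = - monomial k x" for x
    proof -
      have "(\<Prod>l\<in>UNIV - {i}. (coord_refl i x $ l) ^ k l) = (\<Prod>l\<in>UNIV - {i}. (x $ l) ^ k l)"
        by (intro prod.cong) (auto simp: coord_refl_nth)
      then show ?thesis using i by (simp add: monomial_split[of k _ i] coord_refl_nth power_minus_odd)
    qed
    have "(\<integral>x. ?g (coord_refl i x) * monomial k (coord_refl i x) \<partial>?\<mu>) = (\<integral>x. ?g x * monomial k x \<partial>?\<mu>)"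
      using integral_coord_refl(2)[OF borel_measurable_integrable[OF gint]] .
    then show ?thesis by (simp add: refl)
  next
    case True
    then obtain l where l: "total_degree k = 2 * l" by (rule evenE)
    have cross: "E k j * E ?o l = E k 0 * E ?o (l + j)" for j
    proof (induction j)
      case (Suc j)
      have r1: "E k (Suc j) = ?\<rho> (real (l + j)) * E k j" using rec[of k j] by (simp add: l add.commute)
      have r2: "E ?o (l + Suc j) = ?\<rho> (real (l + j)) * E ?o (l + j)" using rec0[of "l + j"] by simp
      have "E k (Suc j) * E ?o l = ?\<rho> (real (l + j)) * (E k j * E ?o l)" unfolding r1 by (simp only: mult.assoc)
      also have "\<dots> = E k 0 * E ?o (l + Suc j)" unfolding Suc r2 by (simp only: mult_ac)
      finally show ?case .
    qed simp
    have gk: "(\<integral>x. ?g x * monomial k x \<partial>?\<mu>) = (\<Sum>j\<le>degree g. coeff g j * E k j)"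
    proof -
      have "(\<integral>x. ?g x * monomial k x \<partial>?\<mu>) = (\<integral>x. (\<Sum>j\<le>degree g. coeff g j * ((norm x)\<^sup>2 ^ j * monomial k x)) \<partial>?\<mu>)"
        by (intro Bochner_Integration.integral_cong refl) (simp add: poly_altdef sum_distrib_left sum_distrib_right mult_ac)
      also have "\<dots> = (\<Sum>j\<le>degree g. coeff g j * E k j)"
        unfolding E_def by (subst Bochner_Integration.integral_sum) (simp_all add: Eint)
      finally show ?thesis .
    qed
    have "radial_integral (g * monom 1 l) = (\<Sum>j\<le>degree g. coeff g j * E ?o (l + j))"
    proof -
      have "radial_integral (g * monom 1 l) = (\<integral>x. (\<Sum>j\<le>degree g. coeff g j * ((norm x)\<^sup>2 ^ (l + j) * monomial ?o x)) \<partial>?\<mu>)"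
        unfolding radial_integral_def one
        by (intro Bochner_Integration.integral_cong refl)
           (simp add: poly_altdef[of g] poly_monom sum_distrib_left sum_distrib_right power_add mult_ac)
      also have "\<dots> = (\<Sum>j\<le>degree g. coeff g j * E ?o (l + j))"
        unfolding E_def by (subst Bochner_Integration.integral_sum) (simp_all add: Eint)
      finally show ?thesis .
    qed
    moreover have "radial_integral (g * monom 1 l) = 0"
      using k l by (intro g) (auto intro: order_trans[OF degree_monom_le])
    ultimately have z: "(\<Sum>j\<le>degree g. coeff g j * E ?o (l + j)) = 0" by simp
    have "(\<integral>x. ?g x * monomial k x \<partial>?\<mu>) * E ?o l = (\<Sum>j\<le>degree g. coeff g j * (E k j * E ?o l))"
      unfolding gk sum_distrib_right by (simp only: mult.assoc)
    also have "\<dots> = E k 0 * (\<Sum>j\<le>degree g. coeff g j * E ?o (l + j))"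
      unfolding cross sum_distrib_left by (simp only: mult.left_commute)
    finally have "(\<integral>x. ?g x * monomial k x \<partial>?\<mu>) * E ?o l = 0" unfolding z by simp
    then show ?thesis using E0[of l] by simp
  qed
  obtain c where c: "q = (\<lambda>x. \<Sum>k | total_degree k \<le> 2 * m. c k * monomial k x)" using q poly_le_iff_monomial_sum by blast
  have gm: "?g \<in> borel_measurable ?\<mu>" by (intro borel_measurable_ball_continuous continuous_intros)
  have qm: "q \<in> borel_measurable ?\<mu>" by (intro borel_measurable_ball_continuous continuous_on_poly_le[OF q])
  have "L2_inner \<alpha> \<gamma> ?g q = (\<integral>x. (\<Sum>k | total_degree k \<le> 2 * m. c k * (?g x * monomial k x)) \<partial>?\<mu>)"
    unfolding L2_inner_eq[OF gm qm]
    by (intro Bochner_Integration.integral_cong refl) (simp add: c sum_distrib_left mult_ac)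
  also have "\<dots> = (\<Sum>k | total_degree k \<le> 2 * m. c k * (\<integral>x. ?g x * monomial k x \<partial>?\<mu>))"
    by (subst Bochner_Integration.integral_sum) (simp_all add: gint)
  also have "\<dots> = 0" by (intro sum.neutral) (simp add: mono)
  finally show ?thesis .
qed

lemma C1_norm_radial:
  "(C1_norm \<alpha> \<gamma> (\<lambda>x. poly f ((norm x)\<^sup>2)))\<^sup>2 = radial_integral (f * f) + 4 * radial_integral ([:0, 1:] * (pderiv f * pderiv f))"
proof -
  let ?\<mu> = "ball_measure \<alpha> \<gamma>"
  let ?u = "\<lambda>x::real^'n. poly f ((norm x)\<^sup>2)" and ?d = "\<lambda>x::real^'n. poly (pderiv f) ((norm x)\<^sup>2)"
  have 1: "(L2_norm \<alpha> \<gamma> ?u)\<^sup>2 = radial_integral (f * f)"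
  proof -
    have m: "?u \<in> borel_measurable ?\<mu>" by (intro borel_measurable_ball_continuous continuous_intros)
    show ?thesis unfolding L2_norm_square L2_inner_eq[OF m m] by (simp add: radial_integral_def)
  qed
  have 2: "(L2_norm \<alpha> \<gamma> (dunkl \<gamma> j ?u))\<^sup>2 = 4 * (\<integral>x. (x $ j)\<^sup>2 * (?d x * ?d x) \<partial>?\<mu>)" for j
  proof -
    have eq: "dunkl \<gamma> j ?u = (\<lambda>x. 2 * x $ j * ?d x)" by (rule ext) (rule dunkl_radial)
    have m: "(\<lambda>x. 2 * x $ j * ?d x) \<in> borel_measurable ?\<mu>" by (intro borel_measurable_ball_continuous continuous_intros)
    have sq: "(2 * x $ j * ?d x) * (2 * x $ j * ?d x) = 4 * ((x $ j)\<^sup>2 * (?d x * ?d x))" for x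
      by (simp add: power2_eq_square)
    show ?thesis unfolding L2_norm_square eq L2_inner_eq[OF m m] sq by (rule integral_mult_right_zero)
  qed
  have "(\<Sum>j\<in>UNIV. \<integral>x. (x $ j)\<^sup>2 * (?d x * ?d x) \<partial>?\<mu>) = (\<integral>x. (\<Sum>j\<in>UNIV. (x $ j)\<^sup>2 * (?d x * ?d x)) \<partial>?\<mu>)"
    by (rule Bochner_Integration.integral_sum[symmetric]) (intro integrable_cball continuous_intros)
  also have "\<dots> = radial_integral ([:0, 1:] * (pderiv f * pderiv f))"
    unfolding sum_distrib_right[symmetric] norm_square_sum[symmetric] by (simp add: radial_integral_def)
  finally have 3: "(\<Sum>j\<in>UNIV. \<integral>x. (x $ j)\<^sup>2 * (?d x * ?d x) \<partial>?\<mu>) = radial_integral ([:0, 1:] * (pderiv f * pderiv f))" .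
  have "0 \<le> (L2_norm \<alpha> \<gamma> ?u)\<^sup>2 + (\<Sum>j\<in>UNIV. (L2_norm \<alpha> \<gamma> (dunkl \<gamma> j ?u))\<^sup>2)"
    by (intro add_nonneg_nonneg sum_nonneg) auto
  then have "(C1_norm \<alpha> \<gamma> ?u)\<^sup>2 = (L2_norm \<alpha> \<gamma> ?u)\<^sup>2 + (\<Sum>j\<in>UNIV. (L2_norm \<alpha> \<gamma> (dunkl \<gamma> j ?u))\<^sup>2)"
    unfolding C1_norm_def by (rule real_sqrt_pow2)
  also have "\<dots> = radial_integral (f * f) + 4 * (\<Sum>j\<in>UNIV. \<integral>x. (x $ j)\<^sup>2 * (?d x * ?d x) \<partial>?\<mu>)"
    unfolding 1 2 sum_distrib_left ..
  finally show ?thesis unfolding 3 .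
qed

lemma H1_projection_error_C1:
  assumes u: "u \<in> C1_ball"
  shows "H1_norm \<alpha> \<gamma> (H1_of_C1 \<alpha> \<gamma> u) = C1_norm \<alpha> \<gamma> u"
    and "H1_norm \<alpha> \<gamma> (H1_diff \<alpha> \<gamma> (H1_of_C1 \<alpha> \<gamma> u) (H1_proj \<alpha> \<gamma> N (H1_of_C1 \<alpha> \<gamma> u)))
      = C1_norm \<alpha> \<gamma> (\<lambda>x. u x - poly_proj \<alpha> \<gamma> N u x)"
    and "H1_of_C1 \<alpha> \<gamma> u \<in> H1_ball \<alpha> \<gamma>"
proof -
  note U = C1_Cauchy_const[OF \<alpha> \<gamma> u]
  note uL = C1_ball_L2(1)[OF \<alpha> \<gamma> u]
  show "H1_norm \<alpha> \<gamma> (H1_of_C1 \<alpha> \<gamma> u) = C1_norm \<alpha> \<gamma> u"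
    unfolding H1_of_C1_def by (rule LIMSEQ_unique[OF H1_class_norm_limit[OF \<alpha> \<gamma> U] tendsto_const])
  show "H1_of_C1 \<alpha> \<gamma> u \<in> H1_ball \<alpha> \<gamma>"
    unfolding H1_of_C1_def H1_ball_def by (rule quotientI[OF U])
  define v where "v = H1_to_L2 \<alpha> \<gamma> (H1_of_C1 \<alpha> \<gamma> u)"
  note v = H1_to_L2[OF \<alpha> \<gamma> U, folded H1_of_C1_def, folded v_def]
  have "L2_norm \<alpha> \<gamma> (\<lambda>x. u x - v x) = 0" by (rule LIMSEQ_unique[OF tendsto_const v(2)])
  note uv = this
  have proj: "poly_proj \<alpha> \<gamma> N v = poly_proj \<alpha> \<gamma> N u"
  proof (rule poly_proj_unique[OF \<alpha> \<gamma> v(1) poly_proj_in[OF \<alpha> \<gamma> uL]])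
    fix q :: "real^'n \<Rightarrow> real" assume q: "q \<in> poly_le N"
    let ?p = "poly_proj \<alpha> \<gamma> N u"
    note qL = C1_ball_L2(1)[OF \<alpha> \<gamma> poly_le_C1_ball[OF q]]
    note pL = C1_ball_L2(1)[OF \<alpha> \<gamma> poly_le_C1_ball[OF poly_proj_in[OF \<alpha> \<gamma> uL, of N]]]
    have z: "L2_inner \<alpha> \<gamma> (\<lambda>x. u x - v x) q = 0"
      using L2_cauchy_schwarz[OF L2_ball_diff[OF uL v(1)] qL] uv by simp
    have eq: "(\<lambda>x. v x - ?p x) = (\<lambda>x. (u x - ?p x) - (u x - v x))" by simp
    show "L2_inner \<alpha> \<gamma> (\<lambda>x. v x - ?p x) q = 0"
      unfolding eq L2_inner_diff[OF L2_ball_diff[OF uL pL] L2_ball_diff[OF uL v(1)] qL]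
      using z poly_proj_orth[OF \<alpha> \<gamma> uL q] by simp
  qed
  have p: "poly_proj \<alpha> \<gamma> N u \<in> C1_ball" by (rule poly_le_C1_ball[OF poly_proj_in[OF \<alpha> \<gamma> uL]])
  have "H1_norm \<alpha> \<gamma> (H1_diff \<alpha> \<gamma> (H1_of_C1 \<alpha> \<gamma> u) (H1_of_C1 \<alpha> \<gamma> (poly_proj \<alpha> \<gamma> N u))) = C1_norm \<alpha> \<gamma> (\<lambda>x. u x - poly_proj \<alpha> \<gamma> N u x)"
    by (rule LIMSEQ_unique[OF H1_diff_norm_limit[OF \<alpha> \<gamma> U p, folded H1_of_C1_def] tendsto_const])
  then show "H1_norm \<alpha> \<gamma> (H1_diff \<alpha> \<gamma> (H1_of_C1 \<alpha> \<gamma> u) (H1_proj \<alpha> \<gamma> N (H1_of_C1 \<alpha> \<gamma> u))) = C1_norm \<alpha> \<gamma> (\<lambda>x. u x - poly_proj \<alpha> \<gamma> N u x)"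
    unfolding H1_proj_def v_def[symmetric] proj .
qed

section \<open>Sharpness of the exponent\<close>

theorem large_projection_error:
  obtains c where "c > 0" "\<And>m. \<exists>u\<in>C1_ball. C1_norm \<alpha> \<gamma> u > 0 \<and>
    c * (real m + 1) * (C1_norm \<alpha> \<gamma> u)\<^sup>2 \<le> (C1_norm \<alpha> \<gamma> (\<lambda>x. u x - poly_proj \<alpha> \<gamma> (2 * (m + 1)) u x))\<^sup>2"
proof -
  obtain C where C: "C > 0" "\<And>m. \<exists>f F. degree f \<le> m + 2 \<and> degree F \<le> m + 1
      \<and> (\<forall>q. degree q \<le> m + 1 \<longrightarrow> radial_integral ((f - F) * q) = 0)
      \<and> radial_integral ([:0, 1:] * (pderiv (f - F) * pderiv (f - F))) > 0
      \<and> (real m + 1) * (radial_integral (f * f) + 4 * radial_integral ([:0, 1:] * (pderiv f * pderiv f)))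
          \<le> C * radial_integral ([:0, 1:] * (pderiv (f - F) * pderiv (f - F)))"
    using R.projection_energy_blowup by metis
  have "\<exists>u\<in>C1_ball. C1_norm \<alpha> \<gamma> u > 0 \<and>
    4 / C * (real m + 1) * (C1_norm \<alpha> \<gamma> u)\<^sup>2 \<le> (C1_norm \<alpha> \<gamma> (\<lambda>x. u x - poly_proj \<alpha> \<gamma> (2 * (m + 1)) u x))\<^sup>2" for m
  proof -
    obtain f F where fF: "degree f \<le> m + 2" "degree F \<le> m + 1"
      "\<And>q. degree q \<le> m + 1 \<Longrightarrow> radial_integral ((f - F) * q) = 0"
      "radial_integral ([:0, 1:] * (pderiv (f - F) * pderiv (f - F))) > 0"
      "(real m + 1) * (radial_integral (f * f) + 4 * radial_integral ([:0, 1:] * (pderiv f * pderiv f)))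
          \<le> C * radial_integral ([:0, 1:] * (pderiv (f - F) * pderiv (f - F)))"
      using C(2)[of m] by (elim exE conjE) simp
    let ?u = "\<lambda>x::real^'n. poly f ((norm x)\<^sup>2)"
    let ?e = "radial_integral ([:0, 1:] * (pderiv (f - F) * pderiv (f - F)))"
    have u: "?u \<in> C1_ball" by (rule poly_le_C1_ball[OF radial_poly_le[OF fF(1)]])
    note uL = C1_ball_L2(1)[OF \<alpha> \<gamma> u]
    have proj: "poly_proj \<alpha> \<gamma> (2 * (m + 1)) ?u = (\<lambda>x. poly F ((norm x)\<^sup>2))"
    proof (rule poly_proj_unique[OF \<alpha> \<gamma> uL radial_poly_le[OF fF(2)]])
      fix q :: "real^'n \<Rightarrow> real" assume "q \<in> poly_le (2 * (m + 1))"
      from radial_orthogonal[OF fF(3) this]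
      show "L2_inner \<alpha> \<gamma> (\<lambda>x. poly f ((norm x)\<^sup>2) - poly F ((norm x)\<^sup>2)) q = 0" by simp
    qed
    have err: "(C1_norm \<alpha> \<gamma> (\<lambda>x. ?u x - poly_proj \<alpha> \<gamma> (2 * (m + 1)) ?u x))\<^sup>2 \<ge> 4 * ?e"
      unfolding proj using C1_norm_radial[of "f - F"] R.nonneg[of "f - F"] by simp
    have pos: "C1_norm \<alpha> \<gamma> ?u > 0"
    proof (rule ccontr)
      assume "\<not> C1_norm \<alpha> \<gamma> ?u > 0"
      then have z: "C1_norm \<alpha> \<gamma> ?u = 0" using C1_norm_nonneg[of \<alpha> \<gamma> ?u] by linarith
      then have "L2_norm \<alpha> \<gamma> ?u = 0" using L2_norm_le_C1_norm[of \<alpha> \<gamma> ?u] L2_norm_nonneg[of \<alpha> \<gamma> ?u] by linarith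
      then have u0: "?u = (\<lambda>x. 0)" by (rule poly_le_definite[OF \<alpha> \<gamma> radial_poly_le[OF fF(1)]])
      have "poly_proj \<alpha> \<gamma> (2 * (m + 1)) ?u = (\<lambda>x. 0)"
        by (rule poly_proj_unique[OF \<alpha> \<gamma> uL poly_le_zero]) (simp add: u0[THEN fun_cong] L2_inner_def)
      then have "(C1_norm \<alpha> \<gamma> (\<lambda>x. ?u x - poly_proj \<alpha> \<gamma> (2 * (m + 1)) ?u x))\<^sup>2 = 0" using z by simp
      then show False using err fF(4) by linarith
    qed
    have "(real m + 1) * (C1_norm \<alpha> \<gamma> ?u)\<^sup>2 \<le> C * ?e" using fF(5) unfolding C1_norm_radial .
    then have "4 / C * (real m + 1) * (C1_norm \<alpha> \<gamma> ?u)\<^sup>2 \<le> 4 * ?e"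
      using C(1) by (simp add: field_simps)
    then show ?thesis using u pos err by (intro bexI[of _ ?u] conjI) auto
  qed
  moreover have "4 / C > 0" using C(1) by simp
  ultimately show thesis using that by blast
qed

end

text \<open>
  For the negative part, a bound with exponent \<open>s\<close> for the functions of \<open>large_projection_error\<close> with \<open>N = 2 (m + 1)\<close> makes
  \<open>N powr (1 - 2 * s)\<close> bounded, which is absurd for \<open>s < 1/2\<close>.
\<close>

theorem theorem5p4:
  fixes \<alpha> :: real and \<gamma> :: "real^'n"
  assumes "\<alpha> > -1" and "\<forall>i. \<gamma> $ i > -1"
  shows "(\<exists>C>0. \<forall>u\<in>H1_ball \<alpha> \<gamma>. \<forall>N\<ge>1.
            H1_norm \<alpha> \<gamma> (H1_diff \<alpha> \<gamma> u (H1_proj \<alpha> \<gamma> N u))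
              \<le> C * real N powr (1/2) * H1_norm \<alpha> \<gamma> u) \<and>
         (\<forall>s::real. s < 1/2 \<longrightarrow>
            \<not> (\<exists>C>0. \<forall>u\<in>H1_ball \<alpha> \<gamma>. \<forall>N\<ge>1.
                 H1_norm \<alpha> \<gamma> (H1_diff \<alpha> \<gamma> u (H1_proj \<alpha> \<gamma> N u))
                   \<le> C * real N powr s * H1_norm \<alpha> \<gamma> u))"
proof (intro conjI allI impI notI)
  note \<alpha> = assms(1) and \<gamma> = spec[OF assms(2)]
  obtain C where "C > 0" "\<And>X N. X \<in> H1_ball \<alpha> \<gamma> \<Longrightarrow> N \<ge> 1 \<Longrightarrow>
    H1_norm \<alpha> \<gamma> (H1_diff \<alpha> \<gamma> X (H1_proj \<alpha> \<gamma> N X)) \<le> C * sqrt (real N) * H1_norm \<alpha> \<gamma> X"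
    using H1_projection_bound[OF \<alpha> \<gamma>] by metis
  then show "\<exists>C>0. \<forall>u\<in>H1_ball \<alpha> \<gamma>. \<forall>N\<ge>1.
            H1_norm \<alpha> \<gamma> (H1_diff \<alpha> \<gamma> u (H1_proj \<alpha> \<gamma> N u))
              \<le> C * real N powr (1/2) * H1_norm \<alpha> \<gamma> u"
    by (intro exI[of _ C] conjI ballI allI impI) (simp_all add: powr_half_sqrt)
  fix s :: real
  assume s: "s < 1/2" and "\<exists>C>0. \<forall>u\<in>H1_ball \<alpha> \<gamma>. \<forall>N\<ge>1.
                 H1_norm \<alpha> \<gamma> (H1_diff \<alpha> \<gamma> u (H1_proj \<alpha> \<gamma> N u))
                   \<le> C * real N powr s * H1_norm \<alpha> \<gamma> u"
  then obtain B where B: "B > 0" "\<And>X N. X \<in> H1_ball \<alpha> \<gamma> \<Longrightarrow> N \<ge> 1 \<Longrightarrow>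
      H1_norm \<alpha> \<gamma> (H1_diff \<alpha> \<gamma> X (H1_proj \<alpha> \<gamma> N X)) \<le> B * real N powr s * H1_norm \<alpha> \<gamma> X"
    by (elim exE conjE) simp
  obtain c where c: "c > 0" "\<And>m. \<exists>u\<in>C1_ball. C1_norm \<alpha> \<gamma> u > 0 \<and>
    c * (real m + 1) * (C1_norm \<alpha> \<gamma> u)\<^sup>2 \<le> (C1_norm \<alpha> \<gamma> (\<lambda>x. u x - poly_proj \<alpha> \<gamma> (2 * (m + 1)) u x))\<^sup>2"
    using large_projection_error[OF \<alpha> \<gamma>] by metis
  have bound: "real (2 * (m + 1)) powr (1 - 2 * s) \<le> 2 * B\<^sup>2 / c" for m
  proof -
    let ?N = "2 * (m + 1)"
    obtain u where u: "u \<in> C1_ball" "C1_norm \<alpha> \<gamma> u > 0"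
      "c * (real m + 1) * (C1_norm \<alpha> \<gamma> u)\<^sup>2 \<le> (C1_norm \<alpha> \<gamma> (\<lambda>x. u x - poly_proj \<alpha> \<gamma> ?N u x))\<^sup>2"
      using c(2)[of m] by (elim bexE conjE) simp
    note e = H1_projection_error_C1[OF \<alpha> \<gamma> u(1)]
    have "C1_norm \<alpha> \<gamma> (\<lambda>x. u x - poly_proj \<alpha> \<gamma> ?N u x) \<le> B * real ?N powr s * C1_norm \<alpha> \<gamma> u"
      using B(2)[OF e(3), of ?N] unfolding e(1) e(2) by simp
    then have "(C1_norm \<alpha> \<gamma> (\<lambda>x. u x - poly_proj \<alpha> \<gamma> ?N u x))\<^sup>2 \<le> (B * real ?N powr s * C1_norm \<alpha> \<gamma> u)\<^sup>2"
      by (intro power_mono) auto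
    then have "c * (real m + 1) * (C1_norm \<alpha> \<gamma> u)\<^sup>2 \<le> (B\<^sup>2 * (real ?N powr s)\<^sup>2) * (C1_norm \<alpha> \<gamma> u)\<^sup>2"
      using u(3) by (simp only: power_mult_distrib)
    then have "c * (real m + 1) \<le> B\<^sup>2 * (real ?N powr s)\<^sup>2" using u(2) by simp
    also have "(real ?N powr s)\<^sup>2 = real ?N powr (2 * s)"
      by (simp add: power2_eq_square powr_add[symmetric])
    finally have 1: "c * (real m + 1) \<le> B\<^sup>2 * real ?N powr (2 * s)" .
    have "c * real ?N = 2 * (c * (real m + 1))" by simp
    then have 1: "c * real ?N \<le> 2 * B\<^sup>2 * real ?N powr (2 * s)" using 1 by linarith
    have "real ?N powr (1 - 2 * s) = real ?N / real ?N powr (2 * s)" by (simp add: powr_diff)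
    also have "\<dots> \<le> 2 * B\<^sup>2 / c"
      using 1 c(1) by (simp add: divide_le_eq pos_le_divide_eq mult.commute)
    finally show ?thesis .
  qed
  define M where "M = 2 * B\<^sup>2 / c + 1"
  have M: "M > 0" using c(1) by (simp add: M_def add_nonneg_pos)
  obtain m where m: "M powr (1 / (1 - 2 * s)) \<le> real m" using real_arch_simple by blast
  have "M = (M powr (1 / (1 - 2 * s))) powr (1 - 2 * s)" using M s by (simp add: powr_powr)
  also have "\<dots> \<le> real (2 * (m + 1)) powr (1 - 2 * s)" using m s by (intro powr_mono2) auto
  finally have "real (2 * (m + 1)) powr (1 - 2 * s) \<ge> 2 * B\<^sup>2 / c + 1" by (simp only: M_def)
  with bound[of m] show False by linarith
qed

end
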